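(* Let $(E,D)=(B_p,\ell_p)$ for some $1<p<\infty$ or $(E,D)=(S_p,c_0)$ for some $1\le p<\infty$. Then $E$ is $C$-uniformly saturated with complemented copies of $D$ for every constant $C>1$.
   Context: Scalars are $\mathbb{K}\in\{\mathbb{R},\mathbb{C}\}$ and $\mathbb{N}=\{1,2,3,\ldots\}$. The Schreier sets are $\mathcal{S}_1=\{F\subset\mathbb{N}\text{ finite} : |F|\le\min F\}$, with the convention $\min\emptyset=0$. Let $c_{00}$ be the space of finitely supported elements of $\mathbb{K}^{\mathbb{N}}$. For $1\le p<\infty$, the $p$-th Schreier space $S_p$ is the completion of $c_{00}$ in the norm $\|x\|_{S_p}=\sup\{(\sum_{n\in F}|x(n)|^p)^{1/p} : F\in\mathcal{S}_1\setminus\{\emptyset\}\}$. For $1<p<\infty$, the $p$-th Baernstein space $B_p$ is the completion of $c_{00}$ in the norm $\|x\|_{B_p}=\sup\{(\sum_{j=1}^m(\sum_{n\in F_j}|x(n)|)^p)^{1/p} : m\in\mathbb{N},\ F_1,\ldots,F_m\in\mathcal{S}_1\setminus\{\emptyset\},\ \max F_j<\min F_{j+1}\text{ for }1\le j<m\}$. Definition. Let $X$ and $Y$ be Banach spaces and $C\ge1$. We say that $X$ is $C$-uniformly saturated with complemented copies of $Y$ if every closed, infinite-dimensional subspace of $X$ contains a closed subspace $Z$ for which (i) there exists an isomorphism $U$ of $Y$ onto $Z$ with $\|U\|\cdot\|U^{-1}\|\le C$, and (ii) there exists a (bounded linear) projection $P$ of $X$ onto $Z$ with $\|P\|\le C$.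 *)

theory Defs
  imports "HOL-Analysis.Analysis" "HOL-Library.Function_Algebras"
begin

section \<open>Normed spaces over a scalar field\<close>

text \<open>
  The space \<open>l_p\<close> depends on a real parameter and closed subspaces are themselves Banach spaces,
  so a normed space is a subspace \<open>vecs X\<close> of an ambient vector space (a type of class
  \<^class>\<open>ab_group_add\<close> with scalar multiplication \<open>smul X\<close>), together with a function \<open>nrm X\<close> that
  is a norm on \<open>vecs X\<close>. Its values outside \<open>vecs X\<close> are irrelevant. Addition is that of the
  type. Only the scalar fields \<^typ>\<open>real\<close> and \<^typ>\<open>complex\<close> are intended.
\<close>

record ('k, 'v) nspace =
  vecs :: "'v set"
  smul :: "'k \<Rightarrow> 'v \<Rightarrow> 'v"
  nrm :: "'v \<Rightarrow> real"

definition normed_space :: "('k::real_normed_field, 'v::ab_group_add) nspace \<Rightarrow> bool" where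
  "normed_space X \<longleftrightarrow>
     vector_space (smul X) \<and> module.subspace (smul X) (vecs X) \<and>
     (\<forall>x\<in>vecs X. 0 \<le> nrm X x \<and> (nrm X x = 0 \<longleftrightarrow> x = 0)) \<and>
     (\<forall>c. \<forall>x\<in>vecs X. nrm X (smul X c x) = norm c * nrm X x) \<and>
     (\<forall>x\<in>vecs X. \<forall>y\<in>vecs X. nrm X (x + y) \<le> nrm X x + nrm X y)"

text \<open>The guard makes \<open>ndist X\<close> nonnegative and symmetric on the whole type, as the locale
  \<^locale>\<open>Metric_space\<close> demands.\<close>

definition ndist :: "('k, 'v::ab_group_add) nspace \<Rightarrow> 'v \<Rightarrow> 'v \<Rightarrow> real" where
  "ndist X x y = (if x \<in> vecs X \<and> y \<in> vecs X then nrm X (x - y) else 0)"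

lemma Metric_space_ndist:
  assumes "normed_space X"
  shows "Metric_space (vecs X) (ndist X)"
proof -
  interpret vector_space "smul X"
    using assms by (simp add: normed_space_def)
  have sub: "subspace (vecs X)"
    and nonneg: "\<And>x. x \<in> vecs X \<Longrightarrow> 0 \<le> nrm X x"
    and zero: "\<And>x. x \<in> vecs X \<Longrightarrow> nrm X x = 0 \<longleftrightarrow> x = 0"
    and hom: "\<And>c x. x \<in> vecs X \<Longrightarrow> nrm X (smul X c x) = norm c * nrm X x"
    and tri: "\<And>x y. x \<in> vecs X \<Longrightarrow> y \<in> vecs X \<Longrightarrow> nrm X (x + y) \<le> nrm X x + nrm X y"
    using assms by (auto simp: normed_space_def)
  have diff: "x - y \<in> vecs X" if "x \<in> vecs X" "y \<in> vecs X" for x y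
    using sub that by (rule subspace_diff)
  have sym: "nrm X (x - y) = nrm X (y - x)" if "x \<in> vecs X" "y \<in> vecs X" for x y
    using hom[OF diff[OF that], of "- 1"] by (simp add: scale_minus_left)
  have "nrm X (x - z) \<le> nrm X (x - y) + nrm X (y - z)"
    if "x \<in> vecs X" "y \<in> vecs X" "z \<in> vecs X" for x y z
    using tri[OF diff[of x y] diff[of y z]] that by simp
  then show ?thesis
    by unfold_locales (auto simp: ndist_def nonneg diff sym zero)
qed

abbreviation ntopology :: "('k, 'v::ab_group_add) nspace \<Rightarrow> 'v topology" where
  "ntopology X \<equiv> Metric_space.mtopology (vecs X) (ndist X)"

definition banach_space :: "('k::real_normed_field, 'v::ab_group_add) nspace \<Rightarrow> bool" where
  "banach_space X \<longleftrightarrow> normed_space X \<and> Metric_space.mcomplete (vecs X) (ndist X)"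

definition closed_subspace :: "('k::real_normed_field, 'v::ab_group_add) nspace \<Rightarrow> 'v set \<Rightarrow> bool" where
  "closed_subspace X W \<longleftrightarrow> module.subspace (smul X) W \<and> closedin (ntopology X) W"

definition infinite_dimensional :: "('k::real_normed_field, 'v::ab_group_add) nspace \<Rightarrow> 'v set \<Rightarrow> bool" where
  "infinite_dimensional X W \<longleftrightarrow> \<not> (\<exists>B. finite B \<and> W \<subseteq> module.span (smul X) B)"

abbreviation restrict_space_to :: "('k, 'v) nspace \<Rightarrow> 'v set \<Rightarrow> ('k, 'v) nspace" where
  "restrict_space_to X Z \<equiv> X\<lparr>vecs := Z\<rparr>"

definition linear_between ::
  "('k, 'v::ab_group_add) nspace \<Rightarrow> ('k, 'w::ab_group_add) nspace \<Rightarrow> ('v \<Rightarrow> 'w) \<Rightarrow> bool" where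
  "linear_between X Y T \<longleftrightarrow>
     T ` vecs X \<subseteq> vecs Y \<and>
     (\<forall>x\<in>vecs X. \<forall>y\<in>vecs X. T (x + y) = T x + T y) \<and>
     (\<forall>c. \<forall>x\<in>vecs X. T (smul X c x) = smul Y c (T x))"

definition bounded_operator ::
  "('k, 'v::ab_group_add) nspace \<Rightarrow> ('k, 'w::ab_group_add) nspace \<Rightarrow> ('v \<Rightarrow> 'w) \<Rightarrow> bool" where
  "bounded_operator X Y T \<longleftrightarrow>
     linear_between X Y T \<and> (\<exists>K. \<forall>x\<in>vecs X. nrm Y (T x) \<le> K * nrm X x)"

definition opnorm ::
  "('k, 'v::ab_group_add) nspace \<Rightarrow> ('k, 'w::ab_group_add) nspace \<Rightarrow> ('v \<Rightarrow> 'w) \<Rightarrow> real" where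
  "opnorm X Y T = Sup {nrm Y (T x) | x. x \<in> vecs X \<and> nrm X x \<le> 1}"

definition isomorphism_onto ::
  "('k, 'v::ab_group_add) nspace \<Rightarrow> ('k, 'w::ab_group_add) nspace \<Rightarrow> ('v \<Rightarrow> 'w) \<Rightarrow> bool" where
  "isomorphism_onto X Y U \<longleftrightarrow>
     bij_betw U (vecs X) (vecs Y) \<and> bounded_operator X Y U \<and>
     bounded_operator Y X (inv_into (vecs X) U)"

definition projection_onto ::
  "('k, 'v::ab_group_add) nspace \<Rightarrow> 'v set \<Rightarrow> ('v \<Rightarrow> 'v) \<Rightarrow> bool" where
  "projection_onto X Z P \<longleftrightarrow>
     bounded_operator X X P \<and> P ` vecs X = Z \<and> (\<forall>z\<in>Z. P z = z)"

definition uniformly_saturated_complemented ::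
  "real \<Rightarrow> ('k::real_normed_field, 'v::ab_group_add) nspace \<Rightarrow> ('k, 'w::ab_group_add) nspace \<Rightarrow> bool" where
  "uniformly_saturated_complemented C X Y \<longleftrightarrow>
     (\<forall>W. closed_subspace X W \<and> infinite_dimensional X W \<longrightarrow>
       (\<exists>Z. closed_subspace X Z \<and> Z \<subseteq> W \<and>
         (\<exists>U. isomorphism_onto Y (restrict_space_to X Z) U \<and>
            opnorm Y (restrict_space_to X Z) U *
              opnorm (restrict_space_to X Z) Y (inv_into (vecs Y) U) \<le> C) \<and>
         (\<exists>P. projection_onto X Z P \<and> opnorm X X P \<le> C)))"

definition completion_of ::
  "('k::real_normed_field, 'v::ab_group_add) nspace \<Rightarrow> ('k, 'w::ab_group_add) nspace \<Rightarrow> bool" where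
  "completion_of X E \<longleftrightarrow>
     banach_space E \<and>
     (\<exists>\<iota>. linear_between X E \<iota> \<and> (\<forall>x\<in>vecs X. nrm E (\<iota> x) = nrm X x) \<and>
          ntopology E closure_of (\<iota> ` vecs X) = vecs E)"


section \<open>Sequence spaces\<close>

text \<open>
  Sequences are indexed by the positive integers: an element of \<open>K\<^sup>N\<close> is encoded as a function
  \<open>x\<close> on \<^typ>\<open>nat\<close> with \<open>x 0 = 0\<close>. Addition is pointwise, from Function_Algebras.
\<close>

definition seq_scale :: "'k::real_normed_field \<Rightarrow> (nat \<Rightarrow> 'k) \<Rightarrow> (nat \<Rightarrow> 'k)" where
  "seq_scale c x = (\<lambda>n. c * x n)"

definition c00 :: "(nat \<Rightarrow> 'k::real_normed_field) set" where
  "c00 = {x. x 0 = 0 \<and> finite {n. x n \<noteq> 0}}"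

definition c00_with :: "((nat \<Rightarrow> 'k::real_normed_field) \<Rightarrow> real) \<Rightarrow> ('k, nat \<Rightarrow> 'k) nspace" where
  "c00_with N = \<lparr>vecs = c00, smul = seq_scale, nrm = N\<rparr>"

definition ell :: "real \<Rightarrow> ('k::real_normed_field, nat \<Rightarrow> 'k) nspace" where
  "ell p = \<lparr>vecs = {x. x 0 = 0 \<and> summable (\<lambda>n. norm (x n) powr p)},
            smul = seq_scale,
            nrm = (\<lambda>x. (\<Sum>n. norm (x n) powr p) powr (1 / p))\<rparr>"

definition c_null :: "('k::real_normed_field, nat \<Rightarrow> 'k) nspace" where
  "c_null = \<lparr>vecs = {x. x 0 = 0 \<and> x \<longlonglongrightarrow> 0},
             smul = seq_scale,
             nrm = (\<lambda>x. SUP n. norm (x n))\<rparr>"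

definition schreier_sets :: "nat set set" where
  "schreier_sets = {F. finite F \<and> 0 \<notin> F \<and> (F = {} \<or> card F \<le> Min F)}"

definition schreier_norm :: "real \<Rightarrow> (nat \<Rightarrow> 'k::real_normed_field) \<Rightarrow> real" where
  "schreier_norm p x =
     Sup {(\<Sum>n\<in>F. norm (x n) powr p) powr (1 / p) | F. F \<in> schreier_sets - {{}}}"

definition baernstein_norm :: "real \<Rightarrow> (nat \<Rightarrow> 'k::real_normed_field) \<Rightarrow> real" where
  "baernstein_norm p x =
     Sup {(\<Sum>j=1..m. (\<Sum>n\<in>F j. norm (x n)) powr p) powr (1 / p) | (m::nat) (F::nat \<Rightarrow> nat set).
            1 \<le> m \<and> (\<forall>j\<in>{1..m}. F j \<in> schreier_sets - {{}}) \<and>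
            (\<forall>j\<in>{1..<m}. Max (F j) < Min (F (j + 1)))}"

end

theory Submission
  imports Defs
begin

text \<open>
  Let \<open>W\<close> be a closed infinite-dimensional subspace of the completion \<open>E\<close> of \<open>c00\<close> in one of the two
  norms \<open>N\<close>, and let \<open>\<phi> s t\<close> be the norm of the pair \<open>(s, t)\<close> in the target space \<open>D\<close>: the p-norm for
  \<open>l_p\<close> and the maximum for \<open>c_0\<close>. Both norms satisfy, for \<open>y\<close> supported in \<open>[1, m]\<close> and \<open>z\<close> supported in
  \<open>(m, \<infinity>)\<close>, the two estimates
  \<open>\<phi> (N y) (N z) \<le> N (y + z) \<le> \<phi> (N y) (N z) + m * sup |z|\<close>.
  The second one holds because a Schreier set that meets \<open>[1, m]\<close> has at most \<open>m\<close> elements. So a vector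
  that lies far out and is flat, meaning that its entries are small compared with \<open>1 / m\<close>, joins \<open>y\<close>
  almost as a new coordinate joins a vector of \<open>D\<close>.

  Every such \<open>W\<close> contains vectors close to normalised flat blocks lying arbitrarily far out
  (\<open>flat_near_block_exists\<close>): the sum of many successive blocks has a large norm and bounded entries.
  One selects \<open>w 1, w 2, \<dots>\<close> in \<open>W\<close> close to successive flat blocks \<open>x 1, x 2, \<dots>\<close>
  (\<open>block_sequence_exists\<close>). By the upper estimate the operator \<open>U\<close> that maps \<open>a\<close> to the sum of the
  \<open>a k w k\<close> is bounded on \<open>D\<close> with norm near one (\<open>norm_w_sum_le\<close>). Functionals norming the blocks, each
  depending only on the coordinates in the interval of its block, define by the lower estimate an
  operator from \<open>E\<close> into \<open>D\<close> of norm near one (\<open>initial_norm_F\<close>). Applied to the \<open>w j\<close> they form a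
  triangular matrix close to the identity, and a small triangular correction of the functionals
  (\<open>biorthogonal\<close>) yields \<open>V\<close> with \<open>V \<circ> U = id\<close>. The range of \<open>U\<close> is then the desired copy of \<open>D\<close>,
  complemented by \<open>U \<circ> V\<close> (\<open>complemented_copy_if_identity_factors\<close>).

  The two norms are treated together as suprema over families \<open>G\<close> of disjoint finite sets of the
  p-norm of the vector of \<open>l_1\<close>-norms of the restrictions to the members of \<open>G\<close>. For the Baernstein
  norm the families consist of successive Schreier sets, for the Schreier norm of the singletons in
  one Schreier set.
\<close>


section \<open>Operators and convergence in an abstract Banach space\<close>

lemma opnorm_le:
  assumes "0 \<in> vecs X" "nrm X 0 \<le> 1" "0 \<le> M" and le: "\<And>x. x \<in> vecs X \<Longrightarrow> nrm Y (T x) \<le> M * nrm X x"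
  shows "opnorm X Y T \<le> M"
  unfolding opnorm_def
proof (rule cSup_least)
  show "{nrm Y (T x) |x. x \<in> vecs X \<and> nrm X x \<le> 1} \<noteq> {}"
    using assms by blast
  show "z \<le> M" if "z \<in> {nrm Y (T x) |x. x \<in> vecs X \<and> nrm X x \<le> 1}" for z
    using that \<open>0 \<le> M\<close> by (auto intro: order_trans[OF le] mult_left_le)
qed

locale banach_nspace =
  fixes E :: "('k::{real_normed_field,banach}, 'e::ab_group_add) nspace"
  assumes banach: "banach_space E"
begin

lemma normed: "normed_space E"
  using banach by (simp add: banach_space_def)

sublocale vs: vector_space "smul E"
  using normed by (simp add: normed_space_def)

sublocale Metric_space "vecs E" "ndist E"
  by (rule Metric_space_ndist[OF normed])

lemma subspace_vecs: "vs.subspace (vecs E)"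
  using normed by (simp add: normed_space_def)

lemma vecs_0 [simp]: "0 \<in> vecs E"
  using subspace_vecs vs.subspace_0 by blast

lemma vecs_add [simp]: "x \<in> vecs E \<Longrightarrow> y \<in> vecs E \<Longrightarrow> x + y \<in> vecs E"
  using subspace_vecs vs.subspace_add by blast

lemma vecs_diff [simp]: "x \<in> vecs E \<Longrightarrow> y \<in> vecs E \<Longrightarrow> x - y \<in> vecs E"
  using subspace_vecs vs.subspace_diff by blast

lemma vecs_scale [simp]: "x \<in> vecs E \<Longrightarrow> smul E c x \<in> vecs E"
  using subspace_vecs vs.subspace_scale by blast

lemma vecs_sum: "(\<And>i. i \<in> I \<Longrightarrow> u i \<in> vecs E) \<Longrightarrow> sum u I \<in> vecs E"
  using subspace_vecs vs.subspace_sum by blast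

lemma nrm_ge_0 [simp]: "x \<in> vecs E \<Longrightarrow> 0 \<le> nrm E x"
  and nrm_eq_0: "x \<in> vecs E \<Longrightarrow> nrm E x = 0 \<longleftrightarrow> x = 0"
  and nrm_scale: "x \<in> vecs E \<Longrightarrow> nrm E (smul E c x) = norm c * nrm E x"
  and nrm_triangle: "x \<in> vecs E \<Longrightarrow> y \<in> vecs E \<Longrightarrow> nrm E (x + y) \<le> nrm E x + nrm E y"
  using normed by (simp_all add: normed_space_def)

lemma nrm_0 [simp]: "nrm E 0 = 0"
  by (simp add: nrm_eq_0)

lemma nrm_sum:
  assumes "finite I" "\<And>i. i \<in> I \<Longrightarrow> u i \<in> vecs E"
  shows "nrm E (sum u I) \<le> (\<Sum>i\<in>I. nrm E (u i))"
  using assms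
proof (induction I rule: finite_induct)
  case (insert i I)
  have "nrm E (u i + sum u I) \<le> nrm E (u i) + nrm E (sum u I)"
    using insert by (intro nrm_triangle vecs_sum) auto
  also have "\<dots> \<le> nrm E (u i) + (\<Sum>i\<in>I. nrm E (u i))"
    using insert by auto
  finally show ?case
    using insert by simp
qed simp

lemma nrm_minus_commute: "x \<in> vecs E \<Longrightarrow> y \<in> vecs E \<Longrightarrow> nrm E (x - y) = nrm E (y - x)"
  using commute[of x y] by (simp add: ndist_def)

lemma nrm_diff_triangle:
  "x \<in> vecs E \<Longrightarrow> y \<in> vecs E \<Longrightarrow> z \<in> vecs E \<Longrightarrow> nrm E (x - z) \<le> nrm E (x - y) + nrm E (y - z)"
  using triangle[of x y z] by (simp add: ndist_def)

lemma nrm_le_nrm_add_diff: "x \<in> vecs E \<Longrightarrow> y \<in> vecs E \<Longrightarrow> nrm E x \<le> nrm E y + nrm E (x - y)"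
  using nrm_triangle[of y "x - y"] by simp

lemma limitin_iff_nrm:
  assumes "\<And>n. s n \<in> vecs E" "x \<in> vecs E"
  shows "limitin mtopology s x sequentially \<longleftrightarrow> (\<lambda>n. nrm E (s n - x)) \<longlonglongrightarrow> 0"
  using assms by (simp add: limitin_metric ndist_def tendsto_iff)

lemma Cauchy_imp_limit:
  assumes s: "\<And>n. s n \<in> vecs E"
    and cauchy: "\<And>\<epsilon>. \<epsilon> > 0 \<Longrightarrow> \<exists>M. \<forall>m\<ge>M. \<forall>n\<ge>M. nrm E (s m - s n) < \<epsilon>"
  obtains x where "x \<in> vecs E" "(\<lambda>n. nrm E (s n - x)) \<longlonglongrightarrow> 0"
proof -
  have "MCauchy s"
    unfolding MCauchy_def using s cauchy by (fastforce simp: ndist_def)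
  then obtain x where x: "limitin mtopology s x sequentially"
    using banach by (auto simp: banach_space_def mcomplete_def)
  moreover have "x \<in> vecs E"
    using x by (simp add: limitin_metric)
  ultimately show thesis
    using that limitin_iff_nrm[of s x] s by simp
qed

lemma limit_unique:
  assumes "\<And>n. s n \<in> vecs E" "x \<in> vecs E" "y \<in> vecs E"
    and "(\<lambda>n. nrm E (s n - x)) \<longlonglongrightarrow> 0" "(\<lambda>n. nrm E (s n - y)) \<longlonglongrightarrow> 0"
  shows "x = y"
proof -
  have "limitin mtopology s x sequentially" "limitin mtopology s y sequentially"
    using assms limitin_iff_nrm by blast+
  then show ?thesis
    using limitin_metric_unique by (metis trivial_limit_sequentially)
qed

lemma closed_subspace_vecs: "closed_subspace E W \<Longrightarrow> W \<subseteq> vecs E"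
  by (simp add: closed_subspace_def closedin_metric)

lemma closed_subspace_limit:
  assumes "closed_subspace E W" "\<And>n. s n \<in> W" "x \<in> vecs E" "(\<lambda>n. nrm E (s n - x)) \<longlonglongrightarrow> 0"
  shows "x \<in> W"
proof -
  have "\<And>n. s n \<in> vecs E"
    using assms closed_subspace_vecs by blast
  then have "limitin mtopology s x sequentially"
    using assms limitin_iff_nrm by blast
  then show ?thesis
    using assms(1,2) unfolding closed_subspace_def metric_closedin_iff_sequentially_closed by blast
qed

lemma closed_subspaceI:
  assumes "vs.subspace W" "W \<subseteq> vecs E"
    and lim: "\<And>s x. (\<And>n. s n \<in> W) \<Longrightarrow> x \<in> vecs E \<Longrightarrow> (\<lambda>n. nrm E (s n - x)) \<longlonglongrightarrow> 0 \<Longrightarrow> x \<in> W"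
  shows "closed_subspace E W"
  unfolding closed_subspace_def metric_closedin_iff_sequentially_closed
proof (intro conjI allI impI)
  fix s l assume s: "range s \<subseteq> W \<and> limitin mtopology s l sequentially"
  then have "\<And>n. s n \<in> W" "l \<in> vecs E"
    by (auto simp: limitin_metric)
  moreover from this have "(\<lambda>n. nrm E (s n - l)) \<longlonglongrightarrow> 0"
    using s assms(2) limitin_iff_nrm[of s l] by blast
  ultimately show "l \<in> W"
    by (rule lim)
qed (use assms in auto)

text \<open>
  If the identity of \<open>D\<close> factors as \<open>V \<circ> U\<close> through \<open>E\<close>, then \<open>U \<circ> V\<close> is a projection of \<open>E\<close> onto
  the range of \<open>U\<close>, and \<open>V\<close> restricted to that range inverts \<open>U\<close>. The range is closed because it is
  the set of fixed points of the continuous map \<open>U \<circ> V\<close>.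
\<close>

lemma complemented_copy_if_identity_factors:
  fixes D :: "('k, 'd::ab_group_add) nspace"
  assumes K: "1 \<le> K" and U: "linear_between D E U" and V: "linear_between E D V"
    and nU: "\<And>a. a \<in> vecs D \<Longrightarrow> nrm E (U a) \<le> K * nrm D a"
    and nV: "\<And>x. x \<in> vecs E \<Longrightarrow> nrm D (V x) \<le> K * nrm E x"
    and nonneg: "\<And>a. a \<in> vecs D \<Longrightarrow> 0 \<le> nrm D a"
    and VU: "\<And>a. a \<in> vecs D \<Longrightarrow> V (U a) = a"
    and UW: "\<And>a. a \<in> vecs D \<Longrightarrow> U a \<in> W"
    and KC: "K * K \<le> C"
  shows "\<exists>Z. closed_subspace E Z \<and> Z \<subseteq> W \<and>
         (\<exists>U. isomorphism_onto D (restrict_space_to E Z) U \<and>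
            opnorm D (restrict_space_to E Z) U *
              opnorm (restrict_space_to E Z) D (inv_into (vecs D) U) \<le> C) \<and>
         (\<exists>P. projection_onto E Z P \<and> opnorm E E P \<le> C)"
proof -
  define Z where "Z = U ` vecs D"
  define P where "P x = U (V x)" for x
  let ?Z = "restrict_space_to E Z"
  let ?I = "inv_into (vecs D) U"
  have UE: "a \<in> vecs D \<Longrightarrow> U a \<in> vecs E" for a
    using U by (auto simp: linear_between_def)
  have VD: "x \<in> vecs E \<Longrightarrow> V x \<in> vecs D" for x
    using V by (auto simp: linear_between_def)
  have inj: "inj_on U (vecs D)"
    using VU by (metis inj_on_inverseI)
  have inv: "?I z = V z" if "z \<in> Z" for z
    using that inj VU by (auto simp: Z_def)
  have ZE: "Z \<subseteq> vecs E"
    using UE by (auto simp: Z_def)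
  have Z_iff: "z \<in> Z \<longleftrightarrow> z \<in> vecs E \<and> P z = z" for z
  proof
    show "z \<in> vecs E \<and> P z = z" if "z \<in> Z"
      using that VU UE by (auto simp: Z_def P_def)
    show "z \<in> Z" if "z \<in> vecs E \<and> P z = z"
      using that imageI[OF VD, of z U] by (simp add: Z_def P_def)
  qed
  have P_add: "P (x + y) = P x + P y" if "x \<in> vecs E" "y \<in> vecs E" for x y
    using U V that VD by (simp add: P_def linear_between_def)
  have P_scale: "P (smul E c x) = smul E c (P x)" if "x \<in> vecs E" for x c
    using U V that VD by (simp add: P_def linear_between_def)
  have PE: "P x \<in> vecs E" if "x \<in> vecs E" for x
    using UE VD that by (simp add: P_def)
  have P_bound: "nrm E (P x) \<le> (K * K) * nrm E x" if "x \<in> vecs E" for x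
  proof -
    have "nrm E (P x) \<le> K * nrm D (V x)"
      using nU VD that by (simp add: P_def)
    also have "\<dots> \<le> K * (K * nrm E x)"
      using nV[OF that] K by (intro mult_left_mono) auto
    finally show ?thesis
      by (simp add: mult.assoc)
  qed
  have P_0: "P 0 = 0"
    using P_add[of 0 0] by simp
  have subZ: "vs.subspace Z"
    unfolding vs.subspace_def
    using P_0 P_add P_scale by (simp add: Z_iff)
  have closed: "closed_subspace E Z"
  proof (rule closed_subspaceI[OF subZ ZE])
    fix s x assume s: "\<And>n. s n \<in> Z" and x: "x \<in> vecs E" and lim: "(\<lambda>n. nrm E (s n - x)) \<longlonglongrightarrow> 0"
    have sE: "s n \<in> vecs E" for n
      using s ZE by blast
    have "P (s n - x) = s n - P x" for n
      using P_add[of "s n - x" x] s[of n] sE[of n] x by (simp add: Z_iff algebra_simps)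
    then have *: "nrm E (s n - P x) \<le> (K * K) * nrm E (s n - x)" for n
      using P_bound[of "s n - x"] sE[of n] x by simp
    have "(\<lambda>n. nrm E (s n - P x)) \<longlonglongrightarrow> 0"
    proof (rule tendsto_sandwich[OF _ _ tendsto_const])
      show "(\<lambda>n. (K * K) * nrm E (s n - x)) \<longlonglongrightarrow> 0"
        using tendsto_mult_left[OF lim, of "K * K"] by simp
    qed (use * sE x PE in auto)
    then have "P x = x"
      using limit_unique[of s "P x" x] sE x PE lim by blast
    then show "x \<in> Z"
      using x by (simp add: Z_iff)
  qed
  have V0: "V 0 = 0"
    using V unfolding linear_between_def by (metis add_cancel_right_right vecs_0)
  have U0: "U 0 = 0"
    using P_0 V0 by (simp add: P_def)
  have D0: "0 \<in> vecs D" "nrm D 0 = 0"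
    using VD[of 0] nV[of 0] nonneg V0 by (auto intro: antisym)
  have iso: "isomorphism_onto D ?Z U"
    unfolding isomorphism_onto_def bounded_operator_def
  proof (intro conjI)
    show "bij_betw U (vecs D) (vecs ?Z)"
      using inj by (simp add: bij_betw_def Z_def)
    show "linear_between D ?Z U"
      using U by (simp add: linear_between_def Z_def)
    show "\<exists>K. \<forall>x\<in>vecs D. nrm ?Z (U x) \<le> K * nrm D x"
      using nU by auto
    show "linear_between ?Z D ?I"
      using V subZ ZE unfolding linear_between_def
      by (auto simp: inv vs.subspace_add vs.subspace_scale subset_iff)
    show "\<exists>K. \<forall>x\<in>vecs ?Z. nrm D (?I x) \<le> K * nrm ?Z x"
      using nV ZE by (auto simp: inv intro!: exI[of _ K])
  qed
  have "opnorm D ?Z U \<le> K"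
    using K D0 nU by (intro opnorm_le) auto
  moreover have "opnorm ?Z D ?I \<le> K"
    using K nV ZE vs.subspace_0[OF subZ] by (intro opnorm_le) (auto simp: inv)
  moreover have "0 \<le> opnorm ?Z D ?I"
    unfolding opnorm_def
  proof (rule cSup_upper2)
    show "nrm D (?I 0) \<in> {nrm D (?I x) |x. x \<in> vecs ?Z \<and> nrm ?Z x \<le> 1}"
      using vs.subspace_0[OF subZ] by auto
    show "0 \<le> nrm D (?I 0)"
      using vs.subspace_0[OF subZ] by (simp add: inv V0 D0)
    show "bdd_above {nrm D (?I x) |x. x \<in> vecs ?Z \<and> nrm ?Z x \<le> 1}"
    proof (rule bdd_aboveI)
      fix y assume "y \<in> {nrm D (?I x) |x. x \<in> vecs ?Z \<and> nrm ?Z x \<le> 1}"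
      then obtain x where x: "x \<in> Z" "y = nrm D (V x)" "nrm E x \<le> 1"
        by (auto simp: inv)
      then show "y \<le> K"
        using order_trans[OF nV[of x], of K] ZE K by (auto intro: mult_left_le)
    qed
  qed
  ultimately have "opnorm D ?Z U * opnorm ?Z D ?I \<le> K * K"
    using K by (intro mult_mono) auto
  then have 1: "opnorm D ?Z U * opnorm ?Z D ?I \<le> C"
    using KC by linarith
  have "projection_onto E Z P"
    unfolding projection_onto_def bounded_operator_def linear_between_def
  proof (intro conjI)
    show "P ` vecs E = Z"
      using VD VU UE by (force simp: Z_iff P_def image_iff)
    show "\<exists>K. \<forall>x\<in>vecs E. nrm E (P x) \<le> K * nrm E x"
      using P_bound by auto
  qed (use PE P_add P_scale Z_iff in auto)
  moreover have "opnorm E E P \<le> C"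
    using opnorm_le[of E "K * K" E P] P_bound KC K by auto
  moreover have "Z \<subseteq> W"
    using UW by (auto simp: Z_def)
  ultimately show ?thesis
    using closed iso 1 by blast
qed

text \<open>
  Cutting an infinite-dimensional space with the kernels of finitely many functionals leaves a
  nonzero vector, because each cut lowers the dimension by at most one.
\<close>

lemma infinite_dimensional_kernels:
  assumes inf: "infinite_dimensional E W" and sub: "vs.subspace W" and WE: "W \<subseteq> vecs E"
    and add: "\<And>n x y. x \<in> vecs E \<Longrightarrow> y \<in> vecs E \<Longrightarrow> h n (x + y) = h n x + h n y"
    and scale: "\<And>n c x. x \<in> vecs E \<Longrightarrow> h n (smul E c x) = c * (h n x :: 'k)"
  obtains w where "w \<in> W" "w \<noteq> 0" "\<And>n. n < (m::nat) \<Longrightarrow> h n w = 0"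
proof -
  define W' where "W' m = {w\<in>W. \<forall>n<m. h n w = 0}" for m
  have W'W: "W' m \<subseteq> W" for m
    by (auto simp: W'_def)
  have "\<not> (\<exists>B. finite B \<and> W' m \<subseteq> vs.span B)"
  proof (induction m)
    case 0
    show ?case
      using inf by (simp add: W'_def infinite_dimensional_def)
  next
    case (Suc m)
    show ?case
    proof
      assume "\<exists>B. finite B \<and> W' (Suc m) \<subseteq> vs.span B"
      then obtain B where B: "finite B" "W' (Suc m) \<subseteq> vs.span B"
        by blast
      show False
      proof (cases "\<exists>v\<in>W' m. h m v \<noteq> 0")
        case False
        then have "W' m \<subseteq> W' (Suc m)"
          by (auto simp: W'_def less_Suc_eq)
        then show False
          using Suc.IH B by blast
      next
        case True
        then obtain v where v: "v \<in> W' m" "h m v \<noteq> 0"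
          by blast
        have "w \<in> vs.span (insert v B)" if w: "w \<in> W' m" for w
        proof -
          define t where "t = h m w / h m v"
          define u where "u = w - smul E t v"
          have uW: "u \<in> W"
            using W'W v w sub by (auto simp: u_def intro!: vs.subspace_diff vs.subspace_scale)
          have E: "w \<in> vecs E" "v \<in> vecs E" "u \<in> vecs E"
            using W'W WE v w uW by blast+
          have hw: "h n w = h n u + t * h n v" for n
            using add[of u "smul E t v" n] scale[of v n t] E by (simp add: u_def)
          have "h n u = 0" if "n < Suc m" for n
            using hw[of n] v w that by (cases "n = m") (auto simp: t_def W'_def)
          then have "u \<in> vs.span B"
            using uW B by (auto simp: W'_def)
          then have "u \<in> vs.span (insert v B)"
            using vs.span_mono[of B "insert v B"] by blast
          moreover have "smul E t v \<in> vs.span (insert v B)"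
            by (simp add: vs.span_base vs.span_scale)
          ultimately have "u + smul E t v \<in> vs.span (insert v B)"
            by (rule vs.span_add)
          then show ?thesis
            by (simp add: u_def)
        qed
        then show False
          using Suc.IH B(1) by (meson finite_insert subsetI)
      qed
    qed
  qed
  then have "\<not> W' m \<subseteq> {0}"
    by (metis finite.emptyI vs.span_empty)
  then show thesis
    using that by (auto simp: W'_def)
qed

end


section \<open>Finitely supported sequences\<close>

lemma c00_0 [simp]: "0 \<in> c00"
  by (simp add: c00_def)

lemma c00_add [simp]:
  assumes "x \<in> c00" "y \<in> c00"
  shows "x + y \<in> c00"
proof -
  have "{n. (x + y) n \<noteq> 0} \<subseteq> {n. x n \<noteq> 0} \<union> {n. y n \<noteq> 0}"
    by auto
  then have "finite {n. (x + y) n \<noteq> 0}"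
    by (rule finite_subset) (use assms in \<open>simp add: c00_def\<close>)
  then show ?thesis
    using assms by (simp add: c00_def)
qed

lemma c00_scale [simp]:
  assumes "x \<in> c00"
  shows "seq_scale c x \<in> c00"
proof -
  have "{n. seq_scale c x n \<noteq> 0} \<subseteq> {n. x n \<noteq> 0}"
    by (auto simp: seq_scale_def)
  then have "finite {n. seq_scale c x n \<noteq> 0}"
    by (rule finite_subset) (use assms in \<open>simp add: c00_def\<close>)
  moreover have "seq_scale c x 0 = 0"
    using assms by (simp add: c00_def seq_scale_def)
  ultimately show ?thesis
    by (simp add: c00_def)
qed

lemma c00_diff [simp]:
  assumes "x \<in> c00" "y \<in> c00"
  shows "x - y \<in> c00"
proof -
  have diff: "x - y = x + seq_scale (- 1) y"
    by (auto simp: seq_scale_def)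
  show ?thesis
    unfolding diff using assms by (intro c00_add c00_scale)
qed

lemma c00_sum: "(\<And>i. i \<in> I \<Longrightarrow> u i \<in> c00) \<Longrightarrow> sum u I \<in> c00"
  by (induction I rule: infinite_finite_induct) auto

definition keep :: "nat set \<Rightarrow> (nat \<Rightarrow> 'k::zero) \<Rightarrow> nat \<Rightarrow> 'k" where
  "keep A x = (\<lambda>n. if n \<in> A then x n else 0)"

lemma c00_keep [simp]:
  assumes "x \<in> c00"
  shows "keep A x \<in> c00"
proof -
  have "{n. keep A x n \<noteq> 0} \<subseteq> {n. x n \<noteq> 0}"
    by (auto simp: keep_def)
  then have "finite {n. keep A x n \<noteq> 0}"
    by (rule finite_subset) (use assms in \<open>simp add: c00_def\<close>)
  moreover have "keep A x 0 = 0"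
    using assms by (simp add: c00_def keep_def)
  ultimately show ?thesis
    by (simp add: c00_def)
qed

lemma c00_bounded:
  assumes "x \<in> c00"
  obtains m where "\<And>n. x n \<noteq> 0 \<Longrightarrow> n \<le> m"
  using assms finite_nat_set_iff_bounded_le[of "{n. x n \<noteq> 0}"] by (auto simp: c00_def)

definition unit_seq :: "nat \<Rightarrow> nat \<Rightarrow> 'k::zero_neq_one" where
  "unit_seq n = (\<lambda>i. if i = n then 1 else 0)"

lemma unit_seq_c00: "n \<noteq> 0 \<Longrightarrow> unit_seq n \<in> c00"
  by (simp add: unit_seq_def c00_def)

lemma sum_fun_apply: "(sum u I) n = (\<Sum>i\<in>I. u i n)"
  by (induction I rule: infinite_finite_induct) auto

lemma keep_initial_eq_sum:
  assumes "x \<in> c00"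
  shows "keep {..m} x = (\<Sum>n=1..m. seq_scale (x n) (unit_seq n))"
proof
  fix i
  have "x 0 = 0"
    using assms by (simp add: c00_def)
  have "(\<Sum>n=1..m. seq_scale (x n) (unit_seq n) i) = (\<Sum>n=1..m. if n = i then x n else 0)"
    by (intro sum.cong) (auto simp: seq_scale_def unit_seq_def)
  also have "\<dots> = keep {..m} x i"
    using \<open>x 0 = 0\<close> by (cases "i = 0") (auto simp: keep_def)
  finally show "keep {..m} x i = (\<Sum>n=1..m. seq_scale (x n) (unit_seq n)) i"
    by (simp add: sum_fun_apply)
qed


section \<open>Sequence norms built by adding one coordinate at a time\<close>

text \<open>
  \<open>\<phi> s t\<close> is to be thought of as the norm of a pair. The last condition bounds the effect of a
  perturbation of either entry; it replaces the full triangle inequality.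
\<close>

locale joining =
  fixes \<phi> :: "real \<Rightarrow> real \<Rightarrow> real"
  assumes \<phi>_mono: "0 \<le> s \<Longrightarrow> s \<le> s' \<Longrightarrow> 0 \<le> t \<Longrightarrow> t \<le> t' \<Longrightarrow> \<phi> s t \<le> \<phi> s' t'"
    and \<phi>_scale: "0 \<le> c \<Longrightarrow> 0 \<le> s \<Longrightarrow> 0 \<le> t \<Longrightarrow> \<phi> (c * s) (c * t) = c * \<phi> s t"
    and \<phi>_ge1: "0 \<le> s \<Longrightarrow> 0 \<le> t \<Longrightarrow> s \<le> \<phi> s t"
    and \<phi>_ge2: "0 \<le> s \<Longrightarrow> 0 \<le> t \<Longrightarrow> t \<le> \<phi> s t"
    and \<phi>_add: "0 \<le> s \<Longrightarrow> 0 \<le> t \<Longrightarrow> 0 \<le> s' \<Longrightarrow> 0 \<le> t' \<Longrightarrow> \<phi> (s + s') (t + t') \<le> \<phi> s t + s' + t'"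
begin

primrec initial_norm :: "(nat \<Rightarrow> 'k::real_normed_vector) \<Rightarrow> nat \<Rightarrow> real" where
  "initial_norm a 0 = 0"
| "initial_norm a (Suc n) = \<phi> (initial_norm a n) (norm (a (Suc n)))"

lemma initial_norm_nonneg [simp]: "0 \<le> initial_norm a n"
proof (induction n)
  case (Suc n)
  show ?case
    using order_trans[OF Suc \<phi>_ge1[OF Suc norm_ge_zero]] by simp
qed simp

lemma norm_le_initial_norm: "1 \<le> k \<Longrightarrow> k \<le> n \<Longrightarrow> norm (a k) \<le> initial_norm a n"
proof (induction n)
  case (Suc n)
  show ?case
  proof (cases "k = Suc n")
    case True
    then show ?thesis
      using \<phi>_ge2 by simp
  next
    case False
    then have "norm (a k) \<le> initial_norm a n"
      using Suc by simp
    also have "\<dots> \<le> initial_norm a (Suc n)"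
      using \<phi>_ge1 by simp
    finally show ?thesis .
  qed
qed simp

lemma initial_norm_add: "initial_norm (\<lambda>k. a k + b k) n \<le> initial_norm a n + (\<Sum>k=1..n. norm (b k))"
proof (induction n)
  case (Suc n)
  have "initial_norm (\<lambda>k. a k + b k) (Suc n)
      \<le> \<phi> (initial_norm a n + (\<Sum>k=1..n. norm (b k))) (norm (a (Suc n)) + norm (b (Suc n)))"
    using Suc by (auto intro: \<phi>_mono norm_triangle_ineq)
  also have "\<dots> \<le> initial_norm a (Suc n) + (\<Sum>k=1..n. norm (b k)) + norm (b (Suc n))"
    by (simp add: \<phi>_add sum_nonneg)
  finally show ?case
    by simp
qed simp

end


section \<open>Norms for which far-out flat vectors behave like unit vectors\<close>

text \<open>
  \<open>growth\<close> forces sums of many successive blocks to be large, \<open>lower\<close> and \<open>upper\<close> compare a flat vector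
  lying beyond \<open>m\<close> with one extra coordinate, and \<open>norming\<close> provides functionals that depend only on
  the coordinates in the support of the vector they norm, given by their coefficients \<open>c\<close>.
\<close>

locale block_norm = joining \<phi> for \<phi> +
  fixes N :: "(nat \<Rightarrow> 'k::{real_normed_field,banach}) \<Rightarrow> real"
  assumes coord_le: "z \<in> c00 \<Longrightarrow> norm (z n) \<le> N z"
    and keep_le: "z \<in> c00 \<Longrightarrow> N (keep A z) \<le> N z"
    and growth: "\<exists>k. \<forall>F\<in>schreier_sets. \<forall>z\<in>c00. card F = k \<longrightarrow> (\<forall>n\<in>F. 1 \<le> norm (z n)) \<longrightarrow> R \<le> N z"
    and lower: "y \<in> c00 \<Longrightarrow> z \<in> c00 \<Longrightarrow> (\<And>n. y n \<noteq> 0 \<Longrightarrow> n \<le> m) \<Longrightarrow> (\<And>n. z n \<noteq> 0 \<Longrightarrow> m < n)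
      \<Longrightarrow> \<phi> (N y) (N z) \<le> N (y + z)"
    and upper: "y \<in> c00 \<Longrightarrow> z \<in> c00 \<Longrightarrow> (\<And>n. y n \<noteq> 0 \<Longrightarrow> n \<le> m) \<Longrightarrow> (\<And>n. z n \<noteq> 0 \<Longrightarrow> m < n)
      \<Longrightarrow> (\<And>n. norm (z n) \<le> s) \<Longrightarrow> N (y + z) \<le> \<phi> (N y) (N z) + real m * s"
    and norming: "x \<in> c00 \<Longrightarrow> N x = 1 \<Longrightarrow> 0 < \<delta> \<Longrightarrow>
      \<exists>c. (\<forall>n. x n = 0 \<longrightarrow> c n = 0) \<and> (\<Sum>n | x n \<noteq> 0. c n * x n) = 1 \<and>
          (\<forall>z\<in>c00. norm (\<Sum>n | x n \<noteq> 0. c n * z n) \<le> (1 + \<delta>) * N z)"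

text \<open>
  The completion is handled through an isometric embedding of \<open>c00\<close> with dense range.
\<close>

locale block_space = block_norm \<phi> N + banach_nspace E
  for \<phi> and N :: "(nat \<Rightarrow> 'k::{real_normed_field,banach}) \<Rightarrow> real"
    and E :: "('k, 'e::ab_group_add) nspace" +
  fixes \<iota> :: "(nat \<Rightarrow> 'k) \<Rightarrow> 'e"
  assumes linear_\<iota>: "linear_between (c00_with N) E \<iota>"
    and isometric: "z \<in> c00 \<Longrightarrow> nrm E (\<iota> z) = N z"
    and dense_\<iota>: "ntopology E closure_of (\<iota> ` c00) = vecs E"
begin

lemma \<iota>_vecs [simp]: "z \<in> c00 \<Longrightarrow> \<iota> z \<in> vecs E"
  using linear_\<iota> by (auto simp: linear_between_def c00_with_def)

lemma \<iota>_add: "y \<in> c00 \<Longrightarrow> z \<in> c00 \<Longrightarrow> \<iota> (y + z) = \<iota> y + \<iota> z"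
  using linear_\<iota> by (auto simp: linear_between_def c00_with_def)

lemma \<iota>_scale: "z \<in> c00 \<Longrightarrow> \<iota> (seq_scale c z) = smul E c (\<iota> z)"
  using linear_\<iota> by (auto simp: linear_between_def c00_with_def)

lemma \<iota>_diff: "y \<in> c00 \<Longrightarrow> z \<in> c00 \<Longrightarrow> \<iota> (y - z) = \<iota> y - \<iota> z"
  using \<iota>_add[of "y - z" z] by simp

lemma \<iota>_0: "\<iota> 0 = 0"
  using \<iota>_add[of 0 0] by simp

lemma \<iota>_sum: "(\<And>i. i \<in> I \<Longrightarrow> u i \<in> c00) \<Longrightarrow> \<iota> (sum u I) = (\<Sum>i\<in>I. \<iota> (u i))"
  by (induction I rule: infinite_finite_induct) (auto simp: \<iota>_0 \<iota>_add c00_sum)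

lemma N_scale: "z \<in> c00 \<Longrightarrow> N (seq_scale c z) = norm c * N z"
  using isometric[of "seq_scale c z"] isometric[of z] by (simp add: \<iota>_scale nrm_scale)

lemma N_nonneg: "z \<in> c00 \<Longrightarrow> 0 \<le> N z"
  using isometric[of z] nrm_ge_0[of "\<iota> z"] by simp

lemma dense_approx:
  assumes "v \<in> vecs E" "0 < \<epsilon>"
  obtains z where "z \<in> c00" "nrm E (v - \<iota> z) < \<epsilon>"
proof -
  have "v \<in> mtopology closure_of (\<iota> ` c00)"
    using assms dense_\<iota> by simp
  then show thesis
    using assms that by (auto simp: metric_closure_of ndist_def)
qed

definition approx :: "'e \<Rightarrow> nat \<Rightarrow> nat \<Rightarrow> 'k" where
  "approx v i = (SOME z. z \<in> c00 \<and> nrm E (v - \<iota> z) < 1 / real (Suc i))"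

lemma approx:
  assumes "v \<in> vecs E"
  shows "approx v i \<in> c00" "nrm E (v - \<iota> (approx v i)) < 1 / real (Suc i)"
proof -
  have "\<exists>z. z \<in> c00 \<and> nrm E (v - \<iota> z) < 1 / real (Suc i)"
    using dense_approx[OF assms] by (metis of_nat_0_less_iff zero_less_Suc zero_less_divide_1_iff)
  then show "approx v i \<in> c00" "nrm E (v - \<iota> (approx v i)) < 1 / real (Suc i)"
    unfolding approx_def by (metis (mono_tags, lifting) someI_ex)+
qed

lemma approx_limit:
  assumes "v \<in> vecs E"
  shows "(\<lambda>i. nrm E (v - \<iota> (approx v i))) \<longlonglongrightarrow> 0"
proof (rule tendsto_sandwich[OF _ _ tendsto_const])
  show "(\<lambda>i. 1 / real (Suc i)) \<longlonglongrightarrow> 0"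
    using LIMSEQ_inverse_real_of_nat by (simp add: inverse_eq_divide)
  show "\<forall>\<^sub>F i in sequentially. nrm E (v - \<iota> (approx v i)) \<le> 1 / real (Suc i)"
    using approx(2)[OF assms] by (intro always_eventually allI less_imp_le)
qed (use approx(1)[OF assms] assms in simp)

text \<open>
  The coordinate functionals are bounded on \<open>c00\<close>, and the scalars are complete; hence they extend to
  the completion. A functional on \<open>c00\<close> with finitely many nonzero coefficients then extends as a
  combination of coordinates, with the same bound (\<open>norm_functional_le\<close>).
\<close>

definition coord :: "'e \<Rightarrow> nat \<Rightarrow> 'k" where
  "coord v n = lim (\<lambda>i. approx v i n)"

lemma coord_limit:
  assumes v: "v \<in> vecs E" and z: "\<And>i. z i \<in> c00" and lim: "(\<lambda>i. nrm E (v - \<iota> (z i))) \<longlonglongrightarrow> 0"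
  shows "(\<lambda>i. z i n) \<longlonglongrightarrow> coord v n"
proof -
  have dist: "norm (y n - y' n) \<le> nrm E (v - \<iota> y) + nrm E (v - \<iota> y')" if "y \<in> c00" "y' \<in> c00" for y y'
  proof -
    have "norm (y n - y' n) \<le> nrm E (\<iota> y - \<iota> y')"
      using coord_le[of "y - y'" n] that isometric[of "y - y'"] by (simp add: \<iota>_diff)
    also have "\<dots> \<le> nrm E (\<iota> y - v) + nrm E (v - \<iota> y')"
      using that v by (intro nrm_diff_triangle) auto
    finally show ?thesis
      using nrm_minus_commute[of v "\<iota> y"] that v by simp
  qed
  have "Cauchy (\<lambda>i. approx v i n)"
  proof (rule metric_CauchyI)
    fix \<epsilon> :: real assume "0 < \<epsilon>"
    then have "\<forall>\<^sub>F i in sequentially. nrm E (v - \<iota> (approx v i)) < \<epsilon> / 2"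
      using order_tendstoD(2)[OF approx_limit[OF v], of "\<epsilon> / 2"] by simp
    then obtain M where M: "\<And>i. M \<le> i \<Longrightarrow> nrm E (v - \<iota> (approx v i)) < \<epsilon> / 2"
      by (auto simp: eventually_sequentially)
    show "\<exists>M. \<forall>i\<ge>M. \<forall>j\<ge>M. dist (approx v i n) (approx v j n) < \<epsilon>"
    proof (intro exI allI impI)
      fix i j assume "M \<le> i" "M \<le> j"
      then show "dist (approx v i n) (approx v j n) < \<epsilon>"
        using M[of i] M[of j] dist[of "approx v i" "approx v j"] approx(1)[OF v]
        by (simp add: dist_norm)
    qed
  qed
  then have *: "(\<lambda>i. approx v i n) \<longlonglongrightarrow> coord v n"
    by (simp add: coord_def Cauchy_convergent_iff convergent_LIMSEQ_iff)
  have "(\<lambda>i. z i n - approx v i n) \<longlonglongrightarrow> 0"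
  proof (rule Lim_null_comparison)
    show "(\<lambda>i. nrm E (v - \<iota> (z i)) + nrm E (v - \<iota> (approx v i))) \<longlonglongrightarrow> 0"
      using tendsto_add[OF lim approx_limit[OF v]] by simp
  qed (use dist z approx(1)[OF v] in auto)
  from tendsto_add[OF this *] show ?thesis
    by simp
qed

lemma coord_approx: "v \<in> vecs E \<Longrightarrow> (\<lambda>i. approx v i n) \<longlonglongrightarrow> coord v n"
  using coord_limit approx(1) approx_limit by blast

lemma coord_\<iota> [simp]: "z \<in> c00 \<Longrightarrow> coord (\<iota> z) n = z n"
  using coord_limit[of "\<iota> z" "\<lambda>_. z" n] LIMSEQ_const_iff[of "z n" "coord (\<iota> z) n"] by simp

lemma coord_add:
  assumes u: "u \<in> vecs E" and v: "v \<in> vecs E"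
  shows "coord (u + v) n = coord u n + coord v n"
proof -
  have "(\<lambda>i. nrm E (u + v - \<iota> (approx u i + approx v i))) \<longlonglongrightarrow> 0"
  proof (rule tendsto_sandwich[OF _ _ tendsto_const])
    show "(\<lambda>i. nrm E (u - \<iota> (approx u i)) + nrm E (v - \<iota> (approx v i))) \<longlonglongrightarrow> 0"
      using tendsto_add[OF approx_limit[OF u] approx_limit[OF v]] by simp
    have "nrm E (u + v - \<iota> (approx u i + approx v i))
        \<le> nrm E (u - \<iota> (approx u i)) + nrm E (v - \<iota> (approx v i))" for i
      using nrm_triangle[of "u - \<iota> (approx u i)" "v - \<iota> (approx v i)"] u v approx(1)
      by (simp add: \<iota>_add algebra_simps)
    then show "\<forall>\<^sub>F i in sequentially. nrm E (u + v - \<iota> (approx u i + approx v i))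
        \<le> nrm E (u - \<iota> (approx u i)) + nrm E (v - \<iota> (approx v i))"
      by simp
  qed (use u v approx(1) in auto)
  then have "(\<lambda>i. (approx u i + approx v i) n) \<longlonglongrightarrow> coord (u + v) n"
    using u v approx(1) by (intro coord_limit[where z = "\<lambda>i. approx u i + approx v i"] vecs_add c00_add)
  moreover have "(\<lambda>i. (approx u i + approx v i) n) \<longlonglongrightarrow> coord u n + coord v n"
    using tendsto_add[OF coord_approx[OF u] coord_approx[OF v]] by simp
  ultimately show ?thesis
    using LIMSEQ_unique by blast
qed

lemma coord_scale:
  assumes v: "v \<in> vecs E"
  shows "coord (smul E c v) n = c * coord v n"
proof -
  have "nrm E (smul E c v - \<iota> (seq_scale c (approx v i))) = norm c * nrm E (v - \<iota> (approx v i))" for i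
    using v approx(1)[OF v] nrm_scale[of "v - \<iota> (approx v i)" c]
    by (simp add: \<iota>_scale vs.scale_right_diff_distrib)
  then have "(\<lambda>i. nrm E (smul E c v - \<iota> (seq_scale c (approx v i)))) \<longlonglongrightarrow> 0"
    using tendsto_mult_left[OF approx_limit[OF v], of "norm c"] by simp
  then have "(\<lambda>i. seq_scale c (approx v i) n) \<longlonglongrightarrow> coord (smul E c v) n"
    using v approx(1) by (intro coord_limit) auto
  moreover have "(\<lambda>i. seq_scale c (approx v i) n) \<longlonglongrightarrow> c * coord v n"
    using tendsto_mult_left[OF coord_approx[OF v]] by (simp add: seq_scale_def)
  ultimately show ?thesis
    using LIMSEQ_unique by blast
qed

lemma coord_diff: "u \<in> vecs E \<Longrightarrow> v \<in> vecs E \<Longrightarrow> coord (u - v) n = coord u n - coord v n"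
  using coord_add[of "u - v" v n] by simp

lemma approx_nrm_limit:
  assumes "v \<in> vecs E"
  shows "(\<lambda>i. N (approx v i)) \<longlonglongrightarrow> nrm E v"
proof -
  have "\<bar>N (approx v i) - nrm E v\<bar> \<le> nrm E (v - \<iota> (approx v i))" for i
    using nrm_le_nrm_add_diff[of v "\<iota> (approx v i)"] nrm_le_nrm_add_diff[of "\<iota> (approx v i)" v]
      nrm_minus_commute[of v "\<iota> (approx v i)"] assms approx(1)[OF assms] isometric by fastforce
  then have "(\<lambda>i. N (approx v i) - nrm E v) \<longlonglongrightarrow> 0"
    by (intro Lim_null_comparison[OF _ approx_limit[OF assms]]) auto
  then show ?thesis
    by (simp add: LIM_zero_iff)
qed

lemma norm_coord_le:
  assumes "v \<in> vecs E"
  shows "norm (coord v n) \<le> nrm E v"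
  using tendsto_norm[OF coord_approx[OF assms]] approx_nrm_limit[OF assms]
  by (rule LIMSEQ_le) (use coord_le approx(1)[OF assms] in auto)

lemma norm_functional_le:
  assumes v: "v \<in> vecs E" and le: "\<And>z. z \<in> c00 \<Longrightarrow> norm (\<Sum>n\<in>I. c n * z n) \<le> L * N z"
  shows "norm (\<Sum>n\<in>I. c n * coord v n) \<le> L * nrm E v"
proof (rule LIMSEQ_le)
  show "(\<lambda>i. norm (\<Sum>n\<in>I. c n * approx v i n)) \<longlonglongrightarrow> norm (\<Sum>n\<in>I. c n * coord v n)"
    by (intro tendsto_intros coord_approx[OF v])
  show "(\<lambda>i. L * N (approx v i)) \<longlonglongrightarrow> L * nrm E v"
    by (intro tendsto_intros approx_nrm_limit[OF v])
qed (use le approx(1)[OF v] in auto)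

end


section \<open>Flat blocks close to a subspace\<close>

locale block_subspace = block_space \<phi> N E \<iota>
  for \<phi> and N :: "(nat \<Rightarrow> 'k::{real_normed_field,banach}) \<Rightarrow> real"
    and E :: "('k, 'e::ab_group_add) nspace" and \<iota> +
  fixes W :: "'e set"
  assumes closed_W: "closed_subspace E W" and inf_W: "infinite_dimensional E W"
begin

lemma W_vecs: "w \<in> W \<Longrightarrow> w \<in> vecs E"
  using closed_subspace_vecs[OF closed_W] by blast

lemma subspace_W: "vs.subspace W"
  using closed_W by (simp add: closed_subspace_def)

text \<open>
  \<open>w\<close> belongs to the subspace and \<open>x\<close> is its finitely supported stand-in. The first \<open>m\<close> coordinates of
  \<open>w\<close> itself, not only those of \<open>x\<close>, vanish: functionals supported in \<open>[1, m]\<close> annihilate \<open>w\<close> exactly,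
  which later makes a matrix triangular.
\<close>

definition near_block :: "nat \<Rightarrow> real \<Rightarrow> 'e \<Rightarrow> (nat \<Rightarrow> 'k) \<Rightarrow> bool" where
  "near_block m \<eta> w x \<longleftrightarrow> w \<in> W \<and> x \<in> c00 \<and> N x = 1 \<and> (\<forall>n. x n \<noteq> 0 \<longrightarrow> m < n) \<and>
     (\<forall>n\<le>m. coord w n = 0) \<and> nrm E (w - \<iota> x) \<le> \<eta>"

lemma near_block_normalise:
  assumes w: "w \<in> W" and y: "y \<in> c00" and supp: "\<And>n. y n \<noteq> 0 \<Longrightarrow> m < n"
    and zero: "\<And>n. n \<le> m \<Longrightarrow> coord w n = 0"
    and pos: "0 < N y" and close: "nrm E (w - \<iota> y) \<le> \<eta> * N y"
  shows "\<exists>w'. near_block m \<eta> w' (seq_scale (of_real (1 / N y)) y)"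
proof -
  let ?c = "of_real (1 / N y) :: 'k"
  have c: "norm ?c = 1 / N y"
    using pos by (simp add: norm_divide)
  have "nrm E (smul E ?c w - \<iota> (seq_scale ?c y)) = (1 / N y) * nrm E (w - \<iota> y)"
    using W_vecs[OF w] y nrm_scale[of "w - \<iota> y" ?c] c
    by (simp add: \<iota>_scale vs.scale_right_diff_distrib)
  also have "\<dots> \<le> \<eta>"
    using close pos by (simp add: field_simps)
  finally have "nrm E (smul E ?c w - \<iota> (seq_scale ?c y)) \<le> \<eta>" .
  moreover have "N (seq_scale ?c y) = 1"
    using y pos by (simp only: N_scale c) simp
  moreover have "smul E ?c w \<in> W"
    using subspace_W w vs.subspace_scale by blast
  moreover have "m < n" if "seq_scale ?c y n \<noteq> 0" for n
    using that supp by (auto simp: seq_scale_def)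
  ultimately have "near_block m \<eta> (smul E ?c w) (seq_scale ?c y)"
    using y zero W_vecs[OF w] by (simp add: near_block_def coord_scale)
  then show ?thesis
    by blast
qed

text \<open>
  A nonzero \<open>v\<close> in the subspace with vanishing first \<open>m\<close> coordinates is approximated by some \<open>y\<close> in
  \<open>c00\<close>. The first \<open>m\<close> coordinates of \<open>y\<close> are then small and can be removed at a cost that is
  controlled by the norms of the first \<open>m\<close> unit vectors.
\<close>

lemma near_block_exists:
  assumes \<eta>: "0 < \<eta>"
  obtains w x where "near_block m \<eta> w x"
proof -
  obtain v where v: "v \<in> W" "v \<noteq> 0" "\<And>n. n < Suc m \<Longrightarrow> coord v n = 0"
  proof (rule infinite_dimensional_kernels[OF inf_W subspace_W, of "\<lambda>n v. coord v n" "Suc m"])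
    show "W \<subseteq> vecs E"
      using W_vecs by blast
  qed (use coord_add coord_scale that in auto)
  have vE: "v \<in> vecs E"
    using v W_vecs by blast
  have pos: "0 < nrm E v"
    using nrm_ge_0[OF vE] nrm_eq_0[OF vE] v(2) by linarith
  define K where "K = 1 + (\<Sum>n=1..m. N (unit_seq n))"
  have K: "1 \<le> K"
    by (auto simp: K_def intro!: sum_nonneg N_nonneg unit_seq_c00)
  \<comment> \<open>The relative error: \<open>1 / 2\<close> keeps the norm of \<open>x\<close> at least half of that of \<open>v\<close>, and \<open>\<eta> / 2\<close>
    allows for the normalisation of \<open>x\<close>.\<close>
  define \<rho> where "\<rho> = min (1 / 2) (\<eta> / 2)"
  have \<rho>: "0 < \<rho>" "\<rho> \<le> 1 / 2" "\<rho> \<le> \<eta> / 2"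
    using \<eta> by (auto simp: \<rho>_def)
  define \<epsilon> where "\<epsilon> = \<rho> * nrm E v / K"
  have \<epsilon>: "0 < \<epsilon>" "\<epsilon> * K = \<rho> * nrm E v"
    using \<rho> pos K by (auto simp: \<epsilon>_def)
  obtain y where y: "y \<in> c00" "nrm E (v - \<iota> y) < \<epsilon>"
    using dense_approx[OF vE \<epsilon>(1)] by blast
  define x where "x = keep {m<..} y"
  have x: "x \<in> c00"
    using y by (simp add: x_def)
  have y_small: "norm (y n) \<le> \<epsilon>" if "n \<le> m" for n
    using norm_coord_le[of "v - \<iota> y" n] v(3)[of n] vE y that by (simp add: coord_diff)
  have split: "y = x + keep {..m} y"
    by (auto simp: x_def keep_def)
  have "nrm E (\<iota> (keep {..m} y)) \<le> (\<Sum>n=1..m. nrm E (\<iota> (seq_scale (y n) (unit_seq n))))"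
    unfolding keep_initial_eq_sum[OF y(1)]
    by (subst \<iota>_sum) (auto intro!: nrm_sum unit_seq_c00 c00_scale \<iota>_vecs)
  also have "\<dots> \<le> (\<Sum>n=1..m. \<epsilon> * N (unit_seq n))"
    by (intro sum_mono)
      (auto simp: isometric N_scale unit_seq_c00 intro!: mult_right_mono y_small N_nonneg)
  also have "\<dots> = \<epsilon> * K - \<epsilon>"
    by (simp add: K_def sum_distrib_left algebra_simps)
  finally have head: "nrm E (\<iota> (keep {..m} y)) \<le> \<epsilon> * K - \<epsilon>" .
  have decomp: "v - \<iota> x = (v - \<iota> y) + \<iota> (keep {..m} y)"
    using \<iota>_add[OF x, of "keep {..m} y"] y(1) split by simp
  have close: "nrm E (v - \<iota> x) \<le> \<rho> * nrm E v"
    unfolding decomp using nrm_triangle[of "v - \<iota> y" "\<iota> (keep {..m} y)"] head y vE \<epsilon> by simp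
  also have "\<dots> \<le> (1 / 2) * nrm E v"
    using \<rho> pos by (intro mult_right_mono) auto
  finally have "nrm E v \<le> 2 * N x"
    using nrm_le_nrm_add_diff[of v "\<iota> x"] vE x by (simp add: isometric)
  then have Nx: "nrm E v \<le> 2 * N x" "0 < N x"
    using pos by auto
  have "nrm E (v - \<iota> x) \<le> (\<eta> / 2) * (2 * N x)"
    using close mult_mono[OF \<rho>(3) Nx(1)] \<eta> pos by simp
  then have close': "nrm E (v - \<iota> x) \<le> \<eta> * N x"
    by simp
  have "m < n" if "x n \<noteq> 0" for n
    using that by (auto simp: x_def keep_def split: if_splits)
  then show thesis
    using near_block_normalise[OF v(1) x _ _ Nx(2) close', of m] v(3) that by auto
qed

text \<open>
  A sum of successive normalised blocks has entries of modulus at most one. If flat blocks were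
  unavailable, each of its blocks would have an entry of modulus above \<open>\<eta>\<close>; sufficiently far out
  these entries form a Schreier set, so the norm of the sum would exceed \<open>1 / \<eta>\<close> and the normalised
  sum would be flat after all.
\<close>

lemma flat_near_block_exists:
  assumes \<eta>: "0 < \<eta>"
  obtains w x where "near_block m \<eta> w x" "\<And>n. norm (x n) \<le> \<eta>"
proof (rule ccontr)
  note found = that
  assume "\<not> thesis"
  then have no: "\<exists>n. \<eta> < norm (x n)" if "near_block m \<eta> w x" for w x
    using that found[of w x] by (meson not_le_imp_less)
  \<comment> \<open>The bound is applied to a sum of blocks divided by \<open>\<eta>\<close>, whose selected entries then have modulus
    at least one; for the sum itself it gives a norm of at least \<open>1 / \<eta> + 1\<close>.\<close>
  obtain k where k: "\<And>F z. F \<in> schreier_sets \<Longrightarrow> z \<in> c00 \<Longrightarrow> card F = k \<Longrightarrow>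
      (\<And>n. n \<in> F \<Longrightarrow> 1 \<le> norm (z n)) \<Longrightarrow> (1 / \<eta> + 1) / \<eta> \<le> N z"
    using growth[of "(1 / \<eta> + 1) / \<eta>"] by blast
  define l where "l = max m k"
  define e where "e = \<eta> / real (Suc k)"
  have e: "0 < e" "e \<le> \<eta>"
    using \<eta> by (auto simp: e_def field_simps)
  have "\<exists>w y G. w \<in> W \<and> y \<in> c00 \<and> finite G \<and> card G = i \<and> (\<forall>n. y n \<noteq> 0 \<longrightarrow> l < n) \<and>
      (\<forall>n\<le>l. coord w n = 0) \<and> (\<forall>n\<in>G. \<eta> < norm (y n)) \<and> (\<forall>n. norm (y n) \<le> 1) \<and>
      nrm E (w - \<iota> y) \<le> real i * e" for i
  proof (induction i)
    case 0
    show ?case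
      by (rule exI[of _ 0], rule exI[of _ 0], rule exI[of _ "{}"])
        (use subspace_W coord_add[of 0 0] in \<open>auto simp: c00_def \<iota>_0[unfolded func_zero] vs.subspace_0\<close>)
  next
    case (Suc i)
    then obtain w y G where IH: "w \<in> W" "y \<in> c00" "finite G" "card G = i"
      "\<And>n. y n \<noteq> 0 \<Longrightarrow> l < n" "\<And>n. n \<le> l \<Longrightarrow> coord w n = 0" "\<And>n. n \<in> G \<Longrightarrow> \<eta> < norm (y n)"
      "\<And>n. norm (y n) \<le> 1" "nrm E (w - \<iota> y) \<le> real i * e"
      by blast
    obtain l0 where l0: "\<And>n. y n \<noteq> 0 \<Longrightarrow> n \<le> l0"
      using c00_bounded[OF IH(2)] by blast
    define l' where "l' = max l l0"
    obtain v x where vx: "near_block l' e v x"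
      using near_block_exists[OF e(1)] by blast
    then have "near_block m \<eta> v x"
      using e by (auto simp: near_block_def l'_def l_def)
    then obtain n0 where n0: "\<eta> < norm (x n0)"
      using no by blast
    have v: "v \<in> W" "x \<in> c00" "N x = 1" "\<And>n. x n \<noteq> 0 \<Longrightarrow> l' < n" "\<And>n. n \<le> l' \<Longrightarrow> coord v n = 0"
      "nrm E (v - \<iota> x) \<le> e"
      using vx by (auto simp: near_block_def)
    have disj: "y n = 0 \<or> x n = 0" for n
      using l0[of n] v(4)[of n] by (fastforce simp: l'_def)
    have xn0: "x n0 \<noteq> 0"
      using n0 \<eta> by auto
    then have yn0: "y n0 = 0"
      using disj by blast
    have n0G: "n0 \<notin> G"
      using IH(7)[of n0] yn0 \<eta> by auto
    show ?case
    proof (intro exI conjI allI ballI impI)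
      show "w + v \<in> W"
        using IH v subspace_W vs.subspace_add by blast
      show "y + x \<in> c00"
        using IH v by simp
      show "finite (insert n0 G)" "card (insert n0 G) = Suc i"
        using IH n0G by auto
      show "l < n" if "(y + x) n \<noteq> 0" for n
        using that IH(5)[of n] v(4)[of n] by (cases "y n = 0") (auto simp: l'_def)
      show "coord (w + v) n = 0" if "n \<le> l" for n
        using that IH(1,6) v(1,5) W_vecs by (simp add: coord_add l'_def)
      show "\<eta> < norm ((y + x) n)" if "n \<in> insert n0 G" for n
      proof (cases "n = n0")
        case False
        then have "\<eta> < norm (y n)"
          using that IH(7) by blast
        moreover from this have "x n = 0"
          using disj[of n] \<eta> by auto
        ultimately show ?thesis
          by simp
      qed (use n0 yn0 in simp)
      show "norm ((y + x) n) \<le> 1" for n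
        using disj[of n] IH(8)[of n] coord_le[OF v(2), of n] v(3) by auto
      have "w + v - \<iota> (y + x) = (w - \<iota> y) + (v - \<iota> x)"
        using IH v by (simp add: \<iota>_add)
      then show "nrm E (w + v - \<iota> (y + x)) \<le> real (Suc i) * e"
        using nrm_triangle[of "w - \<iota> y" "v - \<iota> x"] IH v W_vecs by (simp add: algebra_simps)
    qed
  qed
  from this[of k] obtain w y G where G: "w \<in> W" "y \<in> c00" "finite G" "card G = k"
      "\<And>n. y n \<noteq> 0 \<Longrightarrow> l < n" "\<And>n. n \<le> l \<Longrightarrow> coord w n = 0" "\<And>n. n \<in> G \<Longrightarrow> \<eta> < norm (y n)"
      "\<And>n. norm (y n) \<le> 1" "nrm E (w - \<iota> y) \<le> real k * e"
    by blast
  have lG: "l < n" if "n \<in> G" for n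
    using G(5)[of n] G(7)[OF that] \<eta> by (cases "y n = 0") auto
  have "k \<le> n \<and> n \<noteq> 0" if "n \<in> G" for n
    using lG[OF that] by (auto simp: l_def)
  then have "G \<in> schreier_sets"
    using G(3,4) Min_in[OF G(3)] by (fastforce simp: schreier_sets_def)
  then have "(1 / \<eta> + 1) / \<eta> \<le> N (seq_scale (of_real (1 / \<eta>)) y)"
  proof (rule k)
    show "1 \<le> norm (seq_scale (of_real (1 / \<eta>)) y n)" if "n \<in> G" for n
      using G(7)[OF that] \<eta> by (simp add: seq_scale_def norm_divide)
  qed (use G in auto)
  then have Ny: "1 / \<eta> + 1 \<le> N y"
    using \<eta> G(2) by (simp add: N_scale norm_divide divide_le_cancel)
  moreover have "0 < 1 / \<eta>"
    using \<eta> by simp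
  ultimately have Ny': "1 \<le> N y" "1 / \<eta> \<le> N y"
    by linarith+
  have "real k * e \<le> \<eta>"
    using \<eta> by (simp add: e_def field_simps)
  also have "\<dots> \<le> \<eta> * N y"
    using Ny' \<eta> by simp
  finally obtain w' where w': "near_block l \<eta> w' (seq_scale (of_real (1 / N y)) y)"
    using near_block_normalise[of w y l \<eta>] G Ny' by fastforce
  then have "near_block m \<eta> w' (seq_scale (of_real (1 / N y)) y)"
    by (auto simp: near_block_def l_def)
  then obtain n where "\<eta> < norm (seq_scale (of_real (1 / N y)) y n)"
    using no by blast
  also have "\<dots> = norm (y n) / N y"
    using Ny' by (simp add: seq_scale_def norm_mult norm_divide)
  also have "\<dots> \<le> 1 / N y"
    using G(8)[of n] Ny' by (simp add: divide_right_mono)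
  also have "\<dots> \<le> \<eta>"
    using Ny' \<eta> by (simp add: field_simps)
  finally show False
    by simp
qed

text \<open>
  A functional that norms the block \<open>x\<close> takes a value near one at \<open>w\<close>; dividing by this value makes the
  diagonal entry exactly one and changes the norm only slightly.
\<close>

lemma flat_block_with_functional_exists:
  assumes \<eta>: "0 < \<eta>" and \<delta>: "0 < \<delta>" "\<delta> \<le> 1"
  obtains w x c where "near_block m \<eta> w x" "\<And>n. norm (x n) \<le> \<eta>"
    "\<And>n. x n = 0 \<Longrightarrow> c n = 0" "(\<Sum>n | x n \<noteq> 0. c n * coord w n) = 1"
    "\<And>z. z \<in> c00 \<Longrightarrow> norm (\<Sum>n | x n \<noteq> 0. c n * z n) \<le> (1 + 3 * \<delta>) * N z"
proof -
  define \<theta> where "\<theta> = min \<eta> (\<delta> / 4)"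
  have \<theta>: "0 < \<theta>" "\<theta> \<le> \<eta>" "\<theta> \<le> \<delta> / 4"
    using \<eta> \<delta> by (auto simp: \<theta>_def)
  obtain w x where wx: "near_block m \<theta> w x" "\<And>n. norm (x n) \<le> \<theta>"
    using flat_near_block_exists[OF \<theta>(1)] by blast
  have w: "w \<in> vecs E" "x \<in> c00" "N x = 1" "nrm E (w - \<iota> x) \<le> \<theta>"
    using wx W_vecs by (auto simp: near_block_def)
  obtain c where c: "\<And>n. x n = 0 \<Longrightarrow> c n = 0" "(\<Sum>n | x n \<noteq> 0. c n * x n) = 1"
    "\<And>z. z \<in> c00 \<Longrightarrow> norm (\<Sum>n | x n \<noteq> 0. c n * z n) \<le> (1 + \<delta>) * N z"
    using norming[OF w(2,3) \<delta>(1)] by blast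
  define q where "q = (\<Sum>n | x n \<noteq> 0. c n * coord w n)"
  have "q - 1 = (\<Sum>n | x n \<noteq> 0. c n * coord (w - \<iota> x) n)"
    using w c(2) by (simp add: q_def coord_diff algebra_simps sum_subtractf)
  also have "norm \<dots> \<le> (1 + \<delta>) * nrm E (w - \<iota> x)"
    using w c(3) by (intro norm_functional_le) auto
  also have "\<dots> \<le> 2 * (\<delta> / 4)"
    using w \<theta> \<delta> by (intro mult_mono) auto
  finally have "norm (1 - q) \<le> \<delta> / 2"
    by (simp add: norm_minus_commute)
  then have q: "1 - \<delta> / 2 \<le> norm q"
    using norm_triangle_ineq2[of 1 "1 - q"] by simp
  then have q0: "0 < norm q"
    using \<delta> by linarith
  have "(1 + \<delta>) \<le> (1 + 3 * \<delta>) * (1 - \<delta> / 2)"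
    using mult_mono[of \<delta> 1 \<delta> \<delta>] \<delta> by (simp add: algebra_simps)
  also have "\<dots> \<le> (1 + 3 * \<delta>) * norm q"
    using q \<delta> by (intro mult_left_mono) auto
  finally have ratio: "(1 + \<delta>) / norm q \<le> 1 + 3 * \<delta>"
    using q0 by (simp add: field_simps)
  show thesis
  proof (rule that[of w x "\<lambda>n. c n / q"])
    show "near_block m \<eta> w x"
      using wx(1) \<theta>(2) by (auto simp: near_block_def)
    show "norm (x n) \<le> \<eta>" for n
      using wx(2)[of n] \<theta>(2) by linarith
    show "(\<Sum>n | x n \<noteq> 0. c n / q * coord w n) = 1"
      using q0 by (simp add: q_def flip: sum_divide_distrib)
    fix z :: "nat \<Rightarrow> 'k" assume z: "z \<in> c00"
    have "norm (\<Sum>n | x n \<noteq> 0. c n / q * z n) = norm (\<Sum>n | x n \<noteq> 0. c n * z n) / norm q"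
      by (simp flip: sum_divide_distrib norm_divide)
    also have "\<dots> \<le> (1 + \<delta>) * N z / norm q"
      using c(3)[OF z] by (simp add: divide_right_mono)
    also have "\<dots> \<le> (1 + 3 * \<delta>) * N z"
      using mult_right_mono[OF ratio N_nonneg[OF z]] by simp
    finally show "norm (\<Sum>n | x n \<noteq> 0. c n / q * z n) \<le> (1 + 3 * \<delta>) * N z" .
  qed (use c in auto)
qed

end


section \<open>Selecting a block sequence\<close>

text \<open>
  The error allowed at stage \<open>k\<close> of the selection. The factor \<open>2 ^ Suc k\<close> makes the errors summable
  with sum at most \<open>\<delta>\<close>; the factor \<open>6 * Suc k\<close> leaves room for adding up to \<open>k\<close> of them, with
  coefficients of modulus at most six, at the following stage.
\<close>

definition \<tau> :: "real \<Rightarrow> nat \<Rightarrow> real" where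
  "\<tau> \<delta> k = \<delta> / (6 * real (Suc k) * 2 ^ Suc k)"

lemma \<tau>_pos: "0 < \<delta> \<Longrightarrow> 0 < \<tau> \<delta> k"
  by (simp add: \<tau>_def)

lemma sum_half_powers_le: "(\<Sum>k=1..n. 1 / 2 ^ k) \<le> (1::real)"
proof -
  have "(\<Sum>k=1..n. 1 / 2 ^ k) = 1 - 1 / (2::real) ^ n"
    by (induction n) (auto simp: field_simps)
  then show ?thesis
    by simp
qed

lemma \<tau>_sum_le:
  assumes "0 < \<delta>"
  shows "(\<Sum>k=1..n. \<tau> \<delta> k) \<le> \<delta>"
proof -
  have "\<tau> \<delta> k \<le> \<delta> * (1 / 2 ^ k)" for k
    unfolding \<tau>_def using assms mult_mono[of 1 "6 * real (Suc k)" "2 ^ k" "2 ^ Suc k :: real"]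
    by (auto intro!: divide_left_mono)
  then have "(\<Sum>k=1..n. \<tau> \<delta> k) \<le> \<delta> * (\<Sum>k=1..n. 1 / 2 ^ k)"
    by (simp only: sum_distrib_left sum_mono)
  also have "\<dots> \<le> \<delta> * 1"
    using assms sum_half_powers_le by (intro mult_left_mono) auto
  finally show ?thesis
    by simp
qed

context block_subspace
begin

lemma common_support_bound:
  assumes "finite A" "\<And>v. v \<in> A \<Longrightarrow> v \<in> vecs E" "0 < \<epsilon>"
  shows "\<exists>m\<ge>m0. \<forall>v\<in>A. \<exists>y\<in>c00. (\<forall>n. y n \<noteq> 0 \<longrightarrow> n \<le> m) \<and> nrm E (v - \<iota> y) \<le> \<epsilon>"
  using assms(1,2)
proof (induction A rule: finite_induct)
  case (insert v A)
  then obtain m where m: "m0 \<le> m" "\<forall>v\<in>A. \<exists>y\<in>c00. (\<forall>n. y n \<noteq> 0 \<longrightarrow> n \<le> m) \<and> nrm E (v - \<iota> y) \<le> \<epsilon>"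
    by blast
  obtain y where y: "y \<in> c00" "nrm E (v - \<iota> y) < \<epsilon>"
    using dense_approx[of v \<epsilon>] insert.prems assms(3) by blast
  obtain m' where m': "\<And>n. y n \<noteq> 0 \<Longrightarrow> n \<le> m'"
    using c00_bounded[OF y(1)] by blast
  have "\<exists>y\<in>c00. (\<forall>n. y n \<noteq> 0 \<longrightarrow> n \<le> max m m') \<and> nrm E (u - \<iota> y) \<le> \<epsilon>" if "u \<in> insert v A" for u
  proof (cases "u = v")
    case True
    then show ?thesis
      using y m' by (intro bexI[of _ y]) (auto intro: le_max_iff_disj[THEN iffD2])
  next
    case False
    then show ?thesis
      using m(2) that by (metis insertE le_max_iff_disj)
  qed
  then show ?case
    using m(1) by (intro exI[of _ "max m m'"]) auto
qed auto

end

text \<open>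
  The sequence is selected together with its supports: \<open>x k\<close> lives in the interval
  \<open>(m (k - 1), m k]\<close>, is flat relative to \<open>m (k - 1)\<close>, and \<open>m k\<close> is so large that all the vectors
  \<open>w 0, \<dots>, w k\<close> are almost supported in \<open>[1, m k]\<close>. Thus the later functionals nearly vanish on them.
\<close>

locale block_sequence = block_subspace \<phi> N E \<iota> W
  for \<phi> and N :: "(nat \<Rightarrow> 'k::{real_normed_field,banach}) \<Rightarrow> real"
    and E :: "('k, 'e::ab_group_add) nspace" and \<iota> and W +
  fixes \<delta> :: real and w :: "nat \<Rightarrow> 'e" and x c :: "nat \<Rightarrow> nat \<Rightarrow> 'k" and m :: "nat \<Rightarrow> nat"
  assumes \<delta>: "0 < \<delta>" "\<delta> \<le> 1 / 3"
    and block: "near_block (m k) (\<tau> \<delta> (Suc k)) (w (Suc k)) (x (Suc k))"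
    and flat: "real (m k) * norm (x (Suc k) n) \<le> \<tau> \<delta> (Suc k)"
    and c_supp: "x k n = 0 \<Longrightarrow> c k n = 0"
    and c_w: "(\<Sum>n | x k n \<noteq> 0. c k n * coord (w k) n) = 1"
    and c_bound: "z \<in> c00 \<Longrightarrow> norm (\<Sum>n | x k n \<noteq> 0. c k n * z n) \<le> (1 + 3 * \<delta>) * N z"
    and x_supp: "x k n \<noteq> 0 \<Longrightarrow> n \<le> m k"
    and m_mono: "m k \<le> m (Suc k)"
    and tail: "j \<le> k \<Longrightarrow> \<exists>y\<in>c00. (\<forall>n. y n \<noteq> 0 \<longrightarrow> n \<le> m k) \<and> nrm E (w j - \<iota> y) \<le> \<tau> \<delta> k"

lemma (in block_subspace) block_sequence_exists:
  assumes \<delta>: "0 < \<delta>" "\<delta> \<le> 1 / 3"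
  obtains w x c m where "block_sequence \<phi> N E \<iota> W \<delta> w x c m"
proof -
  define prev where "prev f k = (case k of 0 \<Rightarrow> 0 | Suc j \<Rightarrow> snd (snd (snd (f j))))"
    for f :: "nat \<Rightarrow> 'e \<times> (nat \<Rightarrow> 'k) \<times> (nat \<Rightarrow> 'k) \<times> nat" and k
  define Q where "Q f k r = (case r of (w, x, c, m) \<Rightarrow>
      near_block (prev f k) (\<tau> \<delta> k) w x \<and>
      (\<forall>n. real (prev f k) * norm (x n) \<le> \<tau> \<delta> k) \<and>
      (\<forall>n. x n = 0 \<longrightarrow> c n = 0) \<and>
      (\<Sum>n | x n \<noteq> 0. c n * coord w n) = 1 \<and>
      (\<forall>z\<in>c00. norm (\<Sum>n | x n \<noteq> 0. c n * z n) \<le> (1 + 3 * \<delta>) * N z) \<and>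
      (\<forall>n. x n \<noteq> 0 \<longrightarrow> n \<le> m) \<and> prev f k \<le> m \<and>
      (\<forall>v\<in>insert w ((\<lambda>j. fst (f j)) ` {..<k}).
         \<exists>y\<in>c00. (\<forall>n. y n \<noteq> 0 \<longrightarrow> n \<le> m) \<and> nrm E (v - \<iota> y) \<le> \<tau> \<delta> k))"
    for f :: "nat \<Rightarrow> 'e \<times> (nat \<Rightarrow> 'k) \<times> (nat \<Rightarrow> 'k) \<times> nat" and k r
  have \<delta>1: "\<delta> \<le> 1"
    using \<delta> by simp
  have "\<exists>f. \<forall>k. Q f k (f k)"
  proof (rule dependent_wellorder_choice)
    fix r and f g :: "nat \<Rightarrow> 'e \<times> (nat \<Rightarrow> 'k) \<times> (nat \<Rightarrow> 'k) \<times> nat" and k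
    assume eq: "\<And>j. j < k \<Longrightarrow> f j = g j"
    then have "prev f k = prev g k"
      by (simp add: prev_def split: nat.split)
    moreover have "(\<lambda>j. fst (f j)) ` {..<k} = (\<lambda>j. fst (g j)) ` {..<k}"
      using eq by (intro image_cong) auto
    ultimately show "Q f k r = Q g k r"
      by (simp only: Q_def)
  next
    fix k and f :: "nat \<Rightarrow> 'e \<times> (nat \<Rightarrow> 'k) \<times> (nat \<Rightarrow> 'k) \<times> nat"
    assume IH: "\<And>j. j < k \<Longrightarrow> Q f j (f j)"
    define p where "p = prev f k"
    define \<eta> where "\<eta> = \<tau> \<delta> k / (real p + 1)"
    have \<eta>: "0 < \<eta>" "\<eta> \<le> \<tau> \<delta> k" "real p * \<eta> \<le> \<tau> \<delta> k"
      using \<tau>_pos[OF \<delta>(1), of k] by (auto simp: \<eta>_def field_simps)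
    obtain w x c where wxc: "near_block p \<eta> w x" "\<And>n. norm (x n) \<le> \<eta>"
      "\<And>n. x n = 0 \<Longrightarrow> c n = 0" "(\<Sum>n | x n \<noteq> 0. c n * coord w n) = 1"
      "\<And>z. z \<in> c00 \<Longrightarrow> norm (\<Sum>n | x n \<noteq> 0. c n * z n) \<le> (1 + 3 * \<delta>) * N z"
      using flat_block_with_functional_exists[OF \<eta>(1) \<delta>(1) \<delta>1] by blast
    obtain l where l: "\<And>n. x n \<noteq> 0 \<Longrightarrow> n \<le> l"
      using c00_bounded[of x] wxc(1) by (auto simp: near_block_def)
    have "v \<in> vecs E" if "v \<in> insert w ((\<lambda>j. fst (f j)) ` {..<k})" for v
    proof -
      have "fst (f j) \<in> W" if "j < k" for j
        using IH[OF that] by (auto simp: Q_def near_block_def split: prod.splits)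
      then show ?thesis
        using that wxc(1) W_vecs by (auto simp: near_block_def)
    qed
    then obtain m where m: "max p l \<le> m" "\<forall>v\<in>insert w ((\<lambda>j. fst (f j)) ` {..<k}).
         \<exists>y\<in>c00. (\<forall>n. y n \<noteq> 0 \<longrightarrow> n \<le> m) \<and> nrm E (v - \<iota> y) \<le> \<tau> \<delta> k"
      using common_support_bound[of "insert w ((\<lambda>j. fst (f j)) ` {..<k})" "\<tau> \<delta> k" "max p l"]
        \<tau>_pos[OF \<delta>(1)] by auto
    have "near_block p (\<tau> \<delta> k) w x"
      using wxc(1) \<eta>(2) by (auto simp: near_block_def)
    moreover have "real p * norm (x n) \<le> \<tau> \<delta> k" for n
      using mult_left_mono[OF wxc(2)[of n], of "real p"] \<eta>(3) by simp
    moreover have "n \<le> m" if "x n \<noteq> 0" for n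
      using l[OF that] m(1) by simp
    moreover have "p \<le> m"
      using m(1) by simp
    ultimately have "Q f k (w, x, c, m)"
      using wxc(3-5) m(2) unfolding Q_def prod.case p_def[symmetric] by blast
    then show "\<exists>r. Q f k r" ..
  qed
  then obtain f where f: "\<And>k. Q f k (f k)"
    by blast
  define w x c m where "w k = fst (f k)" and "x k = fst (snd (f k))"
    and "c k = fst (snd (snd (f k)))" and "m k = snd (snd (snd (f k)))" for k
  have fk: "f k = (w k, x k, c k, m k)" for k
    by (simp add: w_def x_def c_def m_def)
  have prev: "prev f (Suc k) = m k" for k
    by (simp add: prev_def m_def)
  have Q: "near_block (prev f k) (\<tau> \<delta> k) (w k) (x k)"
      "\<And>n. real (prev f k) * norm (x k n) \<le> \<tau> \<delta> k"
      "\<And>n. x k n = 0 \<Longrightarrow> c k n = 0"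
      "(\<Sum>n | x k n \<noteq> 0. c k n * coord (w k) n) = 1"
      "\<And>z. z \<in> c00 \<Longrightarrow> norm (\<Sum>n | x k n \<noteq> 0. c k n * z n) \<le> (1 + 3 * \<delta>) * N z"
      "\<And>n. x k n \<noteq> 0 \<Longrightarrow> n \<le> m k" "prev f k \<le> m k"
      "\<And>v. v \<in> insert (w k) (w ` {..<k}) \<Longrightarrow>
         \<exists>y\<in>c00. (\<forall>n. y n \<noteq> 0 \<longrightarrow> n \<le> m k) \<and> nrm E (v - \<iota> y) \<le> \<tau> \<delta> k" for k
    using f[of k] unfolding Q_def fk prod.case fst_conv by blast+
  show thesis
  proof (intro that block_sequence.intro block_sequence_axioms.intro)
    show "block_subspace \<phi> N E \<iota> W" ..
    show "near_block (m k) (\<tau> \<delta> (Suc k)) (w (Suc k)) (x (Suc k))" for k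
      using Q(1)[of "Suc k"] by (simp add: prev)
    show "real (m k) * norm (x (Suc k) n) \<le> \<tau> \<delta> (Suc k)" for k n
      using Q(2)[of "Suc k" n] by (simp add: prev)
    show "m k \<le> m (Suc k)" for k
      using Q(7)[of "Suc k"] by (simp add: prev)
    show "\<exists>y\<in>c00. (\<forall>n. y n \<noteq> 0 \<longrightarrow> n \<le> m k) \<and> nrm E (w j - \<iota> y) \<le> \<tau> \<delta> k" if "j \<le> k" for j k
      using Q(8)[of "w j" k] that by (auto simp: le_less)
  qed (fact \<delta> Q(3-6))+
qed


section \<open>Biorthogonal functionals and estimates for the blocks\<close>

text \<open>
  If the matrix \<open>F k (w j)\<close> is lower triangular with unit diagonal, subtracting the part of \<open>F k\<close> that
  earlier functionals already account for turns \<open>F\<close> into a system that is exactly biorthogonal to \<open>w\<close>.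
  No operator has to be inverted, and if the entries below the diagonal are small, so is the change.
\<close>

fun biorthogonal :: "(nat \<Rightarrow> 'e \<Rightarrow> 'k::comm_ring_1) \<Rightarrow> (nat \<Rightarrow> 'e) \<Rightarrow> nat \<Rightarrow> 'e \<Rightarrow> 'k" where
  "biorthogonal F w k v = F k v - (\<Sum>j\<in>{1..<k}. F k (w j) * biorthogonal F w j v)"

declare biorthogonal.simps [simp del]

lemma biorthogonal_eq:
  assumes diag: "\<And>k. 1 \<le> k \<Longrightarrow> F k (w k) = 1"
    and upper: "\<And>j k. 1 \<le> k \<Longrightarrow> k < j \<Longrightarrow> F k (w j) = 0"
    and "1 \<le> k" "1 \<le> j"
  shows "biorthogonal F w k (w j) = (if k = j then 1 else 0)"
  using assms(3,4)
proof (induction k arbitrary: j rule: less_induct)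
  case (less k)
  have "biorthogonal F w k (w j) = F k (w j) - (\<Sum>i\<in>{1..<k}. F k (w i) * (if i = j then 1 else 0))"
    using less by (subst biorthogonal.simps) (intro arg_cong2[of _ _ _ _ "(-)"] sum.cong, auto)
  also have "(\<Sum>i\<in>{1..<k}. F k (w i) * (if i = j then 1 else 0)) = (\<Sum>i\<in>{1..<k}. if j = i then F k (w i) else 0)"
    by (intro sum.cong) auto
  also have "\<dots> = (if j < k then F k (w j) else 0)"
    using less.prems by simp
  finally show ?case
    using diag upper less.prems by (cases j k rule: linorder_cases) auto
qed

context block_sequence
begin

definition F :: "nat \<Rightarrow> 'e \<Rightarrow> 'k" where
  "F k v = (\<Sum>n | x k n \<noteq> 0. c k n * coord v n)"

abbreviation g :: "nat \<Rightarrow> 'e \<Rightarrow> 'k" where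
  "g \<equiv> biorthogonal F w"

lemma block':
  assumes "1 \<le> k"
  shows "w k \<in> W" "x k \<in> c00" "N (x k) = 1" "\<And>n. x k n \<noteq> 0 \<Longrightarrow> m (k - 1) < n"
    "\<And>n. n \<le> m (k - 1) \<Longrightarrow> coord (w k) n = 0" "nrm E (w k - \<iota> (x k)) \<le> \<tau> \<delta> k"
  using block[of "k - 1"] assms by (auto simp: near_block_def)

lemma w_vecs: "1 \<le> k \<Longrightarrow> w k \<in> vecs E"
  using block' W_vecs by blast

lemma m_le: "j \<le> k \<Longrightarrow> m j \<le> m k"
  using m_mono by (rule lift_Suc_mono_le)

lemma F_add: "u \<in> vecs E \<Longrightarrow> v \<in> vecs E \<Longrightarrow> F k (u + v) = F k u + F k v"
  by (simp add: F_def coord_add algebra_simps sum.distrib)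

lemma F_scale: "v \<in> vecs E \<Longrightarrow> F k (smul E t v) = t * F k v"
  by (simp add: F_def coord_scale sum_distrib_left mult.left_commute)

lemma F_diff: "u \<in> vecs E \<Longrightarrow> v \<in> vecs E \<Longrightarrow> F k (u - v) = F k u - F k v"
  by (simp add: F_def coord_diff algebra_simps sum_subtractf)

lemma F_le: "v \<in> vecs E \<Longrightarrow> norm (F k v) \<le> (1 + 3 * \<delta>) * nrm E v"
  unfolding F_def by (rule norm_functional_le[OF _ c_bound])

lemma F_le_2:
  assumes "v \<in> vecs E"
  shows "norm (F k v) \<le> 2 * nrm E v"
  using F_le[OF assms, of k] mult_right_mono[of "1 + 3 * \<delta>" 2 "nrm E v"] \<delta> assms by simp

lemma F_local:
  assumes z: "z \<in> c00" and k: "1 \<le> k"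
  shows "norm (F k (\<iota> z)) \<le> (1 + 3 * \<delta>) * N (keep {m (k - 1)<..m k} z)"
proof -
  have "F k (\<iota> z) = (\<Sum>n | x k n \<noteq> 0. c k n * keep {m (k - 1)<..m k} z n)"
    unfolding F_def using z block'(4)[OF k] x_supp by (intro sum.cong) (auto simp: keep_def)
  then show ?thesis
    using c_bound[of "keep {m (k - 1)<..m k} z"] z by simp
qed

lemma F_eq_0:
  assumes "1 \<le> k" "\<And>n. m (k - 1) < n \<Longrightarrow> n \<le> m k \<Longrightarrow> coord v n = 0"
  shows "F k v = 0"
  unfolding F_def using block'(4)[OF assms(1)] x_supp assms(2) by (intro sum.neutral) auto

lemma F_diag: "F k (w k) = 1"
  using c_w by (simp add: F_def)

lemma F_upper: "1 \<le> k \<Longrightarrow> k < j \<Longrightarrow> F k (w j) = 0"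
  using block'(5)[of j] order_trans[OF _ m_le[of k "j - 1"]] by (intro F_eq_0) auto

text \<open>
  \<open>w j\<close> is almost supported in \<open>[1, m (k - 1)]\<close>, where the functional \<open>F k\<close> sees nothing.
\<close>

lemma F_lower:
  assumes "1 \<le> j" "j < k"
  shows "norm (F k (w j)) \<le> \<delta> / (3 * real k * 2 ^ k)"
proof -
  obtain y where y: "y \<in> c00" "\<And>n. y n \<noteq> 0 \<Longrightarrow> n \<le> m (k - 1)" "nrm E (w j - \<iota> y) \<le> \<tau> \<delta> (k - 1)"
    using tail[of j "k - 1"] assms by fastforce
  have "F k (\<iota> y) = 0"
    using y(2) assms by (intro F_eq_0) (auto simp: y(1) not_le[symmetric])
  then have "F k (w j) = F k (w j - \<iota> y)"
    using y(1) assms w_vecs by (simp add: F_diff)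
  then have "norm (F k (w j)) \<le> 2 * nrm E (w j - \<iota> y)"
    using F_le_2[of "w j - \<iota> y" k] y(1) assms w_vecs by simp
  also have "\<dots> \<le> 2 * \<tau> \<delta> (k - 1)"
    using y(3) by simp
  also have "\<dots> = \<delta> / (3 * real k * 2 ^ k)"
    using assms by (simp add: \<tau>_def)
  finally show ?thesis .
qed

text \<open>
  Successive pieces of a vector satisfy the lower \<open>\<phi>\<close>-estimate, so the functionals \<open>F k\<close>, each of
  which sees one piece only, jointly map \<open>E\<close> into the sequence space.
\<close>

lemma initial_norm_F_c00:
  assumes z: "z \<in> c00"
  shows "initial_norm (\<lambda>k. F k (\<iota> z)) n \<le> (1 + 3 * \<delta>) * N (keep {..m n} z)"
proof (induction n)
  case 0
  show ?case
    using N_nonneg[of "keep {..m 0} z"] z \<delta> by simp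
next
  case (Suc n)
  have split: "keep {..m (Suc n)} z = keep {..m n} z + keep {m n<..m (Suc n)} z"
    using m_mono[of n] by (fastforce simp: keep_def)
  have "initial_norm (\<lambda>k. F k (\<iota> z)) (Suc n)
      \<le> \<phi> ((1 + 3 * \<delta>) * N (keep {..m n} z)) ((1 + 3 * \<delta>) * N (keep {m n<..m (Suc n)} z))"
    using Suc F_local[OF z, of "Suc n"] by (auto intro!: \<phi>_mono)
  also have "\<dots> = (1 + 3 * \<delta>) * \<phi> (N (keep {..m n} z)) (N (keep {m n<..m (Suc n)} z))"
    using z \<delta> N_nonneg by (intro \<phi>_scale) auto
  also have "\<phi> (N (keep {..m n} z)) (N (keep {m n<..m (Suc n)} z)) \<le> N (keep {..m (Suc n)} z)"
    unfolding split using z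
    by (intro lower[where m = "m n"] c00_keep) (auto simp: keep_def split: if_splits)
  finally show ?case
    using \<delta> by simp
qed

lemma initial_norm_F:
  assumes v: "v \<in> vecs E"
  shows "initial_norm (\<lambda>k. F k v) n \<le> (1 + 3 * \<delta>) * nrm E v"
proof (rule LIMSEQ_le_const)
  let ?e = "\<lambda>i. nrm E (v - \<iota> (approx v i))"
  show "(\<lambda>i. (1 + 3 * \<delta>) * N (approx v i) + (\<Sum>k=1..n. 2 * ?e i)) \<longlonglongrightarrow> (1 + 3 * \<delta>) * nrm E v"
    by (rule tendsto_eq_intros approx_nrm_limit[OF v] approx_limit[OF v] refl)+ simp
  have "initial_norm (\<lambda>k. F k v) n \<le> (1 + 3 * \<delta>) * N (approx v i) + (\<Sum>k=1..n. 2 * ?e i)" for i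
  proof -
    let ?z = "approx v i"
    have z: "?z \<in> c00"
      using approx(1)[OF v] .
    have "initial_norm (\<lambda>k. F k v) n = initial_norm (\<lambda>k. F k (\<iota> ?z) + F k (v - \<iota> ?z)) n"
      using v z by (simp add: F_diff)
    also have "\<dots> \<le> initial_norm (\<lambda>k. F k (\<iota> ?z)) n + (\<Sum>k=1..n. norm (F k (v - \<iota> ?z)))"
      by (rule initial_norm_add)
    also have "initial_norm (\<lambda>k. F k (\<iota> ?z)) n \<le> (1 + 3 * \<delta>) * N ?z"
      using order_trans[OF initial_norm_F_c00[OF z] mult_left_mono[OF keep_le[OF z]]] \<delta> by simp
    also have "(\<Sum>k=1..n. norm (F k (v - \<iota> ?z))) \<le> (\<Sum>k=1..n. 2 * ?e i)"
      using v z by (intro sum_mono F_le_2) auto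
    finally show ?thesis
      by simp
  qed
  then show "\<exists>M. \<forall>i\<ge>M. initial_norm (\<lambda>k. F k v) n \<le> (1 + 3 * \<delta>) * N (approx v i) + (\<Sum>k=1..n. 2 * ?e i)"
    by blast
qed

text \<open>
  On a finitely supported vector all but finitely many of the functionals vanish, and they are
  uniformly bounded.
\<close>

lemma F_tendsto_0:
  assumes v: "v \<in> vecs E"
  shows "(\<lambda>k. F k v) \<longlonglongrightarrow> 0"
proof (rule LIMSEQ_I)
  fix r :: real assume "0 < r"
  then obtain z where z: "z \<in> c00" "nrm E (v - \<iota> z) < r / 2"
    using dense_approx[OF v, of "r / 2"] by auto
  obtain l where l: "\<And>n. z n \<noteq> 0 \<Longrightarrow> n \<le> l"
    using c00_bounded[OF z(1)] by blast
  have "m k < m (Suc k)" for k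
    using block'(3,4)[of "Suc k"] c_w[of "Suc k"] x_supp[of "Suc k"]
    by (metis (mono_tags, lifting) diff_Suc_1 le_add1 less_le_trans mem_Collect_eq plus_1_eq_Suc sum.neutral zero_neq_one)
  then have "strict_mono m"
    by (simp add: strict_mono_Suc_iff)
  then have km: "k \<le> m k" for k
    by (rule strict_mono_imp_increasing)
  have "norm (F k v - 0) < r" if k: "Suc l \<le> k" for k
  proof -
    have "F k (\<iota> z) = 0"
      using k km[of "k - 1"] l by (intro F_eq_0) (fastforce simp: z(1))+
    then have "F k v = F k (v - \<iota> z)"
      using v z by (simp add: F_diff)
    then show ?thesis
      using F_le_2[of "v - \<iota> z" k] v z by simp
  qed
  then show "\<exists>M. \<forall>k\<ge>M. norm (F k v - 0) < r"
    by blast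
qed

lemma g_add: "u \<in> vecs E \<Longrightarrow> v \<in> vecs E \<Longrightarrow> g k (u + v) = g k u + g k v"
proof (induction k rule: less_induct)
  case (less k)
  have "(\<Sum>j\<in>{1..<k}. F k (w j) * g j (u + v)) = (\<Sum>j\<in>{1..<k}. F k (w j) * (g j u + g j v))"
    using less by (intro sum.cong) auto
  then show ?case
    using less.prems
    by (simp add: biorthogonal.simps[of F w k] F_add algebra_simps sum.distrib)
qed

lemma g_scale: "v \<in> vecs E \<Longrightarrow> g k (smul E t v) = t * g k v"
proof (induction k rule: less_induct)
  case (less k)
  have "(\<Sum>j\<in>{1..<k}. F k (w j) * g j (smul E t v)) = t * (\<Sum>j\<in>{1..<k}. F k (w j) * g j v)"
    using less unfolding sum_distrib_left by (intro sum.cong) (auto simp: mult.left_commute)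
  then show ?case
    using less.prems
    by (simp add: biorthogonal.simps[of F w k] F_scale right_diff_distrib)
qed

text \<open>
  The matrix entries below the diagonal in row \<open>k\<close> are so small that the correction of \<open>F k\<close> stays
  below \<open>\<delta> / 2 ^ k\<close> in norm as long as the earlier functionals have norm at most three.
\<close>

lemma g_close:
  assumes v: "v \<in> vecs E"
  shows "norm (g k v) \<le> 3 * nrm E v \<and> norm (g k v - F k v) \<le> \<delta> * (1 / 2 ^ k) * nrm E v"
proof (induction k rule: less_induct)
  case (less k)
  have "norm (F k (w j) * g j v) \<le> (\<delta> / (3 * real k * 2 ^ k)) * (3 * nrm E v)" if "j \<in> {1..<k}" for j
    unfolding norm_mult using that less \<delta> F_lower by (intro mult_mono) auto
  then have "(\<Sum>j\<in>{1..<k}. norm (F k (w j) * g j v))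
      \<le> real (k - 1) * ((\<delta> / (3 * real k * 2 ^ k)) * (3 * nrm E v))"
    using sum_bounded_above[of "{1..<k}" "\<lambda>j. norm (F k (w j) * g j v)"
        "(\<delta> / (3 * real k * 2 ^ k)) * (3 * nrm E v)"] by (simp only: card_atLeastLessThan)
  also have "\<dots> \<le> real k * ((\<delta> / (3 * real k * 2 ^ k)) * (3 * nrm E v))"
    using \<delta> v by (intro mult_right_mono) auto
  also have "\<dots> \<le> \<delta> * (1 / 2 ^ k) * nrm E v"
    using \<delta> v by (cases "k = 0") auto
  finally have "norm (\<Sum>j\<in>{1..<k}. F k (w j) * g j v) \<le> \<delta> * (1 / 2 ^ k) * nrm E v"
    by (rule order_trans[OF norm_sum])
  then have close: "norm (g k v - F k v) \<le> \<delta> * (1 / 2 ^ k) * nrm E v"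
    by (simp add: biorthogonal.simps[of F w k])
  have "\<delta> * (1 / 2 ^ k) \<le> 1 * 1"
    using \<delta> by (intro mult_mono) auto
  then have "norm (g k v - F k v) \<le> nrm E v"
    using close mult_right_mono[of "\<delta> * (1 / 2 ^ k)" 1 "nrm E v"] v by simp
  then have "norm (g k v) \<le> 3 * nrm E v"
    using F_le_2[OF v, of k] norm_triangle_ineq[of "F k v" "g k v - F k v"] by simp
  with close show ?case
    by blast
qed

lemma g_tendsto_0:
  assumes v: "v \<in> vecs E"
  shows "(\<lambda>k. g k v) \<longlonglongrightarrow> 0"
proof -
  have "(\<lambda>k. g k v - F k v) \<longlonglongrightarrow> 0"
  proof (rule Lim_null_comparison)
    have "(\<lambda>k. (1 / 2) ^ k :: real) \<longlonglongrightarrow> 0"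
      by (intro LIMSEQ_power_zero) simp
    then show "(\<lambda>k. \<delta> * (1 / 2 ^ k) * nrm E v) \<longlonglongrightarrow> 0"
      using tendsto_mult_right[of "\<lambda>k. 1 / 2 ^ k" 0 sequentially "\<delta> * nrm E v"]
      by (simp add: power_one_over mult.commute mult.left_commute)
  qed (use g_close[OF v] in auto)
  from tendsto_add[OF this F_tendsto_0[OF v]] show ?thesis
    by simp
qed

lemma initial_norm_g:
  assumes v: "v \<in> vecs E"
  shows "initial_norm (\<lambda>k. g k v) n \<le> (1 + 4 * \<delta>) * nrm E v"
proof -
  have "initial_norm (\<lambda>k. g k v) n = initial_norm (\<lambda>k. F k v + (g k v - F k v)) n"
    by simp
  also have "\<dots> \<le> initial_norm (\<lambda>k. F k v) n + (\<Sum>k=1..n. norm (g k v - F k v))"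
    by (rule initial_norm_add)
  also have "(\<Sum>k=1..n. norm (g k v - F k v)) \<le> (\<Sum>k=1..n. \<delta> * (1 / 2 ^ k) * nrm E v)"
    using g_close[OF v] by (intro sum_mono) blast
  also have "\<dots> = \<delta> * nrm E v * (\<Sum>k=1..n. 1 / 2 ^ k)"
    by (simp add: sum_distrib_left mult.commute mult.left_commute)
  also have "\<dots> \<le> \<delta> * nrm E v * 1"
    using \<delta> v sum_half_powers_le by (intro mult_left_mono) auto
  finally show ?thesis
    using initial_norm_F[OF v, of n] by (simp add: algebra_simps)
qed

text \<open>
  Adding one more flat block costs, by the upper estimate, hardly more than \<open>\<phi>\<close>. Hence the vectors
  \<open>x k\<close>, and with them their neighbours \<open>w k\<close>, satisfy an upper \<open>\<phi>\<close>-estimate with constant near one.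
\<close>

lemma norm_block_sum_le:
  "N (\<Sum>k=1..n. seq_scale (b k) (x k)) \<le> (1 + (\<Sum>k=1..n. \<tau> \<delta> k)) * initial_norm b n"
proof (induction n)
  case 0
  show ?case
    using isometric[of 0] by (simp add: \<iota>_0 del: zero_fun_apply)
next
  case (Suc n)
  define y where "y = (\<Sum>k=1..n. seq_scale (b k) (x k))"
  define z where "z = seq_scale (b (Suc n)) (x (Suc n))"
  define r where "r = 1 + (\<Sum>k=1..n. \<tau> \<delta> k)"
  have r: "1 \<le> r"
    using \<tau>_pos[OF \<delta>(1)] by (simp add: r_def sum_nonneg less_imp_le)
  have y: "y \<in> c00"
    by (auto simp: y_def intro!: c00_sum c00_scale block')
  have z: "z \<in> c00" "N z = norm (b (Suc n))"
    using block'[of "Suc n"] by (auto simp: z_def N_scale)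
  have y_supp: "i \<le> m n" if "y i \<noteq> 0" for i
  proof (rule ccontr)
    assume "\<not> i \<le> m n"
    then have "x k i = 0" if "k \<in> {1..n}" for k
      using x_supp[of k i] m_le[of k n] that by fastforce
    then have "y i = 0"
      by (simp add: y_def sum_fun_apply seq_scale_def)
    with that show False
      by simp
  qed
  have z_supp: "m n < i" if "z i \<noteq> 0" for i
    using that block'(4)[of "Suc n" i] by (auto simp: z_def seq_scale_def)
  have "N (y + z) \<le> \<phi> (N y) (N z) + (\<tau> \<delta> (Suc n) * norm (b (Suc n)))"
  proof (cases "m n = 0")
    case True
    have "N (y + z) \<le> \<phi> (N y) (N z) + real (m n) * N z"
      using coord_le[OF z(1)] by (intro upper y z(1) y_supp z_supp)
    moreover have "0 \<le> \<tau> \<delta> (Suc n) * norm (b (Suc n))"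
      using \<tau>_pos[OF \<delta>(1), of "Suc n"] by simp
    ultimately show ?thesis
      using True by simp
  next
    case False
    have "norm (z i) \<le> \<tau> \<delta> (Suc n) / real (m n) * norm (b (Suc n))" for i
    proof -
      have "norm (x (Suc n) i) \<le> \<tau> \<delta> (Suc n) / real (m n)"
        using flat[of n i] False by (simp add: field_simps)
      then have "norm (b (Suc n)) * norm (x (Suc n) i) \<le> norm (b (Suc n)) * (\<tau> \<delta> (Suc n) / real (m n))"
        by (intro mult_left_mono) auto
      then show ?thesis
        by (simp add: z_def seq_scale_def norm_mult mult.commute)
    qed
    then have "N (y + z) \<le> \<phi> (N y) (N z) + real (m n) * (\<tau> \<delta> (Suc n) / real (m n) * norm (b (Suc n)))"
      by (intro upper y z(1) y_supp z_supp)
    then show ?thesis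
      using False by simp
  qed
  also have "\<phi> (N y) (N z) \<le> \<phi> (r * initial_norm b n) (r * norm (b (Suc n)))"
    using Suc r z(2) N_nonneg[OF y] mult_right_mono[OF r, of "norm (b (Suc n))"]
    unfolding y_def[symmetric] r_def[symmetric] by (intro \<phi>_mono) auto
  also have "\<dots> = r * initial_norm b (Suc n)"
    using r by (simp add: \<phi>_scale)
  also have "\<tau> \<delta> (Suc n) * norm (b (Suc n)) \<le> \<tau> \<delta> (Suc n) * initial_norm b (Suc n)"
    using \<tau>_pos[OF \<delta>(1), of "Suc n"] by (intro mult_left_mono norm_le_initial_norm) auto
  finally show ?case
    by (simp add: y_def z_def r_def algebra_simps)
qed

lemma norm_w_sum_le:
  "nrm E (\<Sum>k=1..n. smul E (b k) (w k)) \<le> (1 + 2 * \<delta>) * initial_norm b n"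
proof -
  let ?y = "\<Sum>k=1..n. seq_scale (b k) (x k)"
  have y: "?y \<in> c00"
    by (auto intro!: c00_sum c00_scale block')
  have "(\<Sum>k=1..n. smul E (b k) (w k)) = \<iota> ?y + (\<Sum>k=1..n. smul E (b k) (w k - \<iota> (x k)))"
    by (subst \<iota>_sum) (auto simp: block' \<iota>_scale vs.scale_right_diff_distrib sum_subtractf)
  also have "nrm E \<dots> \<le> N ?y + nrm E (\<Sum>k=1..n. smul E (b k) (w k - \<iota> (x k)))"
    unfolding isometric[OF y, symmetric] using y
    by (intro nrm_triangle \<iota>_vecs vecs_sum vecs_scale vecs_diff w_vecs block') auto
  also have "nrm E (\<Sum>k=1..n. smul E (b k) (w k - \<iota> (x k)))
      \<le> (\<Sum>k=1..n. nrm E (smul E (b k) (w k - \<iota> (x k))))"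
    by (intro nrm_sum) (auto intro!: vecs_scale vecs_diff w_vecs \<iota>_vecs block')
  also have "\<dots> \<le> (\<Sum>k=1..n. \<tau> \<delta> k * initial_norm b n)"
  proof (rule sum_mono)
    fix k assume k: "k \<in> {1..n}"
    then have "nrm E (smul E (b k) (w k - \<iota> (x k))) = nrm E (w k - \<iota> (x k)) * norm (b k)"
      using w_vecs block' by (simp add: nrm_scale mult.commute)
    also have "\<dots> \<le> \<tau> \<delta> k * initial_norm b n"
      using k block'(6)[of k] norm_le_initial_norm[of k n b] \<tau>_pos[OF \<delta>(1), of k]
      by (intro mult_mono) auto
    finally show "nrm E (smul E (b k) (w k - \<iota> (x k))) \<le> \<tau> \<delta> k * initial_norm b n" .
  qed
  also have "\<dots> = (\<Sum>k=1..n. \<tau> \<delta> k) * initial_norm b n"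
    by (simp add: sum_distrib_right)
  also have "N ?y + \<dots> \<le> (1 + 2 * (\<Sum>k=1..n. \<tau> \<delta> k)) * initial_norm b n"
    using norm_block_sum_le[of b n] by (simp add: algebra_simps)
  also have "\<dots> \<le> (1 + 2 * \<delta>) * initial_norm b n"
    using \<tau>_sum_le[OF \<delta>(1), of n] by (intro mult_right_mono) auto
  finally show ?thesis
    by simp
qed

end


section \<open>Factoring the identity of the sequence space\<close>

text \<open>
  An abstract form of \<open>l_p\<close> and \<open>c_0\<close>: the norm is controlled by the initial segments, to which each
  further coordinate is joined through \<open>\<phi>\<close>. The tails of a member are small, and a null sequence
  whose initial segments are bounded is a member.
\<close>

locale joined_space = joining \<phi> for \<phi> +
  fixes D :: "('k::{real_normed_field,banach}, nat \<Rightarrow> 'k) nspace"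
  assumes D_smul: "smul D = seq_scale"
    and D_zero: "a \<in> vecs D \<Longrightarrow> a 0 = 0"
    and D_initial: "a \<in> vecs D \<Longrightarrow> initial_norm a n \<le> nrm D a"
    and D_tail: "a \<in> vecs D \<Longrightarrow> 0 < \<epsilon> \<Longrightarrow> \<exists>M. \<forall>n. initial_norm (\<lambda>k. if k \<le> M then 0 else a k) n \<le> \<epsilon>"
    and D_member: "a 0 = 0 \<Longrightarrow> a \<longlonglongrightarrow> 0 \<Longrightarrow> (\<And>n. initial_norm a n \<le> R) \<Longrightarrow> a \<in> vecs D \<and> nrm D a \<le> R"

locale block_factorization = block_sequence \<phi> N E \<iota> W \<delta> w x c m + joined_space \<phi> D
  for \<phi> and N :: "(nat \<Rightarrow> 'k::{real_normed_field,banach}) \<Rightarrow> real"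
    and E :: "('k, 'e::ab_group_add) nspace" and \<iota> and W and \<delta> w x c m
    and D :: "('k, nat \<Rightarrow> 'k) nspace"
begin

definition partial_sum :: "(nat \<Rightarrow> 'k) \<Rightarrow> nat \<Rightarrow> 'e" where
  "partial_sum a n = (\<Sum>k=1..n. smul E (a k) (w k))"

definition U :: "(nat \<Rightarrow> 'k) \<Rightarrow> 'e" where
  "U a = (SOME v. v \<in> vecs E \<and> (\<lambda>n. nrm E (partial_sum a n - v)) \<longlonglongrightarrow> 0)"

definition V :: "'e \<Rightarrow> nat \<Rightarrow> 'k" where
  "V v = (\<lambda>k. if k = 0 then 0 else g k v)"

lemma partial_sum_W: "partial_sum a n \<in> W"
  unfolding partial_sum_def
  by (intro vs.subspace_sum[OF subspace_W] vs.subspace_scale[OF subspace_W] block') auto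

lemma partial_sum_vecs [simp]: "partial_sum a n \<in> vecs E"
  using partial_sum_W W_vecs by blast

lemma U_eqI:
  assumes "v \<in> vecs E" "(\<lambda>n. nrm E (partial_sum a n - v)) \<longlonglongrightarrow> 0"
  shows "U a = v"
  unfolding U_def
proof (rule some_equality)
  fix u assume "u \<in> vecs E \<and> (\<lambda>n. nrm E (partial_sum a n - u)) \<longlonglongrightarrow> 0"
  then show "u = v"
    using limit_unique[of "partial_sum a" u v] partial_sum_vecs assms by blast
qed (use assms in blast)

text \<open>
  The partial sums form a Cauchy sequence because the upper estimate \<open>norm_w_sum_le\<close> applies to the
  coefficients with an initial segment replaced by zeros.
\<close>

lemma U_limit:
  assumes a: "a \<in> vecs D"
  shows "U a \<in> vecs E" "(\<lambda>n. nrm E (partial_sum a n - U a)) \<longlonglongrightarrow> 0"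
proof -
  obtain v where v: "v \<in> vecs E" "(\<lambda>n. nrm E (partial_sum a n - v)) \<longlonglongrightarrow> 0"
  proof (rule Cauchy_imp_limit[of "partial_sum a"])
    fix \<epsilon> :: real assume \<epsilon>: "0 < \<epsilon>"
    obtain M where M: "\<And>n. initial_norm (\<lambda>k. if k \<le> M then 0 else a k) n \<le> \<epsilon> / 6"
      using D_tail[OF a, of "\<epsilon> / 6"] \<epsilon> by auto
    have close: "nrm E (partial_sum a n - partial_sum a M) \<le> \<epsilon> / 3" if "M \<le> n" for n
    proof -
      let ?b = "\<lambda>k. if k \<le> M then 0 else a k"
      have "{1..n} = {1..M} \<union> {Suc M..n}"
        using that by auto
      then have "partial_sum a n = partial_sum a M + (\<Sum>k=Suc M..n. smul E (a k) (w k))"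
        unfolding partial_sum_def by (simp add: sum.union_disjoint)
      also have "(\<Sum>k=Suc M..n. smul E (a k) (w k)) = (\<Sum>k=1..n. smul E (?b k) (w k))"
        by (rule sum.mono_neutral_cong_left) auto
      finally have "partial_sum a n - partial_sum a M = (\<Sum>k=1..n. smul E (?b k) (w k))"
        by simp
      then have "nrm E (partial_sum a n - partial_sum a M) \<le> (1 + 2 * \<delta>) * initial_norm ?b n"
        using norm_w_sum_le[of ?b n] by simp
      also have "\<dots> \<le> 2 * (\<epsilon> / 6)"
        using M[of n] \<delta> by (intro mult_mono) auto
      finally show ?thesis
        by simp
    qed
    show "\<exists>M. \<forall>i\<ge>M. \<forall>j\<ge>M. nrm E (partial_sum a i - partial_sum a j) < \<epsilon>"
    proof (intro exI allI impI)
      fix i j assume ij: "M \<le> i" "M \<le> j"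
      have "nrm E (partial_sum a i - partial_sum a j)
          \<le> nrm E (partial_sum a i - partial_sum a M) + nrm E (partial_sum a M - partial_sum a j)"
        by (intro nrm_diff_triangle) auto
      then show "nrm E (partial_sum a i - partial_sum a j) < \<epsilon>"
        using close[OF ij(1)] close[OF ij(2)] \<epsilon>
          nrm_minus_commute[of "partial_sum a M" "partial_sum a j"] by simp
    qed
  qed auto
  then have "U a = v"
    by (intro U_eqI)
  with v show "U a \<in> vecs E" "(\<lambda>n. nrm E (partial_sum a n - U a)) \<longlonglongrightarrow> 0"
    by auto
qed

lemma U_W: "a \<in> vecs D \<Longrightarrow> U a \<in> W"
  by (rule closed_subspace_limit[OF closed_W partial_sum_W U_limit])

lemma U_add:
  assumes a: "a \<in> vecs D" and b: "b \<in> vecs D"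
  shows "U (a + b) = U a + U b"
proof (rule U_eqI)
  have sum: "partial_sum (a + b) n = partial_sum a n + partial_sum b n" for n
    by (simp add: partial_sum_def vs.scale_left_distrib sum.distrib)
  have le: "nrm E (partial_sum (a + b) n - (U a + U b))
      \<le> nrm E (partial_sum a n - U a) + nrm E (partial_sum b n - U b)" for n
    using nrm_triangle[of "partial_sum a n - U a" "partial_sum b n - U b"] U_limit(1) a b
    unfolding sum by (simp add: algebra_simps)
  show "(\<lambda>n. nrm E (partial_sum (a + b) n - (U a + U b))) \<longlonglongrightarrow> 0"
  proof (rule tendsto_sandwich[OF _ _ tendsto_const])
    show "(\<lambda>n. nrm E (partial_sum a n - U a) + nrm E (partial_sum b n - U b)) \<longlonglongrightarrow> 0"
      using tendsto_add[OF U_limit(2)[OF a] U_limit(2)[OF b]] by simp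
    show "\<forall>\<^sub>F n in sequentially. nrm E (partial_sum (a + b) n - (U a + U b))
      \<le> nrm E (partial_sum a n - U a) + nrm E (partial_sum b n - U b)"
      using le by (intro always_eventually allI)
    show "\<forall>\<^sub>F n in sequentially. 0 \<le> nrm E (partial_sum (a + b) n - (U a + U b))"
      using a b U_limit(1) by (intro always_eventually allI nrm_ge_0 vecs_diff vecs_add partial_sum_vecs)
  qed
qed (use a b U_limit(1) in simp)

lemma U_scale:
  assumes a: "a \<in> vecs D"
  shows "U (seq_scale t a) = smul E t (U a)"
proof (rule U_eqI)
  have "partial_sum (seq_scale t a) n = smul E t (partial_sum a n)" for n
    by (simp add: partial_sum_def seq_scale_def vs.scale_sum_right)
  then have "nrm E (partial_sum (seq_scale t a) n - smul E t (U a))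
      = norm t * nrm E (partial_sum a n - U a)" for n
    using nrm_scale[of "partial_sum a n - U a" t] U_limit(1)[OF a]
    by (simp add: vs.scale_right_diff_distrib)
  then show "(\<lambda>n. nrm E (partial_sum (seq_scale t a) n - smul E t (U a))) \<longlonglongrightarrow> 0"
    using tendsto_mult_left[OF U_limit(2)[OF a], of "norm t"] by simp
qed (use a U_limit(1) in simp)

lemma U_bound:
  assumes a: "a \<in> vecs D"
  shows "nrm E (U a) \<le> (1 + 2 * \<delta>) * nrm D a"
proof (rule LIMSEQ_le_const)
  show "(\<lambda>n. (1 + 2 * \<delta>) * nrm D a + nrm E (partial_sum a n - U a)) \<longlonglongrightarrow> (1 + 2 * \<delta>) * nrm D a"
    using tendsto_add[OF tendsto_const U_limit(2)[OF a], of "(1 + 2 * \<delta>) * nrm D a"] by simp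
  have "nrm E (U a) \<le> (1 + 2 * \<delta>) * nrm D a + nrm E (partial_sum a n - U a)" for n
  proof -
    have "nrm E (partial_sum a n) \<le> (1 + 2 * \<delta>) * initial_norm a n"
      unfolding partial_sum_def by (rule norm_w_sum_le)
    also have "\<dots> \<le> (1 + 2 * \<delta>) * nrm D a"
      using D_initial[OF a] \<delta> by (intro mult_left_mono) auto
    finally show ?thesis
      using nrm_le_nrm_add_diff[of "U a" "partial_sum a n"] U_limit(1)[OF a]
        nrm_minus_commute[of "U a" "partial_sum a n"] by simp
  qed
  then show "\<exists>M. \<forall>n\<ge>M. nrm E (U a) \<le> (1 + 2 * \<delta>) * nrm D a + nrm E (partial_sum a n - U a)"
    by blast
qed

lemma V_D:
  assumes v: "v \<in> vecs E"
  shows "V v \<in> vecs D \<and> nrm D (V v) \<le> (1 + 4 * \<delta>) * nrm E v"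
proof (rule D_member)
  show "V v \<longlonglongrightarrow> 0"
  proof (rule Lim_transform_eventually[OF g_tendsto_0[OF v]])
    show "\<forall>\<^sub>F k in sequentially. g k v = V v k"
      using eventually_gt_at_top[of 0] by eventually_elim (simp add: V_def)
  qed
  have "initial_norm (V v) n = initial_norm (\<lambda>k. g k v) n" for n
    by (induction n) (simp_all add: V_def)
  then show "initial_norm (V v) n \<le> (1 + 4 * \<delta>) * nrm E v" for n
    using initial_norm_g[OF v] by simp
qed (simp add: V_def)

lemma g_0: "g k 0 = 0"
  using g_add[of 0 0 k] by simp

lemma g_sum: "(\<And>i. i \<in> I \<Longrightarrow> u i \<in> vecs E) \<Longrightarrow> g k (sum u I) = (\<Sum>i\<in>I. g k (u i))"
  by (induction I rule: infinite_finite_induct) (auto simp: g_0 g_add vecs_sum)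

text \<open>
  By biorthogonality \<open>g k\<close> maps all partial sums from the \<open>k\<close>-th on to \<open>a k\<close>, and \<open>g k\<close> is continuous.
\<close>

lemma V_U:
  assumes a: "a \<in> vecs D"
  shows "V (U a) = a"
proof
  fix k
  show "V (U a) k = a k"
  proof (cases "k = 0")
    case True
    then show ?thesis
      using D_zero[OF a] by (simp add: V_def)
  next
    case False
    have g_partial: "g k (partial_sum a n) = a k" if "k \<le> n" for n
    proof -
      have "g k (partial_sum a n) = (\<Sum>j=1..n. a j * g k (w j))"
        unfolding partial_sum_def by (subst g_sum) (auto simp: g_scale w_vecs)
      also have "\<dots> = (\<Sum>j=1..n. if k = j then a j else 0)"
        using False by (intro sum.cong refl) (auto simp: biorthogonal_eq[of F w, OF F_diag F_upper])
      also have "\<dots> = a k"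
        using False that by simp
      finally show ?thesis .
    qed
    have "(\<lambda>n. g k (partial_sum a n) - g k (U a)) \<longlonglongrightarrow> 0"
    proof (rule Lim_null_comparison)
      have "norm (g k (partial_sum a n) - g k (U a)) \<le> 3 * nrm E (partial_sum a n - U a)" for n
        using g_close[of "partial_sum a n - U a" k] g_add[of "partial_sum a n - U a" "U a" k]
          U_limit(1)[OF a] by simp
      then show "\<forall>\<^sub>F n in sequentially.
          norm (g k (partial_sum a n) - g k (U a)) \<le> 3 * nrm E (partial_sum a n - U a)"
        by simp
      show "(\<lambda>n. 3 * nrm E (partial_sum a n - U a)) \<longlonglongrightarrow> 0"
        using tendsto_mult_left[OF U_limit(2)[OF a], of 3] by simp
    qed
    moreover have "\<forall>\<^sub>F n in sequentially. g k (partial_sum a n) - g k (U a) = a k - g k (U a)"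
      using eventually_ge_at_top[of k] by eventually_elim (simp add: g_partial)
    ultimately have "(\<lambda>n. a k - g k (U a)) \<longlonglongrightarrow> 0"
      by (rule Lim_transform_eventually)
    then have "a k - g k (U a) = 0"
      by (simp add: LIMSEQ_const_iff)
    then show ?thesis
      using False by (simp add: V_def)
  qed
qed

lemma complemented_copy:
  assumes "(1 + 4 * \<delta>) * (1 + 4 * \<delta>) \<le> C"
  shows "\<exists>Z. closed_subspace E Z \<and> Z \<subseteq> W \<and>
         (\<exists>U. isomorphism_onto D (restrict_space_to E Z) U \<and>
            opnorm D (restrict_space_to E Z) U *
              opnorm (restrict_space_to E Z) D (inv_into (vecs D) U) \<le> C) \<and>
         (\<exists>P. projection_onto E Z P \<and> opnorm E E P \<le> C)"
proof (rule complemented_copy_if_identity_factors[of "1 + 4 * \<delta>" D U V])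
  show "linear_between D E U"
    using U_limit(1) U_add U_scale by (auto simp: linear_between_def D_smul)
  show "linear_between E D V"
    using V_D by (auto simp: linear_between_def D_smul V_def g_add g_scale seq_scale_def fun_eq_iff)
  show nonneg: "0 \<le> nrm D a" if "a \<in> vecs D" for a
    using D_initial[OF that, of 0] by simp
  show "nrm E (U a) \<le> (1 + 4 * \<delta>) * nrm D a" if "a \<in> vecs D" for a
    using order_trans[OF U_bound[OF that] mult_right_mono[OF _ nonneg[OF that]]] \<delta> by simp
  show "1 \<le> 1 + 4 * \<delta>"
    using \<delta> by simp
  show "nrm D (V v) \<le> (1 + 4 * \<delta>) * nrm E v" if "v \<in> vecs E" for v
    using V_D[OF that] by blast
  show "V (U a) = a" "U a \<in> W" if "a \<in> vecs D" for a
    using V_U[OF that] U_W[OF that] by blast+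
qed (fact assms)

end

locale saturated_pair = block_space \<phi> N E \<iota> + joined_space \<phi> D
  for \<phi> and N :: "(nat \<Rightarrow> 'k::{real_normed_field,banach}) \<Rightarrow> real"
    and E :: "('k, 'e::ab_group_add) nspace" and \<iota>
    and D :: "('k, nat \<Rightarrow> 'k) nspace"
begin

theorem uniformly_saturated:
  assumes C: "C > 1"
  shows "uniformly_saturated_complemented C E D"
  unfolding uniformly_saturated_complemented_def
proof (intro allI impI, elim conjE)
  fix W assume W: "closed_subspace E W" "infinite_dimensional E W"
  interpret block_subspace \<phi> N E \<iota> W
    by (intro block_subspace.intro block_subspace_axioms.intro block_space_axioms W)
  define \<delta> where "\<delta> = min (1 / 3) ((C - 1) / 14)"
  have \<delta>: "0 < \<delta>" "\<delta> \<le> 1 / 3"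
    using C by (auto simp: \<delta>_def)
  have \<delta>_C: "\<delta> \<le> (C - 1) / 14"
    unfolding \<delta>_def by (rule min.cobounded2)
  \<comment> \<open>Since \<open>\<delta> \<le> 1 / 3\<close>, the square of \<open>1 + 4 * \<delta>\<close> is below \<open>1 + 14 * \<delta>\<close>.\<close>
  have "(1 + 4 * \<delta>) * (1 + 4 * \<delta>) = 1 + 8 * \<delta> + 16 * (\<delta> * \<delta>)"
    by (simp add: algebra_simps)
  also have "\<dots> \<le> 1 + 8 * \<delta> + 16 * (1 / 3 * \<delta>)"
    using \<delta> by (intro add_left_mono mult_left_mono mult_right_mono) auto
  also have "\<dots> \<le> C"
    using \<delta>(1) \<delta>_C by simp
  finally have const: "(1 + 4 * \<delta>) * (1 + 4 * \<delta>) \<le> C" .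
  obtain w x c m where "block_sequence \<phi> N E \<iota> W \<delta> w x c m"
    using block_sequence_exists[OF \<delta>] .
  then interpret block_factorization \<phi> N E \<iota> W \<delta> w x c m D
    by (intro block_factorization.intro joined_space_axioms)
  show "\<exists>Z. closed_subspace E Z \<and> Z \<subseteq> W \<and>
         (\<exists>U. isomorphism_onto D (restrict_space_to E Z) U \<and>
            opnorm D (restrict_space_to E Z) U *
              opnorm (restrict_space_to E Z) D (inv_into (vecs D) U) \<le> C) \<and>
         (\<exists>P. projection_onto E Z P \<and> opnorm E E P \<le> C)"
    using const by (rule complemented_copy)
qed

end


section \<open>Elementary inequalities for p-th powers\<close>

lemma powr_convex_combination:
  fixes p x y u v :: real
  assumes p: "1 \<le> p" and nonneg: "0 \<le> x" "0 \<le> y" "0 \<le> u" "0 \<le> v" and uv: "u + v = 1"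
  shows "(u * x + v * y) powr p \<le> u * x powr p + v * y powr p"
proof -
  have scale: "(t * z) powr p \<le> t * z powr p" if "0 \<le> t" "t \<le> 1" "0 \<le> z" for t z :: real
  proof -
    have "t powr p \<le> t"
      using powr_mono'[of 1 p t] p that by simp
    then show ?thesis
      using that by (simp add: powr_mult mult_right_mono)
  qed
  show ?thesis
  proof (cases "x = 0 \<or> y = 0")
    case True
    then show ?thesis
      using scale[of u x] scale[of v y] nonneg uv p by auto
  next
    case False
    then have "x \<in> {0<..}" "y \<in> {0<..}"
      using nonneg by auto
    then show ?thesis
      using convex_onD[OF powr_convex[OF p], of v x y] nonneg uv
      by (simp add: eq_diff_eq[symmetric])
  qed
qed

text \<open>
  Enlarging one entry of a vector by \<open>v\<close> raises its p-norm by at most \<open>v\<close>: divide by \<open>S + v\<close>, where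
  \<open>S\<close> is the old p-norm, and use that the new vector is then a convex combination of the normalised
  old vector and a unit vector.
\<close>

lemma powr_root_add_le:
  fixes p A b v :: real
  assumes p: "1 \<le> p" and nonneg: "0 \<le> A" "0 \<le> b" "0 \<le> v"
  shows "(A + (b + v) powr p) powr (1 / p) \<le> (A + b powr p) powr (1 / p) + v"
proof -
  define S where "S = (A + b powr p) powr (1 / p)"
  have S: "0 \<le> S" "S powr p = A + b powr p"
    using p nonneg by (auto simp: S_def powr_powr)
  show ?thesis
  proof (cases "S = 0")
    case True
    then have "A = 0" "b = 0"
      using S nonneg p add_nonneg_eq_0_iff[of A "b powr p"] by auto
    then show ?thesis
      using p nonneg by (simp add: powr_powr)
  next
    case False
    then have Spos: "0 < S"
      using S by simp
    define T where "T = S + v"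
    have Tpos: "0 < T"
      using Spos nonneg by (simp add: T_def)
    then have "S / T + v / T = 1"
      by (simp add: T_def flip: add_divide_distrib)
    note T = Tpos this
    have scaled: "b + v = T * ((S / T) * (b / S) + (v / T) * 1)"
      using T(1) Spos by (simp add: field_simps)
    have "(b + v) powr p = T powr p * ((S / T) * (b / S) + (v / T) * 1) powr p"
      unfolding scaled by (rule powr_mult)
    also have "\<dots> \<le> T powr p * ((S / T) * (b / S) powr p + (v / T) * 1 powr p)"
      using T Spos nonneg p by (intro mult_left_mono powr_convex_combination) auto
    also have "\<dots> = T powr p * ((S / T) * (b powr p / S powr p) + v / T)"
      using Spos nonneg by (simp add: powr_divide)
    finally have b: "(b + v) powr p \<le> T powr p * ((S / T) * (b powr p / S powr p) + v / T)" .
    have "S / T \<le> 1"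
      using T nonneg Spos by (simp add: T_def)
    then have "(S / T) powr p \<le> S / T"
      using powr_mono'[of 1 p "S / T"] p Spos T by simp
    then have "T powr p * ((S / T) powr p * (A / S powr p)) \<le> T powr p * ((S / T) * (A / S powr p))"
      using nonneg by (intro mult_left_mono mult_right_mono) auto
    moreover have "T powr p * ((S / T) powr p * (A / S powr p)) = A"
      using T Spos by (simp add: powr_divide)
    ultimately have a: "A \<le> T powr p * ((S / T) * (A / S powr p))"
      by simp
    have "A + (b + v) powr p \<le> T powr p * ((S / T) * ((A + b powr p) / S powr p) + v / T)"
      using a b by (simp add: algebra_simps add_divide_distrib)
    also have "(A + b powr p) / S powr p = 1"
      using Spos by (simp flip: S(2))
    also have "T powr p * ((S / T) * 1 + v / T) = T powr p"
      using T(2) by simp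
    finally have "(A + (b + v) powr p) powr (1 / p) \<le> (T powr p) powr (1 / p)"
      using p nonneg by (intro powr_mono2) auto
    also have "\<dots> = T"
      using T(1) p by (simp add: powr_powr)
    finally show ?thesis
      by (simp add: T_def S_def)
  qed
qed

lemma joining_p:
  fixes p :: real
  assumes p: "1 \<le> p"
  shows "joining (\<lambda>s t. (s powr p + t powr p) powr (1 / p))"
proof
  fix s t s' t' c :: real
  show "(s powr p + t powr p) powr (1 / p) \<le> (s' powr p + t' powr p) powr (1 / p)"
    if "0 \<le> s" "s \<le> s'" "0 \<le> t" "t \<le> t'"
    using that p by (intro powr_mono2 add_mono) auto
  show "((c * s) powr p + (c * t) powr p) powr (1 / p) = c * (s powr p + t powr p) powr (1 / p)"
    if "0 \<le> c" "0 \<le> s" "0 \<le> t"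
  proof -
    have "(c * s) powr p + (c * t) powr p = c powr p * (s powr p + t powr p)"
      using that by (simp add: powr_mult algebra_simps)
    then show ?thesis
      using that p by (simp add: powr_mult powr_powr)
  qed
  have ge: "a \<le> (a powr p + b powr p) powr (1 / p)" if "0 \<le> a" "0 \<le> b" for a b :: real
  proof -
    have "a = (a powr p) powr (1 / p)"
      using that p by (simp add: powr_powr)
    also have "\<dots> \<le> (a powr p + b powr p) powr (1 / p)"
      using that p by (intro powr_mono2) auto
    finally show ?thesis .
  qed
  show "s \<le> (s powr p + t powr p) powr (1 / p)" if "0 \<le> s" "0 \<le> t"
    using ge that .
  show "t \<le> (s powr p + t powr p) powr (1 / p)" if "0 \<le> s" "0 \<le> t"
    using ge[of t s] that by (simp add: add.commute)
  show "((s + s') powr p + (t + t') powr p) powr (1 / p) \<le> (s powr p + t powr p) powr (1 / p) + s' + t'"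
    if "0 \<le> s" "0 \<le> t" "0 \<le> s'" "0 \<le> t'"
    using powr_root_add_le[OF p, of "(s + s') powr p" t t'] powr_root_add_le[OF p, of "t powr p" s s'] that
    by (simp add: add.commute)
qed

lemma p_norm_le_sum:
  fixes p :: real
  assumes p: "1 \<le> p" and "finite I" "\<And>i. i \<in> I \<Longrightarrow> 0 \<le> a i"
  shows "(\<Sum>i\<in>I. a i powr p) powr (1 / p) \<le> (\<Sum>i\<in>I. a i)"
  using assms(2,3)
proof (induction I rule: finite_induct)
  case (insert i I)
  have "(\<Sum>i\<in>insert i I. a i powr p) powr (1 / p) = ((\<Sum>i\<in>I. a i powr p) + (0 + a i) powr p) powr (1 / p)"
    using insert by (simp add: add.commute)
  also have "\<dots> \<le> ((\<Sum>i\<in>I. a i powr p) + 0 powr p) powr (1 / p) + a i"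
    using insert by (intro powr_root_add_le[OF p] sum_nonneg) auto
  also have "\<dots> \<le> (\<Sum>i\<in>insert i I. a i)"
    using insert by simp
  finally show ?case .
qed simp

text \<open>
  The Hoelder inequality for the conjugate exponents \<open>p / (p - 1)\<close> and \<open>p\<close>, divided by the p-th power
  of the p-norm of \<open>a\<close>. In this form it holds for \<open>p = 1\<close> as well. It follows from the inequality of
  Young applied to \<open>a i\<close> and \<open>l * b i\<close>, where \<open>l\<close> makes the two p-norms equal.
\<close>

lemma Holder_dual_bound:
  fixes p :: real
  assumes p: "1 \<le> p" and fin: "finite I"
    and nonneg: "\<And>i. i \<in> I \<Longrightarrow> 0 \<le> a i" "\<And>i. i \<in> I \<Longrightarrow> 0 \<le> b i"
    and pos: "0 < (\<Sum>i\<in>I. a i powr p)"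
  shows "(\<Sum>i\<in>I. a i powr (p - 1) * b i) / (\<Sum>i\<in>I. a i powr p)
     \<le> (\<Sum>i\<in>I. b i powr p) powr (1 / p) / (\<Sum>i\<in>I. a i powr p) powr (1 / p)"
proof -
  define S where "S = (\<Sum>i\<in>I. a i powr p)"
  define T where "T = (\<Sum>i\<in>I. b i powr p)"
  have S: "0 < S"
    using pos by (simp add: S_def)
  have T: "0 \<le> T"
    by (simp add: T_def sum_nonneg)
  have young: "s powr (p - 1) * t \<le> (p - 1) / p * s powr p + 1 / p * t powr p" if "0 \<le> s" "0 \<le> t" for s t :: real
  proof (cases "s = 0 \<or> t = 0")
    case False
    then have "0 < s powr p" "0 < t powr p"
      by auto
    then have "(s powr p) powr ((p - 1) / p) * (t powr p) powr (1 / p) \<le> (p - 1) / p * s powr p + 1 / p * t powr p"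
      using p by (intro Youngs_inequality_0) (auto simp: field_simps)
    then show ?thesis
      using p that by (simp add: powr_powr)
  qed (use p that in auto)
  show ?thesis
  proof (cases "T = 0")
    case True
    then have "b i = 0" if "i \<in> I" for i
      using that fin by (simp add: T_def sum_nonneg_eq_0_iff)
    then show ?thesis
      by simp
  next
    case False
    define l where "l = (S / T) powr (1 / p)"
    have l: "0 < l" "l powr p = S / T"
      using S T False p by (auto simp: l_def powr_powr)
    have "l * (\<Sum>i\<in>I. a i powr (p - 1) * b i) = (\<Sum>i\<in>I. a i powr (p - 1) * (l * b i))"
      by (simp add: sum_distrib_left mult.left_commute)
    also have "\<dots> \<le> (\<Sum>i\<in>I. (p - 1) / p * a i powr p + 1 / p * (l * b i) powr p)"
      using l nonneg by (intro sum_mono young) auto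
    also have "\<dots> = (p - 1) / p * S + 1 / p * (l powr p * T)"
      using l nonneg
      by (simp add: S_def T_def sum.distrib sum_distrib_left powr_mult cong: sum.cong)
    also have "\<dots> = S"
      using l T False p by (simp add: field_simps)
    finally have "(\<Sum>i\<in>I. a i powr (p - 1) * b i) / S \<le> 1 / l"
      using l S by (simp add: field_simps)
    also have "1 / l = T powr (1 / p) / S powr (1 / p)"
      using S T by (simp add: l_def powr_divide)
    finally show ?thesis
      by (simp add: S_def T_def)
  qed
qed


section \<open>Norms given by families of sets\<close>

text \<open>
  With successive Schreier sets as the members of \<open>G\<close>, \<open>family_norm\<close> is one of the quantities in the
  definition of the Baernstein norm; with the singletons in a Schreier set as members, it is one of
  those in the definition of the Schreier norm. In both cases \<open>sup_norm\<close> is the norm itself.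
\<close>

definition family_norm :: "real \<Rightarrow> nat set set \<Rightarrow> (nat \<Rightarrow> 'k::real_normed_field) \<Rightarrow> real" where
  "family_norm p G x = (\<Sum>A\<in>G. (\<Sum>n\<in>A. norm (x n)) powr p) powr (1 / p)"

definition sup_norm :: "real \<Rightarrow> nat set set set \<Rightarrow> (nat \<Rightarrow> 'k::real_normed_field) \<Rightarrow> real" where
  "sup_norm p \<G> x = Sup {family_norm p G x | G. G \<in> \<G>}"

definition singletons :: "nat set \<Rightarrow> nat set set" where
  "singletons F = (\<lambda>n. {n}) ` F"

lemma family_norm_singletons: "family_norm p (singletons F) x = (\<Sum>n\<in>F. norm (x n) powr p) powr (1 / p)"
  by (simp add: family_norm_def singletons_def sum.reindex inj_on_def)

lemma family_norm_nonneg: "0 \<le> family_norm p G x"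
  by (simp add: family_norm_def)

lemma family_norm_powr:
  "1 \<le> p \<Longrightarrow> family_norm p G x powr p = (\<Sum>A\<in>G. (\<Sum>n\<in>A. norm (x n)) powr p)"
  by (simp add: family_norm_def powr_powr sum_nonneg)

locale family_system =
  fixes p :: real and \<G> :: "nat set set set"
  assumes p: "1 \<le> p"
    and finite_family: "G \<in> \<G> \<Longrightarrow> finite G"
    and finite_member: "G \<in> \<G> \<Longrightarrow> A \<in> G \<Longrightarrow> finite A"
    and disjoint: "G \<in> \<G> \<Longrightarrow> A \<in> G \<Longrightarrow> B \<in> G \<Longrightarrow> A \<noteq> B \<Longrightarrow> A \<inter> B = {}"
    and singletons_mem: "F \<in> schreier_sets \<Longrightarrow> F \<noteq> {} \<Longrightarrow> singletons F \<in> \<G>"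
begin

lemma family_norm_mono:
  assumes "G \<in> \<G>" "\<And>n. norm (x n) \<le> norm (y n)"
  shows "family_norm p G x \<le> family_norm p G y"
proof -
  have "(\<Sum>n\<in>A. norm (x n)) powr p \<le> (\<Sum>n\<in>A. norm (y n)) powr p" for A
    using assms(2) p by (intro powr_mono2 sum_mono sum_nonneg) auto
  then have "(\<Sum>A\<in>G. (\<Sum>n\<in>A. norm (x n)) powr p) \<le> (\<Sum>A\<in>G. (\<Sum>n\<in>A. norm (y n)) powr p)"
    by (rule sum_mono)
  then show ?thesis
    unfolding family_norm_def using p by (intro powr_mono2 sum_nonneg) auto
qed

lemma family_norm_le_l1:
  assumes x: "x \<in> c00" and G: "G \<in> \<G>"
  shows "family_norm p G x \<le> (\<Sum>n | x n \<noteq> 0. norm (x n))"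
proof -
  have "family_norm p G x \<le> (\<Sum>A\<in>G. \<Sum>n\<in>A. norm (x n))"
    unfolding family_norm_def using G finite_family p by (intro p_norm_le_sum sum_nonneg) auto
  also have "\<dots> = (\<Sum>n\<in>\<Union>G. norm (x n))"
    using sum.Union_disjoint[of G "\<lambda>n. norm (x n)"] finite_member disjoint G by auto
  also have "\<dots> \<le> (\<Sum>n | x n \<noteq> 0. norm (x n))"
  proof -
    have "(\<Sum>n\<in>\<Union>G. norm (x n)) = (\<Sum>n\<in>\<Union>G \<inter> {n. x n \<noteq> 0}. norm (x n))"
      using G finite_family finite_member by (intro sum.mono_neutral_right) auto
    also have "\<dots> \<le> (\<Sum>n | x n \<noteq> 0. norm (x n))"
      using x by (intro sum_mono2) (auto simp: c00_def)
    finally show ?thesis .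
  qed
  finally show ?thesis .
qed

lemma family_norm_le:
  assumes x: "x \<in> c00" and G: "G \<in> \<G>"
  shows "family_norm p G x \<le> sup_norm p \<G> x"
  unfolding sup_norm_def
proof (rule cSup_upper)
  show "bdd_above {family_norm p G x | G. G \<in> \<G>}"
    using family_norm_le_l1[OF x] by (intro bdd_aboveI[of _ "\<Sum>n | x n \<noteq> 0. norm (x n)"]) blast
qed (use G in blast)

lemma one_singleton_mem: "n \<noteq> 0 \<Longrightarrow> singletons {n} \<in> \<G>"
  by (rule singletons_mem) (simp_all add: schreier_sets_def)

lemma sup_norm_le:
  assumes "\<And>G. G \<in> \<G> \<Longrightarrow> family_norm p G x \<le> R"
  shows "sup_norm p \<G> x \<le> R"
  unfolding sup_norm_def
proof (rule cSup_least)
  show "{family_norm p G x | G. G \<in> \<G>} \<noteq> {}"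
    using one_singleton_mem[of 1] by blast
qed (use assms in blast)

lemma sup_norm_nonneg: "x \<in> c00 \<Longrightarrow> 0 \<le> sup_norm p \<G> x"
  using order_trans[OF family_norm_nonneg family_norm_le[OF _ one_singleton_mem[of 1]]] by simp

lemma less_sup_norm:
  assumes "r < sup_norm p \<G> x"
  obtains G where "G \<in> \<G>" "r < family_norm p G x"
proof -
  have "\<exists>s\<in>{family_norm p G x |G. G \<in> \<G>}. r < s"
  proof (rule less_cSupD)
    show "{family_norm p G x | G. G \<in> \<G>} \<noteq> {}"
      using one_singleton_mem[of 1] by blast
  qed (use assms in \<open>simp add: sup_norm_def\<close>)
  then show thesis
    using that by blast
qed

lemma sup_norm_mono:
  assumes "y \<in> c00" "\<And>n. norm (x n) \<le> norm (y n)"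
  shows "sup_norm p \<G> x \<le> sup_norm p \<G> y"
proof (rule sup_norm_le)
  fix G assume G: "G \<in> \<G>"
  show "family_norm p G x \<le> sup_norm p \<G> y"
    using family_norm_mono[OF G, of x y] assms(2) family_norm_le[OF assms(1) G] by force
qed

lemma sup_norm_coord:
  assumes x: "x \<in> c00"
  shows "norm (x n) \<le> sup_norm p \<G> x"
proof (cases "n = 0")
  case True
  then show ?thesis
    using sup_norm_nonneg[OF x] x by (simp add: c00_def)
next
  case False
  have "norm (x n) = family_norm p (singletons {n}) x"
    using p by (simp add: family_norm_singletons powr_powr)
  then show ?thesis
    using family_norm_le[OF x one_singleton_mem[OF False]] by simp
qed

text \<open>
  The singletons in a Schreier set \<open>F\<close> contribute at least the p-th root of the cardinality of \<open>F\<close> if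
  all entries in \<open>F\<close> have modulus at least one.
\<close>

lemma sup_norm_growth:
  "\<exists>k. \<forall>F\<in>schreier_sets. \<forall>x\<in>c00. card F = k \<longrightarrow> (\<forall>n\<in>F. 1 \<le> norm (x n)) \<longrightarrow> R \<le> sup_norm p \<G> x"
proof -
  define k where "k = nat \<lceil>(max R 1) powr p\<rceil>"
  have k: "(max R 1) powr p \<le> real k"
    by (simp add: k_def)
  moreover have "1 \<le> (max R 1) powr p"
    using p by (intro ge_one_powr_ge_zero) auto
  ultimately have k1: "1 \<le> real k"
    by linarith
  show ?thesis
  proof (intro exI ballI impI)
    fix F and x :: "nat \<Rightarrow> 'a" assume F: "F \<in> schreier_sets" "card F = k" and x: "x \<in> c00" "\<forall>n\<in>F. 1 \<le> norm (x n)"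
    have "R \<le> ((max R 1) powr p) powr (1 / p)"
      using p by (simp add: powr_powr)
    also have "\<dots> \<le> (\<Sum>n\<in>F. 1 powr p) powr (1 / p)"
      using p k F by (intro powr_mono2) auto
    also have "\<dots> \<le> (\<Sum>n\<in>F. norm (x n) powr p) powr (1 / p)"
      using p x by (intro powr_mono2 sum_mono) (auto intro!: sum_nonneg)
    also have "\<dots> = family_norm p (singletons F) x"
      by (simp add: family_norm_singletons)
    also have "\<dots> \<le> sup_norm p \<G> x"
      using F k1 by (intro family_norm_le x singletons_mem) auto
    finally show "R \<le> sup_norm p \<G> x" .
  qed
qed

text \<open>
  A family \<open>G\<close> that almost attains the norm of \<open>x\<close> gives a functional: with \<open>s A\<close> denoting the sum of
  the moduli of \<open>x\<close> over \<open>A\<close>, weight the entries in \<open>A\<close> by \<open>s A powr (p - 1)\<close> and turn them so that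
  those of \<open>x\<close> become nonnegative. Its norm is controlled by the Hoelder inequality over \<open>G\<close>.
\<close>

lemma sup_norm_norming:
  fixes x :: "nat \<Rightarrow> 'k::real_normed_field"
  assumes x: "x \<in> c00" "sup_norm p \<G> x = 1" and \<delta>: "0 < \<delta>"
  shows "\<exists>c. (\<forall>n. x n = 0 \<longrightarrow> c n = 0) \<and> (\<Sum>n | x n \<noteq> 0. c n * x n) = 1 \<and>
    (\<forall>z\<in>c00. norm (\<Sum>n | x n \<noteq> 0. c n * z n) \<le> (1 + \<delta>) * sup_norm p \<G> z)"
proof -
  have "1 / (1 + \<delta>) < sup_norm p \<G> x"
    using x \<delta> by simp
  then obtain G where G: "G \<in> \<G>" "1 / (1 + \<delta>) < family_norm p G x"
    by (rule less_sup_norm)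
  define s where "s A = (\<Sum>n\<in>A. norm (x n))" for A
  define S where "S = (\<Sum>A\<in>G. s A powr p)"
  have root: "family_norm p G x = S powr (1 / p)"
    by (simp add: family_norm_def S_def s_def)
  have s: "0 \<le> s A" for A
    by (simp add: s_def sum_nonneg)
  have "0 < S powr (1 / p)"
    using G(2) \<delta> root by (metis add_pos_pos less_trans zero_less_divide_1_iff zero_less_one)
  then have S: "0 < S"
    by (auto simp: S_def sum_nonneg less_le)
  define \<theta> where "\<theta> n = of_real (norm (x n)) / x n" for n
  define c where "c n = (\<Sum>A\<in>{A\<in>G. n \<in> A}. of_real (s A powr (p - 1))) * \<theta> n / of_real S" for n
  have fin: "finite {n. x n \<noteq> 0}" "finite G" "\<And>A. A \<in> G \<Longrightarrow> finite A"
    using x G finite_family finite_member by (auto simp: c00_def)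
  have rewrite: "(\<Sum>n | x n \<noteq> 0. c n * z n)
      = (\<Sum>A\<in>G. of_real (s A powr (p - 1)) * (\<Sum>n\<in>A. \<theta> n * z n)) / of_real S" for z
  proof -
    have "(\<Sum>n | x n \<noteq> 0. c n * z n)
        = (\<Sum>n | x n \<noteq> 0. \<Sum>A\<in>G. if n \<in> A then of_real (s A powr (p - 1)) * (\<theta> n * z n) / of_real S else 0)"
      unfolding c_def using fin(2)
      by (intro sum.cong refl)
        (simp add: sum_distrib_right sum_divide_distrib sum.inter_filter[symmetric] mult.assoc)
    also have "\<dots> = (\<Sum>A\<in>G. \<Sum>n | x n \<noteq> 0. if n \<in> A then of_real (s A powr (p - 1)) * (\<theta> n * z n) / of_real S else 0)"
      by (rule sum.swap)
    also have "\<dots> = (\<Sum>A\<in>G. \<Sum>n\<in>A. of_real (s A powr (p - 1)) * (\<theta> n * z n) / of_real S)"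
    proof (rule sum.cong[OF refl])
      fix A assume A: "A \<in> G"
      have "(\<Sum>n | x n \<noteq> 0. if n \<in> A then of_real (s A powr (p - 1)) * (\<theta> n * z n) / of_real S else 0)
          = (\<Sum>n\<in>{n. x n \<noteq> 0} \<inter> A. of_real (s A powr (p - 1)) * (\<theta> n * z n) / of_real S)"
        using fin(1) by (simp add: sum.inter_restrict)
      also have "\<dots> = (\<Sum>n\<in>A. of_real (s A powr (p - 1)) * (\<theta> n * z n) / of_real S)"
        using fin(3)[OF A] by (intro sum.mono_neutral_left) (auto simp: \<theta>_def)
      finally show "(\<Sum>n | x n \<noteq> 0. if n \<in> A then of_real (s A powr (p - 1)) * (\<theta> n * z n) / of_real S else 0)
          = (\<Sum>n\<in>A. of_real (s A powr (p - 1)) * (\<theta> n * z n) / of_real S)" .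
    qed
    also have "\<dots> = (\<Sum>A\<in>G. of_real (s A powr (p - 1)) * (\<Sum>n\<in>A. \<theta> n * z n)) / of_real S"
      by (simp add: sum_distrib_left sum_divide_distrib)
    finally show ?thesis .
  qed
  have "(\<Sum>n\<in>A. \<theta> n * x n) = of_real (s A)" for A
    by (simp add: s_def \<theta>_def) (intro sum.cong, auto)
  then have "(\<Sum>n | x n \<noteq> 0. c n * x n) = (\<Sum>A\<in>G. of_real (s A powr (p - 1) * s A)) / of_real S"
    by (simp add: rewrite)
  also have "(\<Sum>A\<in>G. of_real (s A powr (p - 1) * s A)) = (of_real S :: 'k)"
  proof -
    have "s A powr (p - 1) * s A = s A powr p" for A
      using s[of A] powr_add[of "s A" "p - 1" 1] by (cases "s A = 0") auto
    then show ?thesis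
      by (simp add: S_def)
  qed
  finally have cx: "(\<Sum>n | x n \<noteq> 0. c n * x n) = 1"
    using S by simp
  have bound: "norm (\<Sum>n | x n \<noteq> 0. c n * z n) \<le> (1 + \<delta>) * sup_norm p \<G> z" if z: "z \<in> c00" for z
  proof -
    have "norm (\<Sum>n\<in>A. \<theta> n * z n) \<le> (\<Sum>n\<in>A. norm (z n))" for A
    proof (rule sum_norm_le)
      show "norm (\<theta> n * z n) \<le> norm (z n)" for n
        by (cases "x n = 0") (auto simp: \<theta>_def norm_mult norm_divide)
    qed
    then have "norm (\<Sum>A\<in>G. of_real (s A powr (p - 1)) * (\<Sum>n\<in>A. \<theta> n * z n))
        \<le> (\<Sum>A\<in>G. s A powr (p - 1) * (\<Sum>n\<in>A. norm (z n)))"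
      by (intro sum_norm_le) (auto simp: norm_mult intro!: mult_left_mono)
    then have "norm (\<Sum>n | x n \<noteq> 0. c n * z n) \<le> (\<Sum>A\<in>G. s A powr (p - 1) * (\<Sum>n\<in>A. norm (z n))) / S"
      using S by (simp add: rewrite norm_divide divide_right_mono)
    also have "\<dots> \<le> family_norm p G z / family_norm p G x"
      unfolding root unfolding family_norm_def S_def
      using S fin(2) p s by (intro Holder_dual_bound) (auto simp: S_def sum_nonneg)
    also have "\<dots> \<le> (1 + \<delta>) * family_norm p G z"
    proof -
      have "1 / family_norm p G x \<le> 1 + \<delta>"
        using G(2) \<delta> less_trans[OF _ G(2), of 0] by (simp add: field_simps less_imp_le)
      then show ?thesis
        using mult_right_mono[OF _ family_norm_nonneg[of p G z], of "1 / family_norm p G x" "1 + \<delta>"] by simp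
    qed
    also have "\<dots> \<le> (1 + \<delta>) * sup_norm p \<G> z"
      using \<delta> family_norm_le[OF z G(1)] by (intro mult_left_mono) auto
    finally show ?thesis .
  qed
  show ?thesis
  proof (intro exI conjI allI impI ballI)
    show "c n = 0" if "x n = 0" for n
      using that by (simp add: c_def \<theta>_def)
  qed (use cx bound in auto)
qed

lemma block_norm_sup_norm:
  assumes "joining \<phi>"
    and lower: "\<And>m y z. y \<in> c00 \<Longrightarrow> z \<in> c00 \<Longrightarrow> (\<And>n. y n \<noteq> 0 \<Longrightarrow> n \<le> m) \<Longrightarrow> (\<And>n. z n \<noteq> 0 \<Longrightarrow> m < n)
      \<Longrightarrow> \<phi> (sup_norm p \<G> y) (sup_norm p \<G> z) \<le> sup_norm p \<G> (y + z :: nat \<Rightarrow> 'k::{real_normed_field,banach})"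
    and upper: "\<And>m y z s. y \<in> c00 \<Longrightarrow> z \<in> c00 \<Longrightarrow> (\<And>n. y n \<noteq> 0 \<Longrightarrow> n \<le> m) \<Longrightarrow> (\<And>n. z n \<noteq> 0 \<Longrightarrow> m < n)
      \<Longrightarrow> (\<And>n. norm (z n) \<le> s)
      \<Longrightarrow> sup_norm p \<G> (y + z :: nat \<Rightarrow> 'k) \<le> \<phi> (sup_norm p \<G> y) (sup_norm p \<G> z) + real m * s"
  shows "block_norm \<phi> (sup_norm p \<G> :: (nat \<Rightarrow> 'k) \<Rightarrow> real)"
proof (intro block_norm.intro block_norm_axioms.intro)
  show "sup_norm p \<G> (keep A z) \<le> sup_norm p \<G> z" if "z \<in> c00" for A and z :: "nat \<Rightarrow> 'k"
    using that by (intro sup_norm_mono) (auto simp: keep_def)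
qed (fact assms(1) sup_norm_coord sup_norm_growth lower upper sup_norm_norming)+

end


section \<open>The Schreier norm\<close>

lemma schreier_subset:
  assumes A: "A \<in> schreier_sets" and B: "B \<subseteq> A" "B \<noteq> {}"
  shows "B \<in> schreier_sets"
proof -
  have A': "finite A" "0 \<notin> A" "A \<noteq> {}" "card A \<le> Min A"
    using A B by (auto simp: schreier_sets_def)
  have fin: "finite B"
    using A' B finite_subset by blast
  have "card B \<le> card A"
    using A' B by (intro card_mono) auto
  also have "\<dots> \<le> Min A"
    by (fact A')
  also have "\<dots> \<le> Min B"
    using A' B fin by (intro Min_antimono) auto
  finally show ?thesis
    using A' B fin by (auto simp: schreier_sets_def)
qed

lemma schreier_finite: "A \<in> schreier_sets \<Longrightarrow> finite A"
  by (simp add: schreier_sets_def)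

lemma schreier_card_le:
  assumes "A \<in> schreier_sets" "a \<in> A"
  shows "card A \<le> a"
proof -
  have "card A \<le> Min A"
    using assms by (auto simp: schreier_sets_def)
  also have "\<dots> \<le> a"
    using assms schreier_finite by (intro Min_le)
  finally show ?thesis .
qed

definition schreier_families :: "nat set set set" where
  "schreier_families = singletons ` (schreier_sets - {{}})"

lemma schreier_norm_eq: "schreier_norm p x = sup_norm p schreier_families x"
proof -
  have "{(\<Sum>n\<in>F. norm (x n) powr p) powr (1 / p) |F. F \<in> schreier_sets - {{}}}
      = {family_norm p G x |G. G \<in> schreier_families}"
    unfolding schreier_families_def family_norm_singletons[symmetric] by blast
  then show ?thesis
    by (simp add: schreier_norm_def sup_norm_def)
qed

lemma family_system_schreier:
  assumes "1 \<le> p"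
  shows "family_system p schreier_families"
  using assms
  by unfold_locales (auto simp: schreier_families_def singletons_def schreier_finite)

lemma joining_max: "joining max"
proof
  fix c s t :: real assume c: "0 \<le> c"
  show "max (c * s) (c * t) = c * max s t"
  proof (cases "s \<le> t")
    case True
    then show ?thesis
      using mult_left_mono[OF True c] by (simp add: max.absorb2)
  next
    case False
    then show ?thesis
      using mult_left_mono[of t s c] c by (simp add: max.absorb1)
  qed
qed auto

text \<open>
  For the upper estimate, a Schreier set \<open>F\<close> that meets \<open>[1, m]\<close> has at most \<open>m\<close> elements, so \<open>z\<close>
  contributes at most \<open>m * s\<close>; any other Schreier set sees \<open>z\<close> only.
\<close>

lemma block_norm_schreier:
  assumes p: "1 \<le> p"
  shows "block_norm max (schreier_norm p :: (nat \<Rightarrow> 'k::{real_normed_field,banach}) \<Rightarrow> real)"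
proof -
  interpret family_system p schreier_families
    by (rule family_system_schreier[OF p])
  have eq: "schreier_norm p = (sup_norm p schreier_families :: (nat \<Rightarrow> 'k) \<Rightarrow> real)"
    using schreier_norm_eq by blast
  show ?thesis
    unfolding eq
  proof (rule block_norm_sup_norm[OF joining_max])
    fix m and y z :: "nat \<Rightarrow> 'k"
    assume yz: "y \<in> c00" "z \<in> c00" and supp: "\<And>n. y n \<noteq> 0 \<Longrightarrow> n \<le> m" "\<And>n. z n \<noteq> 0 \<Longrightarrow> m < n"
    have disj: "y n = 0 \<or> z n = 0" for n
      using supp[of n] by fastforce
    have "norm (y n) \<le> norm ((y + z) n)" "norm (z n) \<le> norm ((y + z) n)" for n
      using disj[of n] by auto
    then show "max (sup_norm p schreier_families y) (sup_norm p schreier_families z)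
        \<le> sup_norm p schreier_families (y + z)"
      using yz by (intro max.boundedI sup_norm_mono c00_add)
    fix s assume s: "\<And>n. norm (z n) \<le> s"
    have s0: "0 \<le> s"
      using s[of 0] norm_ge_zero order_trans by blast
    show "sup_norm p schreier_families (y + z)
        \<le> max (sup_norm p schreier_families y) (sup_norm p schreier_families z) + real m * s"
    proof (rule sup_norm_le)
      fix G assume G: "G \<in> schreier_families"
      then obtain F where F: "F \<in> schreier_sets" "F \<noteq> {}" "G = singletons F"
        by (auto simp: schreier_families_def)
      have fin: "finite F"
        using F schreier_finite by blast
      show "family_norm p G (y + z)
          \<le> max (sup_norm p schreier_families y) (sup_norm p schreier_families z) + real m * s"
      proof (cases "\<exists>a\<in>F. a \<le> m")
        case False
        then have "y n = 0" if "n \<in> F" for n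
          using supp(1)[of n] that by fastforce
        then have "family_norm p G (y + z) = family_norm p G z"
          by (simp add: F family_norm_singletons)
        also have "\<dots> \<le> sup_norm p schreier_families z"
          by (rule family_norm_le[OF yz(2) G])
        finally show ?thesis
          using s0 by (simp add: le_max_iff_disj add_increasing2)
      next
        case True
        then have card: "card F \<le> m"
          using schreier_card_le[OF F(1)] order_trans by blast
        have "(\<Sum>n\<in>F. norm ((y + z) n) powr p) = (\<Sum>n\<in>F. norm (y n) powr p) + (\<Sum>n\<in>F. norm (z n) powr p)"
          unfolding sum.distrib[symmetric] using disj by (intro sum.cong refl) (metis add.left_neutral add.right_neutral norm_zero plus_fun_apply powr_0)
        also have "(\<Sum>n\<in>F. norm (z n) powr p) = (0 + (\<Sum>n\<in>F. norm (z n) powr p) powr (1 / p)) powr p"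
          using p by (simp add: powr_powr sum_nonneg)
        finally have "family_norm p G (y + z)
            = ((\<Sum>n\<in>F. norm (y n) powr p) + (0 + (\<Sum>n\<in>F. norm (z n) powr p) powr (1 / p)) powr p) powr (1 / p)"
          by (simp add: F family_norm_singletons)
        also have "\<dots> \<le> ((\<Sum>n\<in>F. norm (y n) powr p) + 0 powr p) powr (1 / p) + (\<Sum>n\<in>F. norm (z n) powr p) powr (1 / p)"
          by (intro powr_root_add_le[OF p] sum_nonneg) auto
        also have "((\<Sum>n\<in>F. norm (y n) powr p) + 0 powr p) powr (1 / p) = family_norm p G y"
          by (simp add: F family_norm_singletons)
        also have "family_norm p G y \<le> sup_norm p schreier_families y"
          by (rule family_norm_le[OF yz(1) G])
        also have "(\<Sum>n\<in>F. norm (z n) powr p) powr (1 / p) \<le> (\<Sum>n\<in>F. norm (z n))"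
          using fin by (intro p_norm_le_sum p) auto
        also have "\<dots> \<le> real (card F) * s"
          using sum_bounded_above[of F "\<lambda>n. norm (z n)" s] s by simp
        also have "\<dots> \<le> real m * s"
          using card s0 by (intro mult_right_mono) auto
        finally have "family_norm p G (y + z) \<le> sup_norm p schreier_families y + real m * s"
          by (simp del: plus_fun_apply)
        then show ?thesis
          by (rule order_trans) simp
      qed
    qed
  qed
qed


section \<open>The Baernstein norm\<close>

text \<open>
  Sets of pairwise comparable Schreier sets stand for the finite successive sequences in the
  definition of the norm: unions and restrictions are easier to form without an enumeration. The
  enumeration by increasing maximum is recovered in \<open>successive_enumeration\<close>.
\<close>

definition baernstein_families :: "nat set set set" where
  "baernstein_families = {G. finite G \<and> G \<noteq> {} \<and> G \<subseteq> schreier_sets - {{}} \<and>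
     (\<forall>A\<in>G. \<forall>B\<in>G. A \<noteq> B \<longrightarrow> (\<forall>a\<in>A. \<forall>b\<in>B. a < b) \<or> (\<forall>a\<in>A. \<forall>b\<in>B. b < a))}"

lemma successive_enumeration:
  fixes G :: "nat set set"
  assumes "finite G" "G \<noteq> {}" "\<And>A. A \<in> G \<Longrightarrow> finite A \<and> A \<noteq> {}"
    "\<And>A B. A \<in> G \<Longrightarrow> B \<in> G \<Longrightarrow> A \<noteq> B \<Longrightarrow> (\<forall>a\<in>A. \<forall>b\<in>B. a < b) \<or> (\<forall>a\<in>A. \<forall>b\<in>B. b < a)"
  shows "\<exists>(m::nat) F. 1 \<le> m \<and> bij_betw F {1..m} G \<and> (\<forall>j\<in>{1..<m}. Max (F j) < Min (F (j + 1)))"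
  using assms
proof (induction "card G" arbitrary: G)
  case 0
  then show ?case
    by simp
next
  case (Suc k)
  obtain A where A: "A \<in> G" "\<And>B. B \<in> G \<Longrightarrow> Max B \<le> Max A"
    using Suc.prems(1,2) obtains_MAX[of G Max] by (metis Max_ge finite_imageI imageI)
  have before: "Max B < Min A" if "B \<in> G - {A}" for B
  proof -
    have fin: "finite A" "A \<noteq> {}" "finite B" "B \<noteq> {}"
      using Suc.prems(3) A(1) that by auto
    have "\<not> Max A < Max B"
      using A(2) that by (simp add: not_less)
    then have "\<not> (\<forall>a\<in>A. \<forall>b\<in>B. a < b)"
      using fin Max_in[of A] Max_in[of B] by blast
    then have "\<forall>a\<in>A. \<forall>b\<in>B. b < a"
      using Suc.prems(4)[of A B] A(1) that by auto
    then show ?thesis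
      using fin by simp
  qed
  show ?case
  proof (cases "G - {A} = {}")
    case True
    then have "G = {A}"
      using A(1) by auto
    then have "bij_betw (\<lambda>_. A) {1..1::nat} G"
      by (simp add: bij_betw_def)
    then show ?thesis
      by (intro exI[of _ "1::nat"] exI[of _ "\<lambda>_. A"]) auto
  next
    case False
    have "k = card (G - {A})"
      using Suc.hyps(2) Suc.prems(1) A(1) by (simp add: card_Diff_singleton)
    then have "\<exists>(m::nat) F. 1 \<le> m \<and> bij_betw F {1..m} (G - {A}) \<and> (\<forall>j\<in>{1..<m}. Max (F j) < Min (F (j + 1)))"
      using Suc.prems(1,3,4) False by (intro Suc.hyps(1)) auto
    then obtain m :: nat and F where F: "1 \<le> m" "bij_betw F {1..m} (G - {A})"
      "\<And>j. j \<in> {1..<m} \<Longrightarrow> Max (F j) < Min (F (j + 1))"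
      by blast
    define F' where "F' = F(Suc m := A)"
    have "bij_betw F' {1..m} (G - {A})"
      using F(2) by (rule bij_betw_cong[THEN iffD1, rotated]) (auto simp: F'_def)
    then have "bij_betw F' ({1..m} \<union> {Suc m}) (G - {A} \<union> {F' (Suc m)})"
      by (intro notIn_Un_bij_betw) (auto simp: F'_def)
    moreover have "{1..m} \<union> {Suc m} = {1..Suc m}" "G - {A} \<union> {F' (Suc m)} = G"
      using A(1) by (auto simp: F'_def)
    ultimately have "bij_betw F' {1..Suc m} G"
      by simp
    moreover have "Max (F' j) < Min (F' (j + 1))" if "j \<in> {1..<Suc m}" for j
    proof (cases "j = m")
      case True
      then have "F j \<in> G - {A}"
        using F(1,2) by (auto simp: bij_betw_def)
      then show ?thesis
        using before True by (simp add: F'_def)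
    qed (use F(3) that in \<open>auto simp: F'_def\<close>)
    ultimately show ?thesis
      by (intro exI[of _ "Suc m"] exI[of _ F']) auto
  qed
qed

lemma baernstein_norm_eq: "baernstein_norm p x = sup_norm p baernstein_families x"
proof -
  have "{(\<Sum>j=1..m. (\<Sum>n\<in>F j. norm (x n)) powr p) powr (1 / p) | (m::nat) (F::nat \<Rightarrow> nat set).
            1 \<le> m \<and> (\<forall>j\<in>{1..m}. F j \<in> schreier_sets - {{}}) \<and>
            (\<forall>j\<in>{1..<m}. Max (F j) < Min (F (j + 1)))}
      = {family_norm p G x |G. G \<in> baernstein_families}" (is "?L = ?R")
  proof (intro equalityI subsetI)
    fix r assume "r \<in> ?L"
    then obtain m and F :: "nat \<Rightarrow> nat set" where F: "1 \<le> m"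
      "\<And>j. j \<in> {1..m} \<Longrightarrow> F j \<in> schreier_sets - {{}}"
      "\<And>j. j \<in> {1..<m} \<Longrightarrow> Max (F j) < Min (F (j + 1))"
      and r: "r = (\<Sum>j=1..m. (\<Sum>n\<in>F j. norm (x n)) powr p) powr (1 / p)"
      by blast
    have fin: "finite (F j)" "F j \<noteq> {}" if "j \<in> {1..m}" for j
      using F(2)[OF that] schreier_finite by auto
    have Max_less: "Max (F i) < Min (F j)" if "i \<in> {1..m}" "j \<in> {1..m}" "i < j" for i j
      using that
    proof (induction j)
      case (Suc j)
      show ?case
      proof (cases "i = j")
        case True
        then show ?thesis
          using F(3)[of j] Suc.prems by simp
      next
        case False
        then have "Max (F i) < Min (F j)"
          using Suc by simp
        also have "\<dots> \<le> Max (F j)"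
          using fin[of j] Suc.prems False by simp
        also have "\<dots> < Min (F (Suc j))"
          using F(3)[of j] Suc.prems False by simp
        finally show ?thesis .
      qed
    qed simp
    have less: "a < b" if "i \<in> {1..m}" "j \<in> {1..m}" "i < j" "a \<in> F i" "b \<in> F j" for i j a b
      using Max_less[OF that(1-3)] Max_ge[OF fin(1)[OF that(1)] that(4)]
        Min_le[OF fin(1)[OF that(2)] that(5)] by linarith
    have inj: "inj_on F {1..m}"
    proof (rule inj_onI, rule ccontr)
      fix i j assume ij: "i \<in> {1..m}" "j \<in> {1..m}" "F i = F j" "i \<noteq> j"
      obtain a where "a \<in> F i"
        using fin(2)[OF ij(1)] by blast
      then show False
        using less[of i j a a] less[of j i a a] ij by (cases i j rule: linorder_cases) auto
    qed
    have "F ` {1..m} \<in> baernstein_families"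
      unfolding baernstein_families_def
    proof (intro CollectI conjI ballI impI)
      show "F ` {1..m} \<subseteq> schreier_sets - {{}}"
        using F(2) by blast
      fix A B assume AB: "A \<in> F ` {1..m}" "B \<in> F ` {1..m}" "A \<noteq> B"
      then obtain i j where ij: "i \<in> {1..m}" "j \<in> {1..m}" "A = F i" "B = F j"
        by blast
      then have "i < j \<or> j < i"
        using AB(3) by (cases i j rule: linorder_cases) auto
      then show "(\<forall>a\<in>A. \<forall>b\<in>B. a < b) \<or> (\<forall>a\<in>A. \<forall>b\<in>B. b < a)"
        using less ij by blast
    qed (use F(1) in auto)
    moreover have "r = family_norm p (F ` {1..m}) x"
      unfolding r family_norm_def sum.reindex[OF inj] comp_def by (rule refl)
    ultimately show "r \<in> ?R"
      by blast
  next
    fix r assume "r \<in> ?R"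
    then obtain G where G: "G \<in> baernstein_families" "r = family_norm p G x"
      by blast
    then have "\<exists>(m::nat) F. 1 \<le> m \<and> bij_betw F {1..m} G \<and> (\<forall>j\<in>{1..<m}. Max (F j) < Min (F (j + 1)))"
      by (intro successive_enumeration) (auto simp: baernstein_families_def schreier_finite)
    then obtain m :: nat and F where F: "1 \<le> m" "bij_betw F {1..m} G" "\<forall>j\<in>{1..<m}. Max (F j) < Min (F (j + 1))"
      by blast
    have "r = (\<Sum>j=1..m. (\<Sum>n\<in>F j. norm (x n)) powr p) powr (1 / p)"
      unfolding G(2) family_norm_def 
      using sum.reindex_bij_betw[OF F(2), of "\<lambda>A. (\<Sum>n\<in>A. norm (x n)) powr p"] by simp
    moreover have "\<forall>j\<in>{1..m}. F j \<in> schreier_sets - {{}}"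
      using G(1) F(2) by (auto simp: baernstein_families_def bij_betw_def)
    ultimately show "r \<in> ?L"
      using F(1,3) by blast
  qed
  then show ?thesis
    by (simp only: baernstein_norm_def sup_norm_def)
qed

lemma family_system_baernstein:
  assumes "1 \<le> p"
  shows "family_system p baernstein_families"
proof
  fix G A B assume G: "G \<in> baernstein_families" "A \<in> G" "B \<in> G" "A \<noteq> B"
  then have "(\<forall>a\<in>A. \<forall>b\<in>B. a < b) \<or> (\<forall>a\<in>A. \<forall>b\<in>B. b < a)"
    by (simp add: baernstein_families_def)
  then show "A \<inter> B = {}"
    by (metis disjoint_iff less_irrefl)
next
  fix F assume F: "F \<in> schreier_sets" "F \<noteq> {}"
  have "{n} \<in> schreier_sets" if "n \<in> F" for n
    using schreier_subset[OF F(1), of "{n}"] that by simp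
  then show "singletons F \<in> baernstein_families"
    using F schreier_finite by (auto simp: baernstein_families_def singletons_def)
next
  fix G A assume G: "G \<in> baernstein_families"
  then show "finite G"
    by (simp add: baernstein_families_def)
  assume "A \<in> G"
  then show "finite A"
    using G schreier_finite by (auto simp: baernstein_families_def)
qed (fact assms)

text \<open>
  Cutting the members of a family down to sets \<open>A \<inter> I\<close> and dropping the empty ones does not change
  the contribution of a vector that vanishes off \<open>I\<close>.
\<close>

lemma baernstein_sum_cut:
  assumes G: "G \<in> baernstein_families" and vanish: "\<And>n. n \<notin> I \<Longrightarrow> x n = 0"
  shows "(\<Sum>A\<in>(\<lambda>A. A \<inter> I) ` G - {{}}. (\<Sum>n\<in>A. norm (x n)) powr p) = (\<Sum>A\<in>G. (\<Sum>n\<in>A. norm (x n)) powr p)"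
proof -
  interpret family_system 1 baernstein_families
    by (rule family_system_baernstein) simp
  let ?s = "\<lambda>A. (\<Sum>n\<in>A. norm (x n)) powr p"
  have "(\<Sum>A\<in>(\<lambda>A. A \<inter> I) ` G - {{}}. ?s A) = (\<Sum>A\<in>(\<lambda>A. A \<inter> I) ` G. ?s A)"
    using finite_family[OF G] by (intro sum.mono_neutral_left) auto
  also have "\<dots> = (\<Sum>A\<in>G. ?s (A \<inter> I))"
  proof (rule sum.reindex_nontrivial[unfolded comp_def, OF finite_family[OF G]])
    fix A B assume AB: "A \<in> G" "B \<in> G" "A \<noteq> B" "A \<inter> I = B \<inter> I"
    then have "A \<inter> I = {}"
      using disjoint[OF G AB(1-3)] by blast
    then show "?s (A \<inter> I) = 0"
      by simp
  qed
  also have "\<dots> = (\<Sum>A\<in>G. ?s A)"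
  proof (rule sum.cong[OF refl])
    fix A assume A: "A \<in> G"
    have "(\<Sum>n\<in>A \<inter> I. norm (x n)) = (\<Sum>n\<in>A. norm (x n))"
      using finite_member[OF G A] vanish by (intro sum.mono_neutral_left) auto
    then show "?s (A \<inter> I) = ?s A"
      by simp
  qed
  finally show ?thesis .
qed

text \<open>
  The class of admissible families is closed under putting a family cut down to \<open>[1, m]\<close> in front of
  another one cut down to \<open>(m, \<infinity>)\<close>, because subsets of Schreier sets are Schreier sets.
\<close>

lemma baernstein_cut_union:
  assumes G: "G \<in> baernstein_families" "G' \<in> baernstein_families"
    and H: "H = ((\<lambda>A. A \<inter> {..m}) ` G - {{}}) \<union> ((\<lambda>A. A \<inter> {m<..}) ` G' - {{}})" "H \<noteq> {}"
  shows "H \<in> baernstein_families"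
  unfolding baernstein_families_def
proof (intro CollectI conjI ballI impI)
  show "finite H"
    using G by (simp add: H baernstein_families_def)
  show "H \<subseteq> schreier_sets - {{}}"
  proof
    fix A assume "A \<in> H"
    then obtain A' I where A': "A' \<in> G \<union> G'" "A = A' \<inter> I" "A \<noteq> {}"
      unfolding H(1) by blast
    moreover from A'(1) have "A' \<in> schreier_sets"
      using G by (auto simp: baernstein_families_def)
    ultimately show "A \<in> schreier_sets - {{}}"
      using schreier_subset[of A' A] by simp
  qed
  fix A B assume AB: "A \<in> H" "B \<in> H" "A \<noteq> B"
  have ord: "(\<forall>a\<in>A. \<forall>b\<in>B. a < b) \<or> (\<forall>a\<in>A. \<forall>b\<in>B. b < a)"
    if fam: "K \<in> baernstein_families" "A \<in> (\<lambda>A. A \<inter> I) ` K" "B \<in> (\<lambda>A. A \<inter> I) ` K" "A \<noteq> B" for K I A B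
  proof -
    obtain A' B' where AB': "A' \<in> K" "B' \<in> K" "A = A' \<inter> I" "B = B' \<inter> I"
      using fam(2,3) by blast
    then have "A' \<noteq> B'"
      using fam(4) by blast
    then have "(\<forall>a\<in>A'. \<forall>b\<in>B'. a < b) \<or> (\<forall>a\<in>A'. \<forall>b\<in>B'. b < a)"
      using fam(1) AB'(1,2) by (auto simp: baernstein_families_def)
    then show ?thesis
      unfolding AB'(3,4) by blast
  qed
  have across: "\<forall>a\<in>A. \<forall>b\<in>B. a < b" if "A \<in> (\<lambda>A. A \<inter> {..m}) ` G" "B \<in> (\<lambda>A. A \<inter> {m<..}) ` G'" for A B
    using that by fastforce
  consider "A \<in> (\<lambda>A. A \<inter> {..m}) ` G" "B \<in> (\<lambda>A. A \<inter> {..m}) ` G"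
    | "A \<in> (\<lambda>A. A \<inter> {m<..}) ` G'" "B \<in> (\<lambda>A. A \<inter> {m<..}) ` G'"
    | "A \<in> (\<lambda>A. A \<inter> {..m}) ` G" "B \<in> (\<lambda>A. A \<inter> {m<..}) ` G'"
    | "B \<in> (\<lambda>A. A \<inter> {..m}) ` G" "A \<in> (\<lambda>A. A \<inter> {m<..}) ` G'"
    using AB(1,2) unfolding H(1) by blast
  then show "(\<forall>a\<in>A. \<forall>b\<in>B. a < b) \<or> (\<forall>a\<in>A. \<forall>b\<in>B. b < a)"
  proof cases
    case 1
    then show ?thesis
      using ord[OF G(1) _ _ AB(3)] by blast
  next
    case 2
    then show ?thesis
      using ord[OF G(2) _ _ AB(3)] by blast
  next
    case 3
    then show ?thesis
      using across by blast
  next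
    case 4
    then have "\<forall>b\<in>B. \<forall>a\<in>A. b < a"
      by (rule across)
    then show ?thesis
      by blast
  qed
qed (fact H(2))


text \<open>
  Families that almost attain the norms of \<open>y\<close> and \<open>z\<close> are cut down to \<open>[1, m]\<close> and to \<open>(m, \<infinity>)\<close>; their
  union is admissible for \<open>y + z\<close>.
\<close>

lemma sup_norm_baernstein_lower:
  fixes y z :: "nat \<Rightarrow> 'k::real_normed_field"
  assumes p: "1 \<le> p" and yz: "y \<in> c00" "z \<in> c00"
    and supp: "\<And>n. y n \<noteq> 0 \<Longrightarrow> n \<le> m" "\<And>n. z n \<noteq> 0 \<Longrightarrow> m < n"
  shows "(sup_norm p baernstein_families y powr p + sup_norm p baernstein_families z powr p) powr (1 / p)
    \<le> sup_norm p baernstein_families (y + z)"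
proof -
  interpret family_system p baernstein_families
    by (rule family_system_baernstein[OF p])
  interpret joining "\<lambda>s t. (s powr p + t powr p) powr (1 / p)"
    by (rule joining_p[OF p])
  let ?N = "\<lambda>x. sup_norm p baernstein_families (x :: nat \<Rightarrow> 'k)"
  let ?s = "\<lambda>x A. (\<Sum>n\<in>A. norm (x n :: 'k)) powr p"
  have sum: "(family_norm p G y powr p + family_norm p G' z powr p) powr (1 / p) \<le> ?N (y + z)"
    if G: "G \<in> baernstein_families" "G' \<in> baernstein_families" for G G'
  proof -
    define H1 where "H1 = (\<lambda>A. A \<inter> {..m}) ` G - {{}}"
    define H2 where "H2 = (\<lambda>A. A \<inter> {m<..}) ` G' - {{}}"
    have fin: "finite H1" "finite H2"
      using G finite_family by (auto simp: H1_def H2_def)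
    have low: "A \<subseteq> {..m}" "A \<noteq> {}" if "A \<in> H1" for A
      using that by (auto simp: H1_def)
    have high: "A \<subseteq> {m<..}" if "A \<in> H2" for A
      using that by (auto simp: H2_def)
    have disj: "H1 \<inter> H2 = {}"
    proof (rule equals0I)
      fix A assume "A \<in> H1 \<inter> H2"
      then have "A \<subseteq> {..m} \<inter> {m<..}" "A \<noteq> {}"
        using low[of A] high[of A] by auto
      then show False
        by fastforce
    qed
    have "family_norm p G y powr p = (\<Sum>A\<in>H1. ?s y A)"
      unfolding family_norm_powr[OF p] H1_def
      by (rule baernstein_sum_cut[OF G(1), symmetric]) (use supp(1) in force)
    also have "\<dots> = (\<Sum>A\<in>H1. ?s (y + z) A)"
    proof (intro sum.cong refl arg_cong[where f = "\<lambda>r. r powr p"])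
      fix A n assume "A \<in> H1" "n \<in> A"
      then have "z n = 0"
        using low[of A] supp(2)[of n] by fastforce
      then show "norm (y n) = norm ((y + z) n)"
        by simp
    qed
    finally have 1: "family_norm p G y powr p = (\<Sum>A\<in>H1. ?s (y + z) A)" .
    have "family_norm p G' z powr p = (\<Sum>A\<in>H2. ?s z A)"
      unfolding family_norm_powr[OF p] H2_def
      by (rule baernstein_sum_cut[OF G(2), symmetric]) (use supp(2) in force)
    also have "\<dots> = (\<Sum>A\<in>H2. ?s (y + z) A)"
    proof (intro sum.cong refl arg_cong[where f = "\<lambda>r. r powr p"])
      fix A n assume "A \<in> H2" "n \<in> A"
      then have "y n = 0"
        using high[of A] supp(1)[of n] by fastforce
      then show "norm (z n) = norm ((y + z) n)"
        by simp
    qed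
    finally have 2: "family_norm p G' z powr p = (\<Sum>A\<in>H2. ?s (y + z) A)" .
    have "(family_norm p G y powr p + family_norm p G' z powr p) powr (1 / p) = family_norm p (H1 \<union> H2) (y + z)"
      by (simp only: 1 2 family_norm_def[of p "H1 \<union> H2"] sum.union_disjoint[OF fin disj])
    also have "\<dots> \<le> ?N (y + z)"
    proof (cases "H1 \<union> H2 = {}")
      case True
      then show ?thesis
        using sup_norm_nonneg[OF c00_add[OF yz]] by (simp add: family_norm_def del: plus_fun_apply)
    next
      case False
      then have "H1 \<union> H2 \<in> baernstein_families"
        using baernstein_cut_union[OF G, of "H1 \<union> H2" m] by (simp add: H1_def H2_def)
      then show ?thesis
        by (rule family_norm_le[OF c00_add[OF yz]])
    qed
    finally show ?thesis .
  qed
  show ?thesis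
  proof (rule field_le_epsilon)
    fix \<epsilon> :: real assume \<epsilon>: "0 < \<epsilon>"
    obtain G where G: "G \<in> baernstein_families" "?N y - \<epsilon> / 2 < family_norm p G y"
      using less_sup_norm[of "?N y - \<epsilon> / 2" y] \<epsilon> by auto
    obtain G' where G': "G' \<in> baernstein_families" "?N z - \<epsilon> / 2 < family_norm p G' z"
      using less_sup_norm[of "?N z - \<epsilon> / 2" z] \<epsilon> by auto
    have "(?N y powr p + ?N z powr p) powr (1 / p)
        \<le> ((family_norm p G y + \<epsilon> / 2) powr p + (family_norm p G' z + \<epsilon> / 2) powr p) powr (1 / p)"
      using G(2) G'(2) sup_norm_nonneg yz by (intro \<phi>_mono) auto
    also have "\<dots> \<le> (family_norm p G y powr p + family_norm p G' z powr p) powr (1 / p) + \<epsilon> / 2 + \<epsilon> / 2"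
      using \<epsilon> family_norm_nonneg by (intro \<phi>_add) auto
    also have "\<dots> \<le> ?N (y + z) + \<epsilon>"
      using sum[OF G(1) G'(1)] by simp
    finally show "(?N y powr p + ?N z powr p) powr (1 / p) \<le> ?N (y + z) + \<epsilon>" .
  qed
qed

text \<open>
  At most one member of a family meets both \<open>[1, m]\<close> and \<open>(m, \<infinity>)\<close>. Its minimum is at most \<open>m\<close>, so it has
  at most \<open>m\<close> elements, and replacing \<open>y + z\<close> by \<open>y\<close> on it costs at most \<open>m * s\<close>.
\<close>

lemma sup_norm_baernstein_upper:
  fixes y z :: "nat \<Rightarrow> 'k::real_normed_field"
  assumes p: "1 \<le> p" and yz: "y \<in> c00" "z \<in> c00"
    and supp: "\<And>n. y n \<noteq> 0 \<Longrightarrow> n \<le> m" "\<And>n. z n \<noteq> 0 \<Longrightarrow> m < n" and s: "\<And>n. norm (z n) \<le> s"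
  shows "sup_norm p baernstein_families (y + z)
    \<le> (sup_norm p baernstein_families y powr p + sup_norm p baernstein_families z powr p) powr (1 / p) + real m * s"
proof -
  interpret family_system p baernstein_families
    by (rule family_system_baernstein[OF p])
  let ?N = "\<lambda>x. sup_norm p baernstein_families (x :: nat \<Rightarrow> 'k)"
  let ?t = "\<lambda>x A. \<Sum>n\<in>A. norm (x n :: 'k)"
  have s0: "0 \<le> s"
    using order_trans[OF norm_ge_zero s] .
  show ?thesis
  proof (rule sup_norm_le)
    fix G assume G: "G \<in> baernstein_families"
    define G1 where "G1 = {A\<in>G. A \<inter> {..m} \<noteq> {}}"
    define G2 where "G2 = G - G1"
    have fin: "finite G" "finite G1" "finite G2"
      using finite_family[OF G] by (auto simp: G1_def G2_def)
    have split_G: "G = G1 \<union> G2" "G1 \<inter> G2 = {}"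
      by (auto simp: G1_def G2_def)
    have high: "?t (y + z) A = ?t z A" if "A \<in> G2" for A
    proof (rule sum.cong[OF refl])
      fix n assume "n \<in> A"
      then have "\<not> n \<le> m"
        using that by (auto simp: G1_def G2_def)
      then show "norm ((y + z) n) = norm (z n)"
        using supp(1)[of n] by (cases "y n = 0") auto
    qed
    have low: "?t (y + z) A = ?t y A" if "A \<subseteq> {..m}" for A
    proof (rule sum.cong[OF refl])
      fix n assume "n \<in> A"
      then have "\<not> m < n"
        using that by auto
      then show "norm ((y + z) n) = norm (y n)"
        using supp(2)[of n] by (cases "z n = 0") auto
    qed
    have straddling: "?t (y + z) A \<le> ?t y A + real m * s" if A: "A \<in> G1" for A
    proof -
      obtain a where a: "a \<in> A" "a \<le> m" "A \<in> G"
        using A by (auto simp: G1_def)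
      have "A \<in> schreier_sets"
        using G a(3) by (auto simp: baernstein_families_def)
      then have card: "card A \<le> m"
        using schreier_card_le[of A a] a by simp
      have "?t (y + z) A \<le> ?t y A + ?t z A"
        unfolding sum.distrib[symmetric] by (intro sum_mono) (simp add: norm_triangle_ineq)
      also have "?t z A \<le> real (card A) * s"
        using sum_bounded_above[of A "\<lambda>n. norm (z n)" s] s by simp
      also have "\<dots> \<le> real m * s"
        using card s0 by (intro mult_right_mono) auto
      finally show ?thesis
        by (simp del: plus_fun_apply)
    qed
    have unique: "B \<subseteq> {..m}" if AB: "A \<in> G1" "B \<in> G1" "B \<noteq> A" "\<not> A \<subseteq> {..m}" for A B
    proof -
      obtain a where a: "a \<in> A" "m < a"
        using AB(4) by fastforce
      obtain b where b: "b \<in> B" "b \<le> m"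
        using AB(2) by (auto simp: G1_def)
      have "(\<forall>b\<in>B. \<forall>a\<in>A. b < a) \<or> (\<forall>b\<in>B. \<forall>a\<in>A. a < b)"
        using G AB by (auto simp: baernstein_families_def G1_def)
      then have less: "\<forall>b\<in>B. \<forall>a\<in>A. b < a"
        using a b by fastforce
      obtain a' where a': "a' \<in> A" "a' \<le> m"
        using AB(1) by (auto simp: G1_def)
      show ?thesis
        using less a' by fastforce
    qed
    have sum_G1: "((\<Sum>A\<in>G1. ?t (y + z) A powr p) + R) powr (1 / p)
        \<le> ((\<Sum>A\<in>G1. ?t y A powr p) + R) powr (1 / p) + real m * s" if R: "0 \<le> R" for R
    proof (cases "\<exists>A\<in>G1. \<not> A \<subseteq> {..m}")
      case False
      then have "(\<Sum>A\<in>G1. ?t (y + z) A powr p) = (\<Sum>A\<in>G1. ?t y A powr p)"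
        using low by (intro sum.cong refl) metis
      then show ?thesis
        using s0 by simp
    next
      case True
      then obtain A where A: "A \<in> G1" "\<not> A \<subseteq> {..m}"
        by blast
      let ?Q = "R + (\<Sum>B\<in>G1 - {A}. ?t y B powr p)"
      have rest: "(\<Sum>B\<in>G1 - {A}. ?t (y + z) B powr p) = (\<Sum>B\<in>G1 - {A}. ?t y B powr p)"
        using low unique[OF A(1) _ _ A(2)] by (intro sum.cong refl) (metis DiffD1 DiffD2 singletonI)
      have "((\<Sum>B\<in>G1. ?t (y + z) B powr p) + R) powr (1 / p) = (?Q + ?t (y + z) A powr p) powr (1 / p)"
        unfolding sum.remove[OF fin(2) A(1)] rest by (simp add: algebra_simps del: plus_fun_apply)
      also have "\<dots> \<le> (?Q + (?t y A + real m * s) powr p) powr (1 / p)"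
        using straddling[OF A(1)] p R by (intro powr_mono2 add_left_mono add_nonneg_nonneg sum_nonneg) auto
      also have "\<dots> \<le> (?Q + ?t y A powr p) powr (1 / p) + real m * s"
        using R s0 by (intro powr_root_add_le[OF p] add_nonneg_nonneg sum_nonneg) auto
      also have "?Q + ?t y A powr p = (\<Sum>B\<in>G1. ?t y B powr p) + R"
        unfolding sum.remove[OF fin(2) A(1)] by simp
      finally show ?thesis .
    qed
    have "family_norm p G (y + z)
        = ((\<Sum>A\<in>G1. ?t (y + z) A powr p) + (\<Sum>A\<in>G2. ?t z A powr p)) powr (1 / p)"
      unfolding family_norm_def split_G(1) sum.union_disjoint[OF fin(2,3) split_G(2)]
      using high by (simp cong: sum.cong del: plus_fun_apply)
    also have "\<dots> \<le> ((\<Sum>A\<in>G1. ?t y A powr p) + (\<Sum>A\<in>G2. ?t z A powr p)) powr (1 / p) + real m * s"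
      by (intro sum_G1 sum_nonneg) auto
    also have "((\<Sum>A\<in>G1. ?t y A powr p) + (\<Sum>A\<in>G2. ?t z A powr p)) powr (1 / p)
        \<le> (?N y powr p + ?N z powr p) powr (1 / p)"
    proof -
      have "(\<Sum>A\<in>G1. ?t y A powr p) \<le> (\<Sum>A\<in>G. ?t y A powr p)"
        using fin by (intro sum_mono2) (auto simp: G1_def)
      also have "\<dots> = family_norm p G y powr p"
        by (rule family_norm_powr[OF p, symmetric])
      also have "\<dots> \<le> ?N y powr p"
        using p family_norm_le[OF yz(1) G] family_norm_nonneg by (intro powr_mono2) auto
      finally have 1: "(\<Sum>A\<in>G1. ?t y A powr p) \<le> ?N y powr p" .
      have "(\<Sum>A\<in>G2. ?t z A powr p) \<le> (\<Sum>A\<in>G. ?t z A powr p)"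
        using fin by (intro sum_mono2) (auto simp: G2_def)
      also have "\<dots> = family_norm p G z powr p"
        by (rule family_norm_powr[OF p, symmetric])
      also have "\<dots> \<le> ?N z powr p"
        using p family_norm_le[OF yz(2) G] family_norm_nonneg by (intro powr_mono2) auto
      finally have "(\<Sum>A\<in>G2. ?t z A powr p) \<le> ?N z powr p" .
      with 1 show ?thesis
        using p by (intro powr_mono2 add_mono add_nonneg_nonneg sum_nonneg) auto
    qed
    finally show "family_norm p G (y + z) \<le> (?N y powr p + ?N z powr p) powr (1 / p) + real m * s"
      by (simp del: plus_fun_apply)
  qed
qed

lemma block_norm_baernstein:
  assumes p: "1 \<le> p"
  shows "block_norm (\<lambda>s t. (s powr p + t powr p) powr (1 / p))
    (baernstein_norm p :: (nat \<Rightarrow> 'k::{real_normed_field,banach}) \<Rightarrow> real)"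
proof -
  interpret family_system p baernstein_families
    by (rule family_system_baernstein[OF p])
  have eq: "baernstein_norm p = (sup_norm p baernstein_families :: (nat \<Rightarrow> 'k) \<Rightarrow> real)"
    using baernstein_norm_eq by blast
  show ?thesis
    unfolding eq
    by (rule block_norm_sup_norm[OF joining_p[OF p]])
      (fact sup_norm_baernstein_lower[OF p] sup_norm_baernstein_upper[OF p])+
qed


section \<open>The sequence spaces\<close>

lemma initial_norm_p:
  fixes a :: "nat \<Rightarrow> 'k::real_normed_field"
  assumes p: "1 \<le> p"
  shows "joining.initial_norm (\<lambda>s t. (s powr p + t powr p) powr (1 / p)) a n
    = (\<Sum>k=1..n. norm (a k) powr p) powr (1 / p)"
proof -
  interpret joining "\<lambda>s t. (s powr p + t powr p) powr (1 / p)"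
    by (rule joining_p[OF p])
  show ?thesis
    using p by (induction n) (simp_all add: powr_powr sum_nonneg)
qed

lemma joined_space_ell:
  assumes p: "1 \<le> p"
  shows "joined_space (\<lambda>s t. (s powr p + t powr p) powr (1 / p))
    (ell p :: ('k::{real_normed_field,banach}, nat \<Rightarrow> 'k) nspace)"
proof (intro joined_space.intro joined_space_axioms.intro joining_p[OF p])
  show "smul (ell p) = (seq_scale :: 'k \<Rightarrow> _)"
    by (simp add: ell_def)
  fix a :: "nat \<Rightarrow> 'k"
  show "a 0 = 0" if "a \<in> vecs (ell p)"
    using that by (simp add: ell_def)
  show "joining.initial_norm (\<lambda>s t. (s powr p + t powr p) powr (1 / p)) a n \<le> nrm (ell p) a"
    if "a \<in> vecs (ell p)" for n
  proof -
    have "(\<Sum>k=1..n. norm (a k) powr p) \<le> (\<Sum>k. norm (a k) powr p)"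
      using that by (intro sum_le_suminf) (auto simp: ell_def)
    then show ?thesis
      using p unfolding initial_norm_p[OF p] by (auto simp: ell_def intro!: powr_mono2 sum_nonneg)
  qed
  show "\<exists>M. \<forall>n. joining.initial_norm (\<lambda>s t. (s powr p + t powr p) powr (1 / p)) (\<lambda>k. if k \<le> M then 0 else a k) n \<le> \<epsilon>"
    if a: "a \<in> vecs (ell p)" and \<epsilon>: "0 < \<epsilon>" for \<epsilon>
  proof -
    have "summable (\<lambda>k. norm (a k) powr p)"
      using a by (simp add: ell_def)
    then obtain M where M: "\<And>m n. M \<le> m \<Longrightarrow> norm (\<Sum>k\<in>{m..<n}. norm (a k) powr p) < \<epsilon> powr p"
      using \<epsilon> unfolding summable_Cauchy by (metis powr_gt_zero less_irrefl)
    have "(\<Sum>k=1..n. norm (if k \<le> M then 0 else a k) powr p) powr (1 / p) \<le> \<epsilon>" for n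
    proof -
      have "(\<Sum>k=1..n. norm (if k \<le> M then 0 else a k) powr p) = (\<Sum>k\<in>{Suc M..<Suc n}. norm (a k) powr p)"
        using p by (intro sum.mono_neutral_cong_right) auto
      also have "\<dots> \<le> \<epsilon> powr p"
        using M[of "Suc M" "Suc n"] by simp
      finally have "(\<Sum>k=1..n. norm (if k \<le> M then 0 else a k) powr p) powr (1 / p) \<le> (\<epsilon> powr p) powr (1 / p)"
        using p by (intro powr_mono2 sum_nonneg) auto
      then show ?thesis
        using p \<epsilon> by (simp add: powr_powr)
    qed
    then show ?thesis
      unfolding initial_norm_p[OF p] by blast
  qed
  show "a \<in> vecs (ell p) \<and> nrm (ell p) a \<le> R"
    if a: "a 0 = 0" and le: "\<And>n. joining.initial_norm (\<lambda>s t. (s powr p + t powr p) powr (1 / p)) a n \<le> R" for R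
  proof -
    have R: "0 \<le> R"
      using le[of 0] by (simp add: initial_norm_p[OF p])
    have bound: "(\<Sum>k<n. norm (a k) powr p) \<le> R powr p" for n
    proof -
      have "(\<Sum>k<n. norm (a k) powr p) \<le> (\<Sum>k=0..n. norm (a k) powr p)"
        by (intro sum_mono2) auto
      also have "\<dots> = (\<Sum>k=1..n. norm (a k) powr p)"
        using a by (simp add: sum.atLeast_Suc_atMost)
      also have "\<dots> = ((\<Sum>k=1..n. norm (a k) powr p) powr (1 / p)) powr p"
        using p by (simp add: powr_powr sum_nonneg)
      also have "\<dots> \<le> R powr p"
        using le[of n] p unfolding initial_norm_p[OF p] by (intro powr_mono2) auto
      finally show ?thesis .
    qed
    have sum: "summable (\<lambda>k. norm (a k) powr p)"
      by (rule summableI_nonneg_bounded[OF _ bound]) simp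
    have "(\<Sum>k. norm (a k) powr p) powr (1 / p) \<le> (R powr p) powr (1 / p)"
      using p sum by (intro powr_mono2 suminf_le_const[OF sum bound] suminf_nonneg) auto
    then show ?thesis
      using a sum p R by (simp add: ell_def powr_powr)
  qed
qed

lemma initial_norm_max_le:
  assumes "0 \<le> R"
  shows "joining.initial_norm max a n \<le> R \<longleftrightarrow> (\<forall>k\<in>{1..n}. norm (a k) \<le> R)"
proof -
  interpret joining max
    by (rule joining_max)
  show ?thesis
    using assms by (induction n) (auto simp: le_Suc_eq)
qed

lemma joined_space_c_null:
  "joined_space max (c_null :: ('k::{real_normed_field,banach}, nat \<Rightarrow> 'k) nspace)"
proof (intro joined_space.intro joined_space_axioms.intro joining_max)
  show "smul c_null = (seq_scale :: 'k \<Rightarrow> _)"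
    by (simp add: c_null_def)
  fix a :: "nat \<Rightarrow> 'k"
  show "a 0 = 0" if "a \<in> vecs c_null"
    using that by (simp add: c_null_def)
  have nrm: "nrm c_null a = (SUP n. norm (a n))"
    by (simp add: c_null_def)
  show "joining.initial_norm max a n \<le> nrm c_null a" if "a \<in> vecs c_null" for n
  proof -
    have "Bseq a"
      using that by (intro convergent_imp_Bseq convergentI) (auto simp: c_null_def)
    then obtain K where "\<And>n. norm (a n) \<le> K"
      by (auto simp: Bseq_def)
    then have "bdd_above (range (\<lambda>n. norm (a n)))"
      by (intro bdd_aboveI[of _ K]) auto
    then have le: "norm (a k) \<le> nrm c_null a" for k
      unfolding nrm by (intro cSUP_upper) auto
    then show ?thesis
      using order_trans[OF norm_ge_zero le] by (subst initial_norm_max_le) auto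
  qed
  show "\<exists>M. \<forall>n. joining.initial_norm max (\<lambda>k. if k \<le> M then 0 else a k) n \<le> \<epsilon>"
    if a: "a \<in> vecs c_null" and \<epsilon>: "0 < \<epsilon>" for \<epsilon>
  proof -
    have "a \<longlonglongrightarrow> 0"
      using a by (simp add: c_null_def)
    then obtain M where "\<And>k. M \<le> k \<Longrightarrow> norm (a k) < \<epsilon>"
      using LIMSEQ_D[of a 0 \<epsilon>] \<epsilon> by auto
    then show ?thesis
      using \<epsilon> by (intro exI[of _ M] allI) (auto simp: initial_norm_max_le less_imp_le)
  qed
  show "a \<in> vecs c_null \<and> nrm c_null a \<le> R"
    if a: "a 0 = 0" "a \<longlonglongrightarrow> 0" and le: "\<And>n. joining.initial_norm max a n \<le> R" for R
  proof -
    interpret joining max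
      by (rule joining_max)
    have R: "0 \<le> R"
      using le[of 0] by simp
    then have "norm (a n) \<le> R" for n
      using le[of n] a(1) by (cases "n = 0") (auto simp: initial_norm_max_le)
    then have "(SUP n. norm (a n)) \<le> R"
      by (intro cSUP_least) auto
    then show ?thesis
      using a by (simp add: c_null_def)
  qed
qed


section \<open>Saturation of the Baernstein and Schreier spaces\<close>

lemma uniformly_saturated_completion:
  fixes E :: "('k::{real_normed_field,banach}, 'e::ab_group_add) nspace"
    and D :: "('k, nat \<Rightarrow> 'k) nspace"
  assumes N: "block_norm \<phi> N" and D: "joined_space \<phi> D"
    and E: "completion_of (c00_with N) E" and C: "C > 1"
  shows "uniformly_saturated_complemented C E D"
proof -
  obtain \<iota> where \<iota>: "banach_space E" "linear_between (c00_with N) E \<iota>"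
    "\<And>z. z \<in> c00 \<Longrightarrow> nrm E (\<iota> z) = N z" "ntopology E closure_of (\<iota> ` c00) = vecs E"
    using E by (auto simp: completion_of_def c00_with_def)
  interpret saturated_pair \<phi> N E \<iota> D
    by (intro saturated_pair.intro block_space.intro banach_nspace.intro block_space_axioms.intro N D \<iota>)
  show ?thesis
    by (rule uniformly_saturated[OF C])
qed

lemma baernstein_saturated:
  fixes E :: "('k::{real_normed_field,banach}, 'e::ab_group_add) nspace"
  assumes "1 < p" "completion_of (c00_with (baernstein_norm p)) E" "C > 1"
  shows "uniformly_saturated_complemented C E (ell p)"
  by (rule uniformly_saturated_completion[OF block_norm_baernstein joined_space_ell assms(2,3)])
    (use assms(1) in simp_all)

lemma schreier_saturated:
  fixes E :: "('k::{real_normed_field,banach}, 'e::ab_group_add) nspace"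
  assumes "1 \<le> p" "completion_of (c00_with (schreier_norm p)) E" "C > 1"
  shows "uniformly_saturated_complemented C E c_null"
  by (rule uniformly_saturated_completion[OF block_norm_schreier[OF assms(1)] joined_space_c_null assms(2,3)])

theorem theorem2p4:
  fixes E :: "(real, 'e::ab_group_add) nspace"
    and E' :: "(complex, 'f::ab_group_add) nspace"
    and p C :: real
  assumes "C > 1"
  shows
    "(1 < p \<and> completion_of (c00_with (baernstein_norm p)) E \<longrightarrow>
        uniformly_saturated_complemented C E (ell p)) \<and>
     (1 \<le> p \<and> completion_of (c00_with (schreier_norm p)) E \<longrightarrow>
        uniformly_saturated_complemented C E c_null) \<and>
     (1 < p \<and> completion_of (c00_with (baernstein_norm p)) E' \<longrightarrow>
        uniformly_saturated_complemented C E' (ell p)) \<and>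
     (1 \<le> p \<and> completion_of (c00_with (schreier_norm p)) E' \<longrightarrow>
        uniformly_saturated_complemented C E' c_null)"
  by (intro conjI impI; elim conjE) (simp_all add: baernstein_saturated schreier_saturated assms)

end
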